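(* (Quanto domestic option.) In the two-dimensional Black–Scholes model of the context let $H=S^2_T(S^1_T-K)^+$ with $K>0$, and let $c\ge0$. (linear loss) $$\Psi_1(c)=S^2_0e^{(\alpha_2-\frac12\sigma_2^2)T}\int_{a_1}^{+\infty}\int_{\frac{\ln c-BT-A_1x}{A_2}}^{+\infty}\left(S^1_0e^{(\alpha_1-\frac12\sigma_1^2)T+\sigma_1x}-K\right)e^{\sigma_2y}f_{W^2_T\mid W^1_T=x}(y)f_{W^1_T}(x)\,dy\,dx,$$ $$\Psi_2(c)=S^2_0e^{(r-\frac12\sigma_2^2)T}\int_{\tilde a_1}^{+\infty}\int_{\frac{\ln c-\tilde BT-A_1x}{A_2}}^{+\infty}\left(S^1_0e^{(r-\frac12\sigma_1^2)T+\sigma_1x}-K\right)e^{\sigma_2y}\tilde f_{\widetilde W^2_T\mid\widetilde W^1_T=x}(y)\,dy\,\tilde f_{\widetilde W^1_T}(x)\,dx.$$ (power loss, $p>1$) Assume $\frac{A_2}{p-1}+\sigma_2>0$ and define $$w(x):=\frac{\frac{A_1}{p-1}x+\ln\left(\frac{S^2_0\left(S^1_0e^{(\alpha_1-\frac12\sigma_1^2)T+\sigma_1x}-K\right)}{c^{1/(p-1)}}\right)+\left(B+\alpha_2-\frac12\sigma_2^2\right)T}{-\left(\frac{A_2}{p-1}+\sigma_2\right)},$$ $$\tilde w(x):=\frac{\frac{A_1}{p-1}x+\ln\left(\frac{S^2_0\left(S^1_0e^{(r-\frac12\sigma_1^2)T+\sigma_1x}-K\right)}{c^{1/(p-1)}}\right)+\left(\tilde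 B+r-\frac12\sigma_2^2\right)T}{-\left(\frac{A_2}{p-1}+\sigma_2\right)}.$$ Then $$\Psi^p_1(c)=\frac{(S^2_0)^pe^{(\alpha_2-\frac12\sigma_2^2)pT}}p\left(\int_{a_1}^{+\infty}\int_{-\infty}^{+\infty}g(x,y)\,dy\,dx-\int_{a_1}^{+\infty}\int_{w(x)}^{+\infty}g(x,y)\,dy\,dx\right)$$ $$+\frac{c^{\frac p{p-1}}e^{-\frac{BTp}{p-1}}}p\int_{a_1}^{+\infty}\int_{w(x)}^{+\infty}e^{-\left(\frac{A_1p}{p-1}x+\frac{A_2p}{p-1}y\right)}f_{W^2_T\mid W^1_T=x}(y)f_{W^1_T}(x)\,dy\,dx,$$ where $g(x,y)=e^{p\sigma_2y}\left(S^1_0e^{(\alpha_1-\frac12\sigma_1^2)T+\sigma_1x}-K\right)^pf_{W^2_T\mid W^1_T=x}(y)f_{W^1_T}(x)$, and $$\Psi^p_2(c)=S^2_0e^{(r-\frac12\sigma_2^2)T}\int_{\tilde a_1}^{+\infty}\int_{\tilde w(x)}^{+\infty}e^{\sigma_2y}\left(S^1_0e^{(r-\frac12\sigma_1^2)T+\sigma_1x}-K\right)\tilde f_{\widetilde W^2_T\mid\widetilde W^1_T=x}(y)\tilde f_{\widetilde W^1_T}(x)\,dy\,dx$$ $$-c^{\frac1{p-1}}e^{-\frac{\tilde BT}{p-1}}\int_{\tilde a_1}^{+\infty}\int_{\tilde w(x)}^{+\infty}e^{-\frac1{p-1}(A_1x+A_2y)}\tilde f_{\widetilde W^2_T\mid\widetilde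 W^1_T=x}(y)\tilde f_{\widetilde W^1_T}(x)\,dy\,dx.$$
   Context: Model. $T>0$; $(W^1,W^2)$ is a Wiener process under $P$ with positive definite correlation matrix $Q=\begin{pmatrix}1&\rho\\\rho&1\end{pmatrix}$. Stocks $dS^i_t=S^i_t(\alpha_i\,dt+\sigma_i\,dW^i_t)$, $i=1,2$, with $\alpha_i\in\mathbb R$, $\sigma_i>0$, and constant interest rate $r$. Let $\theta_i=\frac{\alpha_i-r}{\sigma_i}$, $\theta=(\theta_1,\theta_2)^T$, $\widetilde W^i_t=W^i_t+\theta_it$. The martingale measure $\tilde P$ has density $\tilde Z_T=e^{-A_1W^1_T-A_2W^2_T-BT}=e^{-A_1\widetilde W^1_T-A_2\widetilde W^2_T-\tilde BT}$ with respect to $P$, where $(A_1,A_2)^T=Q^{-1}\theta$, $B=\frac12|Q^{-1/2}\theta|^2$, $\tilde B=B-A_1\theta_1-A_2\theta_2$; under $\tilde P$, $\widetilde W=(\widetilde W^1,\widetilde W^2)$ is a Wiener process with correlation matrix $Q$. $\mathbf E,\tilde{\mathbf E}$ are expectations under $P,\tilde P$; $f$ denotes (conditional) densities under $P$ and $\tilde f$ under $\tilde P$. Constants: $a_1=\frac1{\sigma_1}\left(\ln\frac K{S^1_0}-(\alpha_1-\frac12\sigma_1^2)T\right)$, $\tilde a_1=\frac1{\sigma_1}\left(\ln\frac K{S^1_0}-(r-\frac12\sigma_1^2)T\right)$. Risk auxiliary functions. Linear loss $l(x)=x$: $\Psi_1(c)=\mathbf E[H\mathbf 1_{\{\tilde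 Z_T^{-1}\ge c\}}]$, $\Psi_2(c)=\tilde{\mathbf E}[H\mathbf 1_{\{\tilde Z_T^{-1}\ge c\}}]$. Power loss $l(x)=x^p/p$, $p>1$: with $\varphi_c:=\left\{1-\left(\frac{(c\tilde Z_T)^{1/(p-1)}}{H}\wedge1\right)\right\}\mathbf 1_{\{H>0\}}$, $\Psi^p_1(c)=\frac1p\mathbf E[((1-\varphi_c)H)^p]$ and $\Psi^p_2(c)=\tilde{\mathbf E}[H\varphi_c]$. Convention: $\ln0=-\infty$.
   Formalization: The linear-loss formulas are stated for A_2>0 (for A_2<0 the region is reversed, for A_2=0 the limit is undefined), and in w and w̃ the terms B and B̃ are corrected to B/(p-1) and B̃/(p-1); as printed these are false in general for p≠2. *)

theory Defs
  imports "HOL-Probability.Probability"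
begin

definition positive_definite :: "real^'n^'n \<Rightarrow> bool" where
  "positive_definite C \<longleftrightarrow> transpose C = C \<and> (\<forall>z. z \<noteq> 0 \<longrightarrow> z \<bullet> (C *v z) > 0)"

text \<open>\<open>C\<^sup>-\<^sup>1\<^sup>/\<^sup>2\<close>, for positive definite \<open>C\<close>.\<close>

definition matrix_inv_sqrt :: "real^'n^'n \<Rightarrow> real^'n^'n" where
  "matrix_inv_sqrt C = (THE R. positive_definite R \<and> R ** R = matrix_inv C)"

definition gauss2_density :: "real^2^2 \<Rightarrow> real \<times> real \<Rightarrow> real" where
  "gauss2_density C = (\<lambda>(x, y). let z = vector [x, y] :: real^2 in
     exp (- (z \<bullet> (matrix_inv C *v z)) / 2) / (2 * pi * sqrt (det C)))"

text \<open>Filtrations in the library are indexed by the whole type of times; only the indices in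
  \<open>[0, T]\<close> matter here.\<close>

definition wiener2 ::
  "'a measure \<Rightarrow> (real \<Rightarrow> 'a measure) \<Rightarrow> real \<Rightarrow> real^2^2
    \<Rightarrow> (real \<Rightarrow> 'a \<Rightarrow> real) \<Rightarrow> (real \<Rightarrow> 'a \<Rightarrow> real) \<Rightarrow> bool" where
  "wiener2 M F T Q W1 W2 \<longleftrightarrow>
     prob_space M \<and> filtration (space M) F \<and>
     (\<forall>t\<in>{0..T}. subalgebra M (F t) \<and>
        W1 t \<in> borel_measurable (F t) \<and> W2 t \<in> borel_measurable (F t)) \<and>
     (AE \<omega> in M. W1 0 \<omega> = 0 \<and> W2 0 \<omega> = 0) \<and>
     (\<forall>\<omega>\<in>space M. continuous_on {0..T} (\<lambda>t. W1 t \<omega>) \<and> continuous_on {0..T} (\<lambda>t. W2 t \<omega>)) \<and>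
     (\<forall>s t. 0 \<le> s \<and> s < t \<and> t \<le> T \<longrightarrow>
        (let D = (\<lambda>\<omega>. (W1 t \<omega> - W1 s \<omega>, W2 t \<omega> - W2 s \<omega>)) in
          prob_space.indep_set M (sets (F s))
            (sets (vimage_algebra (space M) D (borel \<Otimes>\<^sub>M borel))) \<and>
          distributed M (lborel \<Otimes>\<^sub>M lborel) D
            (\<lambda>z. ennreal (gauss2_density ((t - s) *\<^sub>R Q) z))))"

text \<open>A list of triples \<open>(u, v, \<xi>)\<close> stands for the step process
  \<open>\<Sum> \<xi> 1\<^bsub>(u, v]\<^esub>\<close>; the intervals need not be disjoint.\<close>

type_synonym 'a steps = "(real \<times> real \<times> ('a \<Rightarrow> real)) list"

definition adapted_steps :: "'a measure \<Rightarrow> (real \<Rightarrow> 'a measure) \<Rightarrow> real \<Rightarrow> 'a steps \<Rightarrow> bool" where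
  "adapted_steps M F T L \<longleftrightarrow>
     (\<forall>(u, v, \<xi>)\<in>set L. 0 \<le> u \<and> u \<le> v \<and> v \<le> T \<and>
        \<xi> \<in> borel_measurable (F u) \<and> integrable M (\<lambda>\<omega>. (\<xi> \<omega>)\<^sup>2))"

definition step_process :: "'a steps \<Rightarrow> real \<Rightarrow> 'a \<Rightarrow> real" where
  "step_process L s \<omega> = (\<Sum>(u, v, \<xi>)\<leftarrow>L. \<xi> \<omega> * indicator {u<..v} s)"

definition step_integral :: "(real \<Rightarrow> 'a \<Rightarrow> real) \<Rightarrow> 'a steps \<Rightarrow> real \<Rightarrow> 'a \<Rightarrow> real" where
  "step_integral W L t \<omega> = (\<Sum>(u, v, \<xi>)\<leftarrow>L. \<xi> \<omega> * (W (min v t) \<omega> - W (min u t) \<omega>))"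

text \<open>\<open>J = \<integral>\<^sub>0\<^sup>t X\<^sub>s dW\<^sub>s\<close>, as the \<open>L\<^sup>2\<close> limit of the integrals of step processes tending to \<open>X\<close>
  in \<open>L\<^sup>2([0, t] \<times> M)\<close>.\<close>

definition has_ito_integral ::
  "'a measure \<Rightarrow> (real \<Rightarrow> 'a measure) \<Rightarrow> real \<Rightarrow> (real \<Rightarrow> 'a \<Rightarrow> real)
    \<Rightarrow> (real \<Rightarrow> 'a \<Rightarrow> real) \<Rightarrow> real \<Rightarrow> ('a \<Rightarrow> real) \<Rightarrow> bool" where
  "has_ito_integral M F T W X t J \<longleftrightarrow>
     J \<in> borel_measurable M \<and>
     (\<exists>L :: nat \<Rightarrow> 'a steps. (\<forall>n. adapted_steps M F T (L n)) \<and>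
        (\<lambda>n. \<integral>\<^sup>+\<omega>. (\<integral>\<^sup>+s\<in>{0..t}. ennreal ((step_process (L n) s \<omega> - X s \<omega>)\<^sup>2) \<partial>lborel) \<partial>M)
          \<longlonglongrightarrow> 0 \<and>
        (\<lambda>n. \<integral>\<^sup>+\<omega>. ennreal ((step_integral W (L n) t \<omega> - J \<omega>)\<^sup>2) \<partial>M) \<longlonglongrightarrow> 0)"

text \<open>\<open>dX\<^sub>t = b(X\<^sub>t) dt + a(X\<^sub>t) dW\<^sub>t\<close> on \<open>[0, T]\<close>, with \<open>X\<^sub>0 = x0\<close>.\<close>

definition solves_sde ::
  "'a measure \<Rightarrow> (real \<Rightarrow> 'a measure) \<Rightarrow> real \<Rightarrow> (real \<Rightarrow> 'a \<Rightarrow> real)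
    \<Rightarrow> (real \<Rightarrow> real) \<Rightarrow> (real \<Rightarrow> real) \<Rightarrow> real \<Rightarrow> (real \<Rightarrow> 'a \<Rightarrow> real) \<Rightarrow> bool" where
  "solves_sde M F T W b a x0 X \<longleftrightarrow>
     (\<forall>t\<in>{0..T}. X t \<in> borel_measurable (F t)) \<and>
     (\<forall>\<omega>\<in>space M. continuous_on {0..T} (\<lambda>t. X t \<omega>)) \<and>
     (\<forall>t\<in>{0..T}. \<exists>J. has_ito_integral M F T W (\<lambda>s \<omega>. a (X s \<omega>)) t J \<and>
        (AE \<omega> in M. X t \<omega> = x0 + (LBINT s=ereal 0..ereal t. b (X s \<omega>)) + J \<omega>))"

text \<open>Densities are determined only almost everywhere; the predicates below hold for every
  version.\<close>

definition is_density :: "'a measure \<Rightarrow> ('a \<Rightarrow> real) \<Rightarrow> (real \<Rightarrow> real) \<Rightarrow> bool" where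
  "is_density M X f \<longleftrightarrow>
     (\<forall>x. 0 \<le> f x) \<and> distributed M lborel X (\<lambda>x. ennreal (f x))"

text \<open>\<open>k x y\<close> is the conditional density at \<open>y\<close> of \<open>Y\<close> given \<open>X = x\<close>: multiplied by a density of
  \<open>X\<close>, it gives a joint density of \<open>X\<close> and \<open>Y\<close>.\<close>

definition is_cond_density ::
  "'a measure \<Rightarrow> ('a \<Rightarrow> real) \<Rightarrow> ('a \<Rightarrow> real) \<Rightarrow> (real \<Rightarrow> real \<Rightarrow> real) \<Rightarrow> bool" where
  "is_cond_density M Y X k \<longleftrightarrow>
     (\<forall>x y. 0 \<le> k x y) \<and> (\<lambda>(x, y). k x y) \<in> borel_measurable (borel \<Otimes>\<^sub>M borel) \<and>
     (\<forall>f. is_density M X f \<longrightarrow>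
        distributed M (lborel \<Otimes>\<^sub>M lborel) (\<lambda>\<omega>. (X \<omega>, Y \<omega>))
          (\<lambda>(x, y). ennreal (k x y * f x)))"

text \<open>\<open>H\<close> is the payoff, \<open>Z\<close> the density of the martingale measure. The functions \<open>\<Psi>\<^sub>1\<close> and \<open>\<Psi>\<^sub>2\<close>
  are \<open>linear_risk\<close> for \<open>M\<close> the original and the martingale measure, respectively.\<close>

definition linear_risk :: "'a measure \<Rightarrow> ('a \<Rightarrow> real) \<Rightarrow> ('a \<Rightarrow> real) \<Rightarrow> real \<Rightarrow> real" where
  "linear_risk M Z H c = (\<integral>\<omega>. H \<omega> * indicator {\<omega>. inverse (Z \<omega>) \<ge> c} \<omega> \<partial>M)"

definition power_test :: "real \<Rightarrow> ('a \<Rightarrow> real) \<Rightarrow> ('a \<Rightarrow> real) \<Rightarrow> real \<Rightarrow> 'a \<Rightarrow> real" where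
  "power_test p Z H c \<omega> =
     (1 - min ((c * Z \<omega>) powr (1 / (p - 1)) / H \<omega>) 1) * indicator {\<omega>. H \<omega> > 0} \<omega>"

definition power_risk1 ::
  "'a measure \<Rightarrow> real \<Rightarrow> ('a \<Rightarrow> real) \<Rightarrow> ('a \<Rightarrow> real) \<Rightarrow> real \<Rightarrow> real" where
  "power_risk1 M p Z H c = 1 / p * (\<integral>\<omega>. ((1 - power_test p Z H c \<omega>) * H \<omega>) powr p \<partial>M)"

definition power_risk2 ::
  "'a measure \<Rightarrow> real \<Rightarrow> ('a \<Rightarrow> real) \<Rightarrow> ('a \<Rightarrow> real) \<Rightarrow> real \<Rightarrow> real" where
  "power_risk2 M p Z H c = (\<integral>\<omega>. H \<omega> * power_test p Z H c \<omega> \<partial>M)"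

text \<open>The library has \<open>ln 0 = 0\<close>. Limits of integration are computed in \<open>ereal\<close>, where
  \<open>x / 0 = \<infinity>\<close> for \<open>x > 0\<close>, so that \<open>c = 0\<close> is covered.\<close>

definition ext_ln :: "ereal \<Rightarrow> ereal" where
  "ext_ln x = (if x \<le> 0 then -\<infinity> else if x = \<infinity> then \<infinity> else ereal (ln (real_of_ereal x)))"

end

theory Submission
  imports Defs
begin

text \<open>The stochastic part is that the solution \<open>S\<close> of a linear equation is the geometric Brownian
  motion \<open>G\<close>. On a grid of mesh \<open>h\<close>, both satisfy the Euler recursion up to a drift error of
  square mean \<open>O(h\<^sup>3)\<close>, respectively \<open>o(h\<^sup>2)\<close>, and an error orthogonal to the past of square mean
  \<open>O(h\<^sup>2)\<close>, respectively \<open>o(h)\<close>; for \<open>S\<close> this follows from the isometry, for \<open>G\<close> from Gaussian moments.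
  A discrete Gronwall argument then gives \<open>S\<^sub>T = G\<^sub>T\<close> almost surely. So payoff and density are
  functions of the terminal values of the Wiener processes, whose joint density is given under either
  measure, and the formulas follow from Fubini's theorem, with the limits of integration obtained by
  taking logarithms in \<open>Z\<^sup>-\<^sup>1 \<ge> c\<close> and in \<open>H > (cZ)\<^sup>1\<^sup>/\<^sup>(\<^sup>p\<^sup>-\<^sup>1\<^sup>)\<close>.\<close>

section \<open>Scalar Wiener processes and the isometry for step processes\<close>

text \<open>The definition of the stochastic integral shapes the argument:
  \<open>has_ito_integral\<close> speaks of one time t, through a sequence of step processes
  belonging to that t alone, and the equation for S holds outside a null set depending on t.
  Increments between two times have to be reconciled by the isometry, and S and G are compared only
  through second moments at finitely many grid times. The required orders come from counting: there
  are T/h steps. Errors orthogonal to the past add up in square mean, so o(h) each suffices. Drift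
  errors are correlated with the accumulated error; splitting that cross term with weight h
  multiplies their square mean by 1 + 1/h, so o(h^2) each is needed. The orders for S are reached by
  bootstrapping: finiteness of the time integral of E S^2, then a uniform bound for E S^2, then E
  (S_t - S_s)^2 = O(t - s). For G they are read off from closed formulas whose first-order terms at
  h = 0 cancel.\<close>

lemma normal_density_exp_shift:
  assumes "s > 0"
  shows "exp (a * x) * normal_density 0 s x = exp (a\<^sup>2 * s\<^sup>2 / 2) * normal_density (a * s\<^sup>2) s x"
proof -
  have "a * x + - (x - 0)\<^sup>2 / (2 * s\<^sup>2) = a\<^sup>2 * s\<^sup>2 / 2 + - (x - a * s\<^sup>2)\<^sup>2 / (2 * s\<^sup>2)"
    using assms by (simp add: field_simps power2_eq_square)
  then show ?thesis
    unfolding normal_density_def by (simp add: exp_add[symmetric] mult.assoc mult.left_commute)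
qed

text \<open>By completing the square, the weight \<open>exp (a * x)\<close> turns the centred normal
  density into a constant times the normal density with mean \<open>a * s\<^sup>2\<close>. The
  exponential moment is the total mass of the tilted density; the next lemma uses its mean in the
  same way.\<close>

lemma normal_exp_moment:
  assumes "s > 0"
  shows "has_bochner_integral lborel (\<lambda>x. normal_density 0 s x * exp (a * x)) (exp (a\<^sup>2 * s\<^sup>2 / 2))"
proof -
  have "has_bochner_integral lborel (normal_density (a * s\<^sup>2) s) 1"
    using assms by (simp add: has_bochner_integral_iff)
  from has_bochner_integral_mult_right[OF this, of "exp (a\<^sup>2 * s\<^sup>2 / 2)"] show ?thesis
    using normal_density_exp_shift[OF assms, of a] by (simp add: mult.commute)
qed

lemma normal_exp_moment_1:
  assumes "s > 0"
  shows "has_bochner_integral lborel (\<lambda>x. normal_density 0 s x * (x * exp (a * x)))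
    (a * s\<^sup>2 * exp (a\<^sup>2 * s\<^sup>2 / 2))"
proof -
  have *: "exp (a\<^sup>2 * s\<^sup>2 / 2) * (normal_density (a * s\<^sup>2) s x * x) = normal_density 0 s x * (x * exp (a * x))" for x
    using normal_density_exp_shift[OF assms, of a x] by (simp add: ac_simps)
  have **: "exp (a\<^sup>2 * s\<^sup>2 / 2) * (a * s\<^sup>2) = a * s\<^sup>2 * exp (a\<^sup>2 * s\<^sup>2 / 2)" by simp
  show ?thesis
    using has_bochner_integral_mult_right[OF normal_moment_nz_1[OF assms, of "a * s\<^sup>2"], of "exp (a\<^sup>2 * s\<^sup>2 / 2)"]
    unfolding * ** by simp
qed

lemma integrable_mult_square_integrable:
  fixes f g :: "'a \<Rightarrow> real"
  assumes [measurable]: "f \<in> borel_measurable M" "g \<in> borel_measurable M"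
    and "integrable M (\<lambda>x. (f x)\<^sup>2)" "integrable M (\<lambda>x. (g x)\<^sup>2)"
  shows "integrable M (\<lambda>x. f x * g x)"
proof (rule Bochner_Integration.integrable_bound)
  show "integrable M (\<lambda>x. (f x)\<^sup>2 + (g x)\<^sup>2)" using assms by simp
  have "\<bar>f x * g x\<bar> \<le> (f x)\<^sup>2 + (g x)\<^sup>2" for x
  proof -
    have "0 \<le> (\<bar>f x\<bar> - \<bar>g x\<bar>)\<^sup>2" by simp
    then have "2 * (\<bar>f x\<bar> * \<bar>g x\<bar>) \<le> (f x)\<^sup>2 + (g x)\<^sup>2" by (simp add: power2_diff)
    moreover have "0 \<le> \<bar>f x\<bar> * \<bar>g x\<bar>" by (rule mult_nonneg_nonneg) simp_all
    ultimately show ?thesis unfolding abs_mult by linarith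
  qed
  then show "AE x in M. norm (f x * g x) \<le> norm ((f x)\<^sup>2 + (g x)\<^sup>2)" by simp
qed simp

lemma integrable_square_add:
  fixes f g :: "'a \<Rightarrow> real"
  assumes [measurable]: "f \<in> borel_measurable M" "g \<in> borel_measurable M"
    and "integrable M (\<lambda>x. (f x)\<^sup>2)" "integrable M (\<lambda>x. (g x)\<^sup>2)"
  shows "integrable M (\<lambda>x. (f x + g x)\<^sup>2)"
  unfolding power2_sum using assms integrable_mult_square_integrable[OF assms]
  by (simp add: mult.assoc)

lemma integrable_square_cmult:
  fixes f :: "'a \<Rightarrow> real"
  assumes "integrable M (\<lambda>x. (f x)\<^sup>2)"
  shows "integrable M (\<lambda>x. (c * f x)\<^sup>2)"
  unfolding power_mult_distrib using assms by simp

text \<open>One coordinate of the two-dimensional process. The filtration is kept as a parameter,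
  since both coordinates live on the same one. Independence is phrased for real variables known at
  time s, so that expectations of products factorise directly.\<close>

locale scalar_wiener = prob_space M + filtration "space M" F
  for M :: "'a measure" and F :: "real \<Rightarrow> 'a measure" +
  fixes T :: real and W :: "real \<Rightarrow> 'a \<Rightarrow> real"
  assumes subalg: "0 \<le> t \<Longrightarrow> t \<le> T \<Longrightarrow> subalgebra M (F t)"
    and adapted: "0 \<le> t \<Longrightarrow> t \<le> T \<Longrightarrow> W t \<in> borel_measurable (F t)"
    and starts_0: "AE \<omega> in M. W 0 \<omega> = 0"
    and increment_indep: "0 \<le> s \<Longrightarrow> s < t \<Longrightarrow> t \<le> T \<Longrightarrow> Y \<in> borel_measurable (F s) \<Longrightarrow>
      indep_var borel Y borel (\<lambda>\<omega>. W t \<omega> - W s \<omega>)"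
    and increment_normal: "0 \<le> s \<Longrightarrow> s < t \<Longrightarrow> t \<le> T \<Longrightarrow>
      distributed M lborel (\<lambda>\<omega>. W t \<omega> - W s \<omega>) (normal_density 0 (sqrt (t - s)))"
begin

lemma F_measurable:
  assumes "0 \<le> t" "t \<le> T" "f \<in> borel_measurable (F t)"
  shows "f \<in> borel_measurable M"
  using measurable_from_subalg[OF subalg] assms by blast

lemma F_mono_measurable:
  assumes "s \<le> t" "f \<in> borel_measurable (F s)"
  shows "f \<in> borel_measurable (F t)"
  using assms sets_F_mono[of s t] space_F unfolding measurable_def by auto

lemma W_measurable:
  assumes "0 \<le> t" "t \<le> T"
  shows "W t \<in> borel_measurable M"
  using F_measurable adapted assms by blast

lemma increment_exp:
  assumes "0 \<le> s" "s < t" "t \<le> T"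
  shows "has_bochner_integral M (\<lambda>\<omega>. exp (a * (W t \<omega> - W s \<omega>))) (exp (a\<^sup>2 * (t - s) / 2))"
  using normal_exp_moment[of "sqrt (t - s)" a] assms
    distributed_integral[OF increment_normal[OF assms], of "\<lambda>x. exp (a * x)"]
    distributed_integrable[OF increment_normal[OF assms], of "\<lambda>x. exp (a * x)"]
  by (simp add: has_bochner_integral_iff)

lemma increment_exp_1:
  assumes "0 \<le> s" "s < t" "t \<le> T"
  shows "has_bochner_integral M (\<lambda>\<omega>. (W t \<omega> - W s \<omega>) * exp (a * (W t \<omega> - W s \<omega>)))
    (a * (t - s) * exp (a\<^sup>2 * (t - s) / 2))"
  using normal_exp_moment_1[of "sqrt (t - s)" a] assms
    distributed_integral[OF increment_normal[OF assms], of "\<lambda>x. x * exp (a * x)"]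
    distributed_integrable[OF increment_normal[OF assms], of "\<lambda>x. x * exp (a * x)"]
  by (simp add: has_bochner_integral_iff)

lemma increment_square:
  assumes "0 \<le> s" "s < t" "t \<le> T"
  shows "has_bochner_integral M (\<lambda>\<omega>. (W t \<omega> - W s \<omega>)\<^sup>2) (t - s)"
  using normal_moment_even[of "sqrt (t - s)" 0 1] assms
    distributed_integral[OF increment_normal[OF assms], of "\<lambda>x. x\<^sup>2"]
    distributed_integrable[OF increment_normal[OF assms], of "\<lambda>x. x\<^sup>2"]
  by (simp add: has_bochner_integral_iff)

text \<open>Independence of the past and the increment factorises the expectation. The function
  \<open>g\<close> is left free: the identity, squares, and the remainder of geometric Brownian
  motion are all inserted later.\<close>

lemma mult_increment:
  fixes g :: "real \<Rightarrow> real"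
  assumes "0 \<le> s" "s < t" "t \<le> T" and Y: "Y \<in> borel_measurable (F s)" "integrable M Y"
    and [measurable]: "g \<in> borel_measurable borel"
    and g: "has_bochner_integral M (\<lambda>\<omega>. g (W t \<omega> - W s \<omega>)) x"
  shows "has_bochner_integral M (\<lambda>\<omega>. Y \<omega> * g (W t \<omega> - W s \<omega>)) (expectation Y * x)"
proof -
  have "indep_var borel (id \<circ> Y) borel (g \<circ> (\<lambda>\<omega>. W t \<omega> - W s \<omega>))"
    by (rule indep_var_compose[OF increment_indep]) (use assms in auto)
  then have *: "indep_var borel Y borel (\<lambda>\<omega>. g (W t \<omega> - W s \<omega>))" by (simp add: comp_def)
  show ?thesis
    using indep_var_lebesgue_integral[OF * Y(2)] indep_var_integrable[OF * Y(2)] g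
    by (simp add: has_bochner_integral_iff)
qed

text \<open>The martingale property in integrated form. The case s = t is included because step
  processes may contain empty intervals, where no normal density is available.\<close>

lemma mult_increment_1:
  assumes "0 \<le> s" "s \<le> t" "t \<le> T" and Y: "Y \<in> borel_measurable (F s)" "integrable M Y"
  shows "has_bochner_integral M (\<lambda>\<omega>. Y \<omega> * (W t \<omega> - W s \<omega>)) 0"
proof (cases "s = t")
  case False
  \<comment> \<open>The mean of an increment is the case a = 0 of the first exponential
    moment.\<close>
  then show ?thesis using mult_increment[of s t Y "\<lambda>x. x" 0] assms increment_exp_1[of s t 0] by simp
qed (simp add: has_bochner_integral_iff)

lemma mult_increment_square:
  assumes "0 \<le> s" "s \<le> t" "t \<le> T" and Y: "Y \<in> borel_measurable (F s)" "integrable M Y"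
  shows "has_bochner_integral M (\<lambda>\<omega>. Y \<omega> * (W t \<omega> - W s \<omega>)\<^sup>2) (expectation Y * (t - s))"
proof (cases "s = t")
  case False
  then show ?thesis
    using mult_increment[of s t Y "\<lambda>x. x\<^sup>2" "t - s"] assms increment_square[of s t] by simp
qed (simp add: has_bochner_integral_iff)

lemma square_mult_increment:
  assumes "0 \<le> s" "s \<le> t" "t \<le> T" and Y: "Y \<in> borel_measurable (F s)" "integrable M (\<lambda>\<omega>. (Y \<omega>)\<^sup>2)"
  shows "integrable M (\<lambda>\<omega>. (Y \<omega> * (W t \<omega> - W s \<omega>))\<^sup>2)"
  using mult_increment_square[OF assms(1-3) _ Y(2)] Y(1)
  by (simp add: has_bochner_integral_iff power_mult_distrib)

text \<open>Cut the longer interval at the earlier endpoint: the common part contributes the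
  variance, and the rest is a later increment, hence orthogonal to everything before it.\<close>

lemma mult_increments_same_start:
  assumes "0 \<le> s" "s \<le> t" "s \<le> t'" "t \<le> T" "t' \<le> T"
    and Y: "Y \<in> borel_measurable (F s)" "integrable M (\<lambda>\<omega>. (Y \<omega>)\<^sup>2)"
    and Y': "Y' \<in> borel_measurable (F s)" "integrable M (\<lambda>\<omega>. (Y' \<omega>)\<^sup>2)"
  shows "has_bochner_integral M (\<lambda>\<omega>. (Y \<omega> * (W t \<omega> - W s \<omega>)) * (Y' \<omega> * (W t' \<omega> - W s \<omega>)))
    ((\<integral>\<omega>. Y \<omega> * Y' \<omega> \<partial>M) * (min t t' - s))"
proof -
  have *: "has_bochner_integral M (\<lambda>\<omega>. (Y \<omega> * (W t \<omega> - W s \<omega>)) * (Y' \<omega> * (W t' \<omega> - W s \<omega>)))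
    ((\<integral>\<omega>. Y \<omega> * Y' \<omega> \<partial>M) * (t - s))"
    if "0 \<le> s" "s \<le> t" "t \<le> t'" "t' \<le> T"
      and Y: "Y \<in> borel_measurable (F s)" "integrable M (\<lambda>\<omega>. (Y \<omega>)\<^sup>2)"
      and Y': "Y' \<in> borel_measurable (F s)" "integrable M (\<lambda>\<omega>. (Y' \<omega>)\<^sup>2)" for t t' Y Y'
  proof -
    have st: "s \<le> T" "t \<le> T" using that by auto
    have I: "integrable M (\<lambda>\<omega>. Y \<omega> * Y' \<omega>)"
      using that st by (intro integrable_mult_square_integrable F_measurable[of s]) auto
    have "has_bochner_integral M (\<lambda>\<omega>. (Y \<omega> * Y' \<omega>) * (W t \<omega> - W s \<omega>)\<^sup>2)
        ((\<integral>\<omega>. Y \<omega> * Y' \<omega> \<partial>M) * (t - s))"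
      using that st I by (intro mult_increment_square) auto
    moreover have "has_bochner_integral M (\<lambda>\<omega>. ((Y \<omega> * (W t \<omega> - W s \<omega>)) * Y' \<omega>) * (W t' \<omega> - W t \<omega>)) 0"
    proof (rule mult_increment_1)
      show "(\<lambda>\<omega>. Y \<omega> * (W t \<omega> - W s \<omega>) * Y' \<omega>) \<in> borel_measurable (F t)"
        using F_mono_measurable[OF \<open>s \<le> t\<close> Y(1)] F_mono_measurable[OF \<open>s \<le> t\<close> Y'(1)]
          F_mono_measurable[OF \<open>s \<le> t\<close> adapted] adapted[of t] that st by auto
      show "integrable M (\<lambda>\<omega>. Y \<omega> * (W t \<omega> - W s \<omega>) * Y' \<omega>)"
        using that st W_measurable[of s] W_measurable[of t] F_measurable[OF _ _ Y(1)] F_measurable[OF _ _ Y'(1)]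
        by (intro integrable_mult_square_integrable square_mult_increment) auto
    qed (use that st in auto)
    ultimately have "has_bochner_integral M (\<lambda>\<omega>. (Y \<omega> * Y' \<omega>) * (W t \<omega> - W s \<omega>)\<^sup>2
        + ((Y \<omega> * (W t \<omega> - W s \<omega>)) * Y' \<omega>) * (W t' \<omega> - W t \<omega>))
        ((\<integral>\<omega>. Y \<omega> * Y' \<omega> \<partial>M) * (t - s) + 0)"
      by (rule has_bochner_integral_add)
    then show ?thesis
      by (simp add: algebra_simps power2_eq_square)
  qed
  show ?thesis
  proof (cases "t \<le> t'")
    case True
    then show ?thesis using *[of t t' Y Y'] assms by simp
  next
    case False
    then show ?thesis using *[of t' t Y' Y] assms by (simp add: mult.commute)
  qed
qed

text \<open>The intervals of a step process may overlap arbitrarily, so the covariance is needed for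
  any two of them. Cutting the interval that starts first at the start of the other leaves a
  disjoint piece, which is orthogonal, and a piece with the same start. The last factor is the
  length of the overlap.\<close>

lemma mult_increments:
  assumes "0 \<le> u" "u \<le> v" "v \<le> T" and X: "X \<in> borel_measurable (F u)" "integrable M (\<lambda>\<omega>. (X \<omega>)\<^sup>2)"
    and "0 \<le> u'" "u' \<le> v'" "v' \<le> T" and Y: "Y \<in> borel_measurable (F u')" "integrable M (\<lambda>\<omega>. (Y \<omega>)\<^sup>2)"
  shows "has_bochner_integral M (\<lambda>\<omega>. (X \<omega> * (W v \<omega> - W u \<omega>)) * (Y \<omega> * (W v' \<omega> - W u' \<omega>)))
    ((\<integral>\<omega>. X \<omega> * Y \<omega> \<partial>M) * max 0 (min v v' - max u u'))"
proof -
  have disjoint: "has_bochner_integral M (\<lambda>\<omega>. (X \<omega> * (W v \<omega> - W u \<omega>)) * (Y \<omega> * (W v' \<omega> - W u' \<omega>))) 0"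
    if "0 \<le> u" "u \<le> v" "v \<le> u'" "u' \<le> v'" "v' \<le> T"
      and X: "X \<in> borel_measurable (F u)" "integrable M (\<lambda>\<omega>. (X \<omega>)\<^sup>2)"
      and Y: "Y \<in> borel_measurable (F u')" "integrable M (\<lambda>\<omega>. (Y \<omega>)\<^sup>2)" for u v u' v' X Y
  proof -
    have "has_bochner_integral M (\<lambda>\<omega>. ((X \<omega> * (W v \<omega> - W u \<omega>)) * Y \<omega>) * (W v' \<omega> - W u' \<omega>)) 0"
    proof (rule mult_increment_1)
      show "(\<lambda>\<omega>. X \<omega> * (W v \<omega> - W u \<omega>) * Y \<omega>) \<in> borel_measurable (F u')"
        using F_mono_measurable[of u u', OF _ X(1)] Y
          F_mono_measurable[of u u', OF _ adapted] F_mono_measurable[of v u', OF _ adapted] that by auto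
      show "integrable M (\<lambda>\<omega>. X \<omega> * (W v \<omega> - W u \<omega>) * Y \<omega>)"
        using that W_measurable[of u] W_measurable[of v] F_measurable[OF _ _ X(1)] F_measurable[OF _ _ Y(1)]
        by (intro integrable_mult_square_integrable square_mult_increment) auto
    qed (use that in auto)
    then show ?thesis by (simp add: mult.assoc)
  qed
  have *: "has_bochner_integral M (\<lambda>\<omega>. (X \<omega> * (W v \<omega> - W u \<omega>)) * (Y \<omega> * (W v' \<omega> - W u' \<omega>)))
    ((\<integral>\<omega>. X \<omega> * Y \<omega> \<partial>M) * max 0 (min v v' - max u u'))"
    if "0 \<le> u" "u \<le> v" "v \<le> T" and X: "X \<in> borel_measurable (F u)" "integrable M (\<lambda>\<omega>. (X \<omega>)\<^sup>2)"
      and "u \<le> u'" "u' \<le> v'" "v' \<le> T" and Y: "Y \<in> borel_measurable (F u')" "integrable M (\<lambda>\<omega>. (Y \<omega>)\<^sup>2)"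
    for u v u' v' X Y
  proof (cases "v \<le> u'")
    case True
    then have "max 0 (min v v' - max u u') = 0" using that by auto
    then show ?thesis using disjoint[of u v u' v' X Y] that True by simp
  next
    case False
    have "has_bochner_integral M (\<lambda>\<omega>. (X \<omega> * (W u' \<omega> - W u \<omega>)) * (Y \<omega> * (W v' \<omega> - W u' \<omega>))
        + (X \<omega> * (W v \<omega> - W u' \<omega>)) * (Y \<omega> * (W v' \<omega> - W u' \<omega>)))
      (0 + (\<integral>\<omega>. X \<omega> * Y \<omega> \<partial>M) * (min v v' - u'))"
      using that False F_mono_measurable[of u u', OF _ X(1)]
      by (intro has_bochner_integral_add disjoint mult_increments_same_start) auto
    moreover have eq: "max 0 (min v v' - max u u') = min v v' - u'" using that False by auto
    ultimately show ?thesis unfolding eq by (simp add: algebra_simps)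
  qed
  show ?thesis
  proof (cases "u \<le> u'")
    case True
    then show ?thesis using *[of u v X u' v' Y] assms by simp
  next
    case False
    then show ?thesis using *[of u' v' Y u v X] assms by (simp add: mult.commute max.commute min.commute)
  qed
qed

end

text \<open>The same overlap length as in \<open>mult_increments\<close>, now from Lebesgue measure;
  this coincidence is the isometry for single intervals.\<close>

lemma has_bochner_integral_overlap:
  "has_bochner_integral lborel (\<lambda>s::real. indicator {u<..v} s * indicator {u'<..v'} s :: real)
    (max 0 (min v v' - max u u'))"
proof -
  have "(\<lambda>s::real. indicator {u<..v} s * indicator {u'<..v'} s :: real) = indicator {max u u'<..min v v'}"
    by (auto simp: fun_eq_iff indicator_def)
  moreover have "has_bochner_integral lborel (indicator {max u u'<..min v v'} :: real \<Rightarrow> real) (measure lborel {max u u'<..min v v'})"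
    using emeasure_bounded_finite[of "{max u u'<..min v v'}"]
    by (intro has_bochner_integral_real_indicator) (auto simp: less_top)
  moreover have "measure lborel {max u u'<..min v v'} = max 0 (min v v' - max u u')"
    by (cases "max u u' \<le> min v v'") (auto simp: max_def)
  ultimately show ?thesis by simp
qed

section \<open>Step processes as lists of intervals, and their isometry\<close>

lemma step_process_Nil [simp]: "step_process [] s \<omega> = 0"
  and step_process_Cons [simp]:
    "step_process ((u, v, X) # L) s \<omega> = X \<omega> * indicator {u<..v} s + step_process L s \<omega>"
  and step_process_append [simp]:
    "step_process (L @ L') s \<omega> = step_process L s \<omega> + step_process L' s \<omega>"
  by (simp_all add: step_process_def)

lemma step_integral_Nil [simp]: "step_integral W [] t \<omega> = 0"
  and step_integral_Cons [simp]: "step_integral W ((u, v, X) # L) t \<omega> =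
    X \<omega> * (W (min v t) \<omega> - W (min u t) \<omega>) + step_integral W L t \<omega>"
  and step_integral_append [simp]:
    "step_integral W (L @ L') t \<omega> = step_integral W L t \<omega> + step_integral W L' t \<omega>"
  by (simp_all add: step_integral_def)

lemma adapted_steps_Nil [simp]: "adapted_steps M F T []"
  and adapted_steps_Cons: "adapted_steps M F T ((u, v, X) # L) \<longleftrightarrow>
    0 \<le> u \<and> u \<le> v \<and> v \<le> T \<and> X \<in> borel_measurable (F u) \<and> integrable M (\<lambda>\<omega>. (X \<omega>)\<^sup>2) \<and>
    adapted_steps M F T L"
  and adapted_steps_append [simp]: "adapted_steps M F T (L @ L') \<longleftrightarrow> adapted_steps M F T L \<and> adapted_steps M F T L'"
  by (simp_all add: adapted_steps_def case_prod_beta ball_Un)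

definition step_inner :: "'a steps \<Rightarrow> 'a steps \<Rightarrow> 'a \<Rightarrow> real" where
  "step_inner L L' \<omega> = (\<Sum>(u, v, X)\<leftarrow>L. \<Sum>(u', v', X')\<leftarrow>L'. X \<omega> * X' \<omega> * max 0 (min v v' - max u u'))"

lemma has_bochner_integral_step_inner:
  "has_bochner_integral lborel (\<lambda>s. step_process L s \<omega> * step_process L' s \<omega>) (step_inner L L' \<omega>)"
proof (induction L)
  case Nil
  then show ?case by (simp add: step_inner_def has_bochner_integral_iff)
next
  case (Cons x L)
  obtain u v X where x: "x = (u, v, X)" by (cases x) auto
  have "has_bochner_integral lborel (\<lambda>s. (X \<omega> * indicator {u<..v} s) * step_process L' s \<omega>)
      (\<Sum>(u', v', X')\<leftarrow>L'. X \<omega> * X' \<omega> * max 0 (min v v' - max u u'))"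
  proof (induction L')
    case (Cons y L')
    obtain u' v' Y where y: "y = (u', v', Y)" by (cases y) auto
    have "has_bochner_integral lborel (\<lambda>s. (X \<omega> * Y \<omega>) * (indicator {u<..v} s * indicator {u'<..v'} s))
        (X \<omega> * Y \<omega> * max 0 (min v v' - max u u'))"
      by (intro has_bochner_integral_mult_right has_bochner_integral_overlap)
    from has_bochner_integral_add[OF this Cons.IH] show ?case
      unfolding y by (simp add: algebra_simps)
  qed (simp add: has_bochner_integral_iff)
  from has_bochner_integral_add[OF this Cons.IH] show ?case
    unfolding x step_inner_def by (simp add: algebra_simps)
qed

context scalar_wiener
begin

text \<open>Both sides are bilinear in the two lists, so two nested inductions reduce the claim to
  \<open>mult_increments\<close>. Integrability of \<open>step_inner\<close> is carried along
  because the expectation of the sum splits only then.\<close>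

lemma step_integral_inner:
  assumes "adapted_steps M F T L" "adapted_steps M F T L'"
  shows "integrable M (step_inner L L')
    \<and> has_bochner_integral M (\<lambda>\<omega>. step_integral W L T \<omega> * step_integral W L' T \<omega>) (expectation (step_inner L L'))"
  using assms(1)
proof (induction L)
  case Nil
  then show ?case by (simp add: step_inner_def has_bochner_integral_iff)
next
  case (Cons x L)
  obtain u v X where x: "x = (u, v, X)" by (cases x) auto
  note X = Cons.prems[unfolded x adapted_steps_Cons]
  have IH: "integrable M (step_inner L L')"
    "has_bochner_integral M (\<lambda>\<omega>. step_integral W L T \<omega> * step_integral W L' T \<omega>) (expectation (step_inner L L'))"
    using Cons.IH X by auto
  have *: "integrable M (step_inner [(u, v, X)] L') \<and>
    has_bochner_integral M (\<lambda>\<omega>. (X \<omega> * (W v \<omega> - W u \<omega>)) * step_integral W L' T \<omega>)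
      (expectation (step_inner [(u, v, X)] L'))"
    using assms(2)
  proof (induction L')
    case Nil
    then show ?case by (simp add: step_inner_def has_bochner_integral_iff)
  next
    case (Cons y L')
    obtain u' v' Y where y: "y = (u', v', Y)" by (cases y) auto
    note Y = Cons.prems[unfolded y adapted_steps_Cons]
    have IH: "integrable M (step_inner [(u, v, X)] L')"
      "has_bochner_integral M (\<lambda>\<omega>. (X \<omega> * (W v \<omega> - W u \<omega>)) * step_integral W L' T \<omega>)
      (expectation (step_inner [(u, v, X)] L'))"
      using Cons.IH Y by auto
    have "integrable M (\<lambda>\<omega>. X \<omega> * Y \<omega>)"
      using X Y F_measurable[of u X] F_measurable[of u' Y] by (intro integrable_mult_square_integrable) auto
    then have 1: "integrable M (\<lambda>\<omega>. X \<omega> * Y \<omega> * max 0 (min v v' - max u u'))" by simp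
    have 2: "step_inner [(u, v, X)] (y # L') =
        (\<lambda>\<omega>. X \<omega> * Y \<omega> * max 0 (min v v' - max u u') + step_inner [(u, v, X)] L' \<omega>)"
      by (simp add: y step_inner_def fun_eq_iff)
    have 3: "integrable M (step_inner [(u, v, X)] (y # L'))"
      unfolding 2 using 1 IH(1) by (rule Bochner_Integration.integrable_add)
    have 4: "expectation (step_inner [(u, v, X)] (y # L')) = 
        (\<integral>\<omega>. X \<omega> * Y \<omega> \<partial>M) * max 0 (min v v' - max u u') + expectation (step_inner [(u, v, X)] L')"
      unfolding 2 using 1 IH(1) by simp
    have 5: "has_bochner_integral M (\<lambda>\<omega>. (X \<omega> * (W v \<omega> - W u \<omega>)) * (Y \<omega> * (W v' \<omega> - W u' \<omega>)))
      ((\<integral>\<omega>. X \<omega> * Y \<omega> \<partial>M) * max 0 (min v v' - max u u'))"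
      using X Y by (intro mult_increments) auto
    \<comment> \<open>All intervals end by T, so the truncation at T in \<open>step_integral\<close>
      changes nothing.\<close>
    have "step_integral W (y # L') T \<omega> = Y \<omega> * (W v' \<omega> - W u' \<omega>) + step_integral W L' T \<omega>" for \<omega>
      using Y by (simp add: y)
    with 3 4 has_bochner_integral_add[OF 5 IH(2)] show ?case by (simp add: distrib_left)
  qed
  have 2: "step_inner (x # L) L' = (\<lambda>\<omega>. step_inner [(u, v, X)] L' \<omega> + step_inner L L' \<omega>)"
    by (simp add: x step_inner_def fun_eq_iff)
  have 3: "integrable M (step_inner (x # L) L')"
    unfolding 2 using * IH(1) by simp
  have 4: "expectation (step_inner (x # L) L') = expectation (step_inner [(u, v, X)] L') + expectation (step_inner L L')"
    unfolding 2 using * IH(1) by simp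
  have "step_integral W (x # L) T \<omega> = X \<omega> * (W v \<omega> - W u \<omega>) + step_integral W L T \<omega>" for \<omega>
    using X by (simp add: x)
  with 3 4 has_bochner_integral_add[OF _ IH(2)] * show ?case by (simp add: distrib_right)
qed

text \<open>Stated in \<open>ennreal\<close>, as are the limits in \<open>has_ito_integral\<close>,
  so that applying it creates no integrability obligations.\<close>

lemma ito_isometry_steps:
  assumes "adapted_steps M F T L"
  shows "(\<integral>\<^sup>+\<omega>. ennreal ((step_integral W L T \<omega>)\<^sup>2) \<partial>M)
    = (\<integral>\<^sup>+\<omega>. (\<integral>\<^sup>+s. ennreal ((step_process L s \<omega>)\<^sup>2) \<partial>lborel) \<partial>M)"
proof -
  note I = step_integral_inner[OF assms assms]
  have *: "(\<integral>\<^sup>+s. ennreal ((step_process L s \<omega>)\<^sup>2) \<partial>lborel) = ennreal (step_inner L L \<omega>)" 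
    and "0 \<le> step_inner L L \<omega>" for \<omega>
  proof -
    note S = has_bochner_integral_step_inner[of L \<omega> L]
    show "0 \<le> step_inner L L \<omega>" using S
      unfolding has_bochner_integral_iff by (metis (no_types, lifting) Bochner_Integration.integral_nonneg zero_le_square)
    show "(\<integral>\<^sup>+s. ennreal ((step_process L s \<omega>)\<^sup>2) \<partial>lborel) = ennreal (step_inner L L \<omega>)"
      unfolding power2_eq_square using S
      by (subst nn_integral_eq_integral) (auto simp: has_bochner_integral_iff)
  qed
  then have "(\<integral>\<^sup>+\<omega>. (\<integral>\<^sup>+s. ennreal ((step_process L s \<omega>)\<^sup>2) \<partial>lborel) \<partial>M) = ennreal (expectation (step_inner L L))"
    unfolding * using I by (intro nn_integral_eq_integral) auto
  also have "\<dots> = (\<integral>\<^sup>+\<omega>. ennreal ((step_integral W L T \<omega>)\<^sup>2) \<partial>M)"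
    unfolding power2_eq_square using I
    by (subst nn_integral_eq_integral) (auto simp: has_bochner_integral_iff)
  finally show ?thesis by simp
qed

end

section \<open>Increments of the stochastic integral\<close>

text \<open>Multiplication of the step process by the indicator of the interval from a to b. The
  outer \<open>max\<close> keeps the endpoints in order when the intersection is empty. Every
  interval now starts at a or later, which preserves adaptedness and gives orthogonality to the past
  of a.\<close>

definition restr_steps :: "real \<Rightarrow> real \<Rightarrow> 'a steps \<Rightarrow> 'a steps" where
  "restr_steps a b L = map (\<lambda>(u, v, X). (max a u, max (max a u) (min v b), X)) L"

text \<open>Together with list append this represents differences, to which the isometry can then be
  applied.\<close>

definition neg_steps :: "'a steps \<Rightarrow> 'a steps" where
  "neg_steps L = map (\<lambda>(u, v, X). (u, v, \<lambda>\<omega>. - X \<omega>)) L"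

lemma step_process_restr_steps [simp]:
  "step_process (restr_steps a b L) s \<omega> = indicator {a<..b} s * step_process L s \<omega>"
  by (induction L) (auto simp: restr_steps_def indicator_def)

lemma step_process_neg_steps [simp]: "step_process (neg_steps L) s \<omega> = - step_process L s \<omega>"
  by (induction L) (auto simp: neg_steps_def)

lemma step_integral_neg_steps [simp]: "step_integral W (neg_steps L) t \<omega> = - step_integral W L t \<omega>"
  by (induction L) (auto simp: neg_steps_def algebra_simps)

lemma adapted_steps_neg_steps: "adapted_steps M F T L \<Longrightarrow> adapted_steps M F T (neg_steps L)"
  by (induction L) (auto simp: neg_steps_def adapted_steps_Cons)

text \<open>The isometry is available at time T only; this rewrites an increment between two times
  as an integral up to T. For each interval it is a case distinction on its position relative to s
  and t.\<close>

lemma step_integral_restr_steps: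
  assumes "adapted_steps M F T L" "0 \<le> s" "s \<le> t" "t \<le> T"
  shows "step_integral W (restr_steps s t L) T \<omega> = step_integral W L t \<omega> - step_integral W L s \<omega>"
  using assms(1)
proof (induction L)
  case (Cons x L)
  obtain u v X where x: "x = (u, v, X)" by (cases x) auto
  have uv: "u \<le> v" "v \<le> T" using Cons.prems unfolding x adapted_steps_Cons by auto
  have m: "min (max s u) T = max s u" "min (max (max s u) (min v t)) T = max (max s u) (min v t)"
    using assms(2-4) uv by auto
  have W: "W (max (max s u) (min v t)) \<omega> - W (max s u) \<omega>
      = (W (min v t) \<omega> - W (min u t) \<omega>) - (W (min v s) \<omega> - W (min u s) \<omega>)"
  proof -
    consider "v \<le> s" | "u \<le> s" "s \<le> v" | "s \<le> u" "u \<le> t" | "t \<le> u" by linarith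
    then show ?thesis
    proof cases
      case 1
      then show ?thesis using assms(2-4) uv by (simp add: min_absorb1 min_absorb2 max_absorb1 max_absorb2)
    next
      case 2
      then show ?thesis using assms(2-4) uv by (simp add: min_absorb1 min_absorb2 max_absorb1 max_absorb2)
    next
      case 3
      then show ?thesis using assms(2-4) uv by (simp add: min_absorb1 min_absorb2 max_absorb1 max_absorb2)
    next
      case 4
      then show ?thesis using assms(2-4) uv by (simp add: min_absorb1 min_absorb2 max_absorb1 max_absorb2)
    qed
  qed
  have IH: "step_integral W (restr_steps s t L) T \<omega> = step_integral W L t \<omega> - step_integral W L s \<omega>"
    using Cons unfolding x adapted_steps_Cons by simp
  have "step_integral W (restr_steps s t (x # L)) T \<omega>
      = X \<omega> * (W (max (max s u) (min v t)) \<omega> - W (max s u) \<omega>) + step_integral W (restr_steps s t L) T \<omega>"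
    by (simp add: x restr_steps_def m)
  also have "\<dots> = step_integral W (x # L) t \<omega> - step_integral W (x # L) s \<omega>"
    unfolding W IH x step_integral_Cons by (simp only: right_diff_distrib)
  finally show ?case .
qed (simp add: restr_steps_def)

lemma step_integral_0:
  assumes "adapted_steps M F T L"
  shows "step_integral W L 0 \<omega> = 0"
  using assms by (induction L) (auto simp: adapted_steps_Cons)

text \<open>Takes the place of the triangle inequality for square means. The lost factor 2 is
  harmless, since only limits and orders of magnitude are needed.\<close>

lemma ennreal_square_add_le: "ennreal ((a + b)\<^sup>2) \<le> 2 * ennreal (a\<^sup>2) + 2 * ennreal (b\<^sup>2)"
proof -
  have "(a + b)\<^sup>2 \<le> 2 * a\<^sup>2 + 2 * b\<^sup>2"
    using sum_squares_bound[of a b] by (simp add: power2_sum)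
  then have "ennreal ((a + b)\<^sup>2) \<le> ennreal (2 * a\<^sup>2 + 2 * b\<^sup>2)" by (rule ennreal_leI)
  then show ?thesis by (simp add: ennreal_plus ennreal_mult)
qed

lemma nn_integral_square_add_le:
  assumes [measurable]: "f \<in> borel_measurable M" "g \<in> borel_measurable M"
  shows "(\<integral>\<^sup>+x. ennreal ((f x + g x)\<^sup>2) \<partial>M)
    \<le> 2 * (\<integral>\<^sup>+x. ennreal ((f x)\<^sup>2) \<partial>M) + 2 * (\<integral>\<^sup>+x. ennreal ((g x)\<^sup>2) \<partial>M)"
proof -
  have "(\<integral>\<^sup>+x. ennreal ((f x + g x)\<^sup>2) \<partial>M) \<le> (\<integral>\<^sup>+x. 2 * ennreal ((f x)\<^sup>2) + 2 * ennreal ((g x)\<^sup>2) \<partial>M)"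
    by (intro nn_integral_mono ennreal_square_add_le)
  then show ?thesis by (simp add: nn_integral_add nn_integral_cmult)
qed

lemma integrable_square_iff_nn_integral:
  fixes f :: "'a \<Rightarrow> real"
  assumes [measurable]: "f \<in> borel_measurable M"
  shows "integrable M (\<lambda>x. (f x)\<^sup>2) \<longleftrightarrow> (\<integral>\<^sup>+x. ennreal ((f x)\<^sup>2) \<partial>M) < \<infinity>"
  by (simp add: integrable_iff_bounded)

text \<open>The squared norm in L2 of the product of M with the real line. The time interval is put
  into the argument as an indicator.\<close>

definition (in scalar_wiener) norm2_sq :: "('a \<Rightarrow> real \<Rightarrow> real) \<Rightarrow> ennreal" where
  "norm2_sq X = (\<integral>\<^sup>+\<omega>. (\<integral>\<^sup>+s. ennreal ((X \<omega> s)\<^sup>2) \<partial>lborel) \<partial>M)"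

section \<open>Square mean estimates for increments of the stochastic integral\<close>

context scalar_wiener
begin

lemma adapted_steps_restr_steps:
  assumes "adapted_steps M F T L" "0 \<le> a" "a \<le> T"
  shows "adapted_steps M F T (restr_steps a b L)"
  using assms(1)
proof (induction L)
  case (Cons x L)
  obtain u v X where x: "x = (u, v, X)" by (cases x) auto
  note X = Cons.prems[unfolded x adapted_steps_Cons]
  have "0 \<le> max a u" "max a u \<le> max (max a u) (min v b)" "max (max a u) (min v b) \<le> T"
    using X assms(2,3) by auto
  moreover have "X \<in> borel_measurable (F (max a u))"
    using X by (intro F_mono_measurable[of u "max a u" X]) auto
  moreover have "restr_steps a b (x # L) = (max a u, max (max a u) (min v b), X) # restr_steps a b L"
    by (simp add: x restr_steps_def)
  ultimately show ?case
    using Cons.IH X by (simp only: adapted_steps_Cons)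
qed (simp add: restr_steps_def)

lemma step_process_measurable [measurable]:
  assumes "adapted_steps M F T L"
  shows "(\<lambda>(\<omega>, s). step_process L s \<omega>) \<in> borel_measurable (M \<Otimes>\<^sub>M lborel)"
  using assms
proof (induction L)
  case (Cons x L)
  obtain u v X where x: "x = (u, v, X)" by (cases x) auto
  have [measurable]: "X \<in> borel_measurable M"
    using Cons.prems F_measurable[of u X] unfolding x adapted_steps_Cons by auto
  have [measurable]: "(\<lambda>(\<omega>, s). step_process L s \<omega>) \<in> borel_measurable (M \<Otimes>\<^sub>M lborel)"
    using Cons unfolding x adapted_steps_Cons by auto
  show ?case unfolding x by simp
qed simp

lemma step_integral_measurable:
  assumes "adapted_steps M F T L" "0 \<le> t" "t \<le> T"
  shows "step_integral W L t \<in> borel_measurable M"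
  using assms(1)
proof (induction L)
  case (Cons x L)
  obtain u v X where x: "x = (u, v, X)" by (cases x) auto
  have [measurable]: "X \<in> borel_measurable M" "W (min u t) \<in> borel_measurable M" "W (min v t) \<in> borel_measurable M"
    using Cons.prems F_measurable[of u X] assms(2,3) by (auto simp: x adapted_steps_Cons intro!: W_measurable)
  have [measurable]: "step_integral W L t \<in> borel_measurable M"
    using Cons unfolding x adapted_steps_Cons by auto
  have "step_integral W (x # L) t = (\<lambda>\<omega>. X \<omega> * (W (min v t) \<omega> - W (min u t) \<omega>) + step_integral W L t \<omega>)"
    by (simp add: x fun_eq_iff)
  then show ?case by simp
qed (simp add: step_integral_def[abs_def])

lemma step_integral_square_integrable:
  assumes "adapted_steps M F T L"
  shows "integrable M (\<lambda>\<omega>. (step_integral W L T \<omega>)\<^sup>2)"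
  using step_integral_inner[OF assms assms] by (simp add: power2_eq_square has_bochner_integral_iff)

lemma norm2_sq_add_le:
  assumes [measurable]: "case_prod X \<in> borel_measurable (M \<Otimes>\<^sub>M lborel)" "case_prod Y \<in> borel_measurable (M \<Otimes>\<^sub>M lborel)"
  shows "norm2_sq (\<lambda>\<omega> s. X \<omega> s + Y \<omega> s) \<le> 2 * norm2_sq X + 2 * norm2_sq Y"
proof -
  have "norm2_sq (\<lambda>\<omega> s. X \<omega> s + Y \<omega> s)
      \<le> (\<integral>\<^sup>+\<omega>. 2 * (\<integral>\<^sup>+s. ennreal ((X \<omega> s)\<^sup>2) \<partial>lborel) + 2 * (\<integral>\<^sup>+s. ennreal ((Y \<omega> s)\<^sup>2) \<partial>lborel) \<partial>M)"
    unfolding norm2_sq_def by (intro nn_integral_mono nn_integral_square_add_le) measurable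
  also have "\<dots> = 2 * norm2_sq X + 2 * norm2_sq Y"
    unfolding norm2_sq_def by (subst nn_integral_add) (simp_all add: nn_integral_cmult)
  finally show ?thesis .
qed

lemma norm2_sq_mono:
  assumes "\<And>\<omega> s. \<omega> \<in> space M \<Longrightarrow> \<bar>X \<omega> s\<bar> \<le> \<bar>Y \<omega> s\<bar>"
  shows "norm2_sq X \<le> norm2_sq Y"
  unfolding norm2_sq_def using assms by (intro nn_integral_mono ennreal_leI) (simp add: abs_le_square_iff)

lemma norm2_sq_step_process:
  assumes "adapted_steps M F T L"
  shows "norm2_sq (\<lambda>\<omega> s. step_process L s \<omega>) = (\<integral>\<^sup>+\<omega>. ennreal ((step_integral W L T \<omega>)\<^sup>2) \<partial>M)"
  unfolding norm2_sq_def ito_isometry_steps[OF assms] ..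

text \<open>\<open>J\<close> and \<open>J'\<close> are limits along unrelated sequences of step
  processes. Both sequences approximate X on [0, s], so by the isometry their integrals up to s have
  the same limit, and the sequence for t alone can be used to approximate the increment.\<close>

lemma ito_increment_approx:
  assumes "0 \<le> s" "s \<le> t" "t \<le> T"
    and X [measurable]: "(\<lambda>(\<omega>, u). indicator {0..T} u * X u \<omega>) \<in> borel_measurable (M \<Otimes>\<^sub>M lborel)"
    and J: "has_ito_integral M F T W X s J" and J': "has_ito_integral M F T W X t J'"
  shows "\<exists>N. (\<forall>n. adapted_steps M F T (N n)) \<and> (\<forall>n. \<forall>x\<in>set (N n). s \<le> fst x) \<and>
    (\<lambda>n::nat. norm2_sq (\<lambda>\<omega> u. step_process (N n) u \<omega> - indicator {s<..t} u * X u \<omega>)) \<longlonglongrightarrow> 0 \<and>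
    (\<lambda>n. \<integral>\<^sup>+\<omega>. ennreal ((step_integral W (N n) T \<omega> - (J' \<omega> - J \<omega>))\<^sup>2) \<partial>M) \<longlonglongrightarrow> 0"
proof -
  define e where "e r L = norm2_sq (\<lambda>\<omega> u. indicator {0..r} u * (step_process L u \<omega> - X u \<omega>))" for r L
  have e: "(\<integral>\<^sup>+\<omega>. (\<integral>\<^sup>+u\<in>{0..r}. ennreal ((step_process L u \<omega> - X u \<omega>)\<^sup>2) \<partial>lborel) \<partial>M) = e r L" for r L
    unfolding e_def norm2_sq_def
    by (intro nn_integral_cong) (auto simp: indicator_def)
  from J obtain L where L: "\<And>n. adapted_steps M F T (L n)" "(\<lambda>n::nat. e s (L n)) \<longlonglongrightarrow> 0"
      "(\<lambda>n. \<integral>\<^sup>+\<omega>. ennreal ((step_integral W (L n) s \<omega> - J \<omega>)\<^sup>2) \<partial>M) \<longlonglongrightarrow> 0" and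
      Jm [measurable]: "J \<in> borel_measurable M"
    unfolding has_ito_integral_def e by blast
  from J' obtain L' where L': "\<And>n. adapted_steps M F T (L' n)" "(\<lambda>n::nat. e t (L' n)) \<longlonglongrightarrow> 0"
      "(\<lambda>n. \<integral>\<^sup>+\<omega>. ennreal ((step_integral W (L' n) t \<omega> - J' \<omega>)\<^sup>2) \<partial>M) \<longlonglongrightarrow> 0" and
      Jm' [measurable]: "J' \<in> borel_measurable M"
    unfolding has_ito_integral_def e by blast
  \<comment> \<open>The integral of \<open>N n\<close> is the increment from s to t of the integral
    of \<open>L' n\<close>, while its intervals start at s or later.\<close>
  define N where "N n = restr_steps s t (L' n)" for n
  have N: "adapted_steps M F T (N n)" for n
    unfolding N_def using L' assms by (intro adapted_steps_restr_steps) auto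
  show ?thesis
  proof (intro exI[of _ N] conjI allI N)
    show "\<forall>x\<in>set (N n). s \<le> fst x" for n
      by (auto simp: N_def restr_steps_def)
    have "norm2_sq (\<lambda>\<omega> u. step_process (N n) u \<omega> - indicator {s<..t} u * X u \<omega>) \<le> e t (L' n)" for n
      unfolding e_def N_def using assms by (intro norm2_sq_mono) (auto simp: indicator_def)
    then show "(\<lambda>n. norm2_sq (\<lambda>\<omega> u. step_process (N n) u \<omega> - indicator {s<..t} u * X u \<omega>)) \<longlonglongrightarrow> 0"
      by (intro tendsto_sandwich[OF _ _ tendsto_const L'(2)]) auto
    \<comment> \<open>The error is split by inserting the integrals up to s of both sequences. The
      term comparing \<open>L n\<close> with \<open>L' n\<close> is an integral of a difference of
      step processes, and the isometry bounds it by the distances of both to X on [0, s].\<close>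
    have bound: "(\<integral>\<^sup>+\<omega>. ennreal ((step_integral W (N n) T \<omega> - (J' \<omega> - J \<omega>))\<^sup>2) \<partial>M)
      \<le> 2 * (\<integral>\<^sup>+\<omega>. ennreal ((step_integral W (L' n) t \<omega> - J' \<omega>)\<^sup>2) \<partial>M)
        + 2 * (2 * (\<integral>\<^sup>+\<omega>. ennreal ((step_integral W (L n) s \<omega> - J \<omega>)\<^sup>2) \<partial>M)
          + 2 * (2 * e s (L n) + 2 * e t (L' n)))" for n
    proof -
      have [measurable]: "step_integral W (L' n) t \<in> borel_measurable M" "step_integral W (L' n) s \<in> borel_measurable M"
        "step_integral W (L n) s \<in> borel_measurable M"
        using L(1) L'(1) assms by (auto intro!: step_integral_measurable)
      have [measurable]: "(\<lambda>(\<omega>, u). step_process (L n) u \<omega>) \<in> borel_measurable (M \<Otimes>\<^sub>M lborel)"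
        "(\<lambda>(\<omega>, u). step_process (L' n) u \<omega>) \<in> borel_measurable (M \<Otimes>\<^sub>M lborel)"
        using L(1) L'(1) by (auto intro!: step_process_measurable)
      have mX [measurable]: "(\<lambda>(\<omega>, u). indicator {0..r} u * X u \<omega>) \<in> borel_measurable (M \<Otimes>\<^sub>M lborel)" if "r \<le> T" for r
      proof -
        have "(\<lambda>(\<omega>, u). indicator {0..r} u * X u \<omega>) = (\<lambda>(\<omega>, u). indicator {0..r} u * (indicator {0..T} u * X u \<omega>))"
          using that by (auto simp: fun_eq_iff indicator_def)
        then show ?thesis by simp
      qed
      note [measurable] = mX[of s] mX[of t]
      have "(\<integral>\<^sup>+\<omega>. ennreal ((step_integral W (L n) s \<omega> - step_integral W (L' n) s \<omega>)\<^sup>2) \<partial>M)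
          = norm2_sq (\<lambda>\<omega> u. step_process (restr_steps 0 s (L n) @ neg_steps (restr_steps 0 s (L' n))) u \<omega>)"
        using assms
        by (subst norm2_sq_step_process)
          (auto intro!: adapted_steps_restr_steps adapted_steps_neg_steps L(1) L'(1)
            simp: step_integral_restr_steps[OF L(1)] step_integral_restr_steps[OF L'(1)]
              step_integral_0[OF L(1)] step_integral_0[OF L'(1)])
      also have "\<dots> \<le> norm2_sq (\<lambda>\<omega> u. indicator {0..s} u * (step_process (L n) u \<omega> - X u \<omega>)
          + (- 1) * (indicator {0..s} u * (step_process (L' n) u \<omega> - X u \<omega>)))"
        by (intro norm2_sq_mono) (auto simp: indicator_def)
      also have "\<dots> \<le> 2 * norm2_sq (\<lambda>\<omega> u. indicator {0..s} u * (step_process (L n) u \<omega> - X u \<omega>))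
          + 2 * norm2_sq (\<lambda>\<omega> u. (- 1) * (indicator {0..s} u * (step_process (L' n) u \<omega> - X u \<omega>)))"
        using assms by (intro norm2_sq_add_le) (simp_all add: right_diff_distrib split_beta')
      also have "\<dots> \<le> 2 * e s (L n) + 2 * e t (L' n)"
        unfolding e_def using assms by (intro add_mono mult_left_mono order_refl norm2_sq_mono) (auto simp: indicator_def)
      finally have *: "(\<integral>\<^sup>+\<omega>. ennreal ((step_integral W (L n) s \<omega> - step_integral W (L' n) s \<omega>)\<^sup>2) \<partial>M)
        \<le> 2 * e s (L n) + 2 * e t (L' n)" .
      have "(\<integral>\<^sup>+\<omega>. ennreal ((step_integral W (N n) T \<omega> - (J' \<omega> - J \<omega>))\<^sup>2) \<partial>M)
        = (\<integral>\<^sup>+\<omega>. ennreal (((step_integral W (L' n) t \<omega> - J' \<omega>) +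
            ((J \<omega> - step_integral W (L n) s \<omega>) + (step_integral W (L n) s \<omega> - step_integral W (L' n) s \<omega>)))\<^sup>2) \<partial>M)"
        unfolding N_def using assms by (simp add: step_integral_restr_steps[OF L'(1)] algebra_simps)
      also have "\<dots> \<le> 2 * (\<integral>\<^sup>+\<omega>. ennreal ((step_integral W (L' n) t \<omega> - J' \<omega>)\<^sup>2) \<partial>M)
        + 2 * (\<integral>\<^sup>+\<omega>. ennreal (((J \<omega> - step_integral W (L n) s \<omega>) + (step_integral W (L n) s \<omega> - step_integral W (L' n) s \<omega>))\<^sup>2) \<partial>M)"
        by (intro nn_integral_square_add_le) measurable
      also have "(\<integral>\<^sup>+\<omega>. ennreal (((J \<omega> - step_integral W (L n) s \<omega>) + (step_integral W (L n) s \<omega> - step_integral W (L' n) s \<omega>))\<^sup>2) \<partial>M)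
        \<le> 2 * (\<integral>\<^sup>+\<omega>. ennreal ((J \<omega> - step_integral W (L n) s \<omega>)\<^sup>2) \<partial>M)
          + 2 * (\<integral>\<^sup>+\<omega>. ennreal ((step_integral W (L n) s \<omega> - step_integral W (L' n) s \<omega>)\<^sup>2) \<partial>M)"
        by (intro nn_integral_square_add_le) measurable
      also note *
      also have "(\<integral>\<^sup>+\<omega>. ennreal ((J \<omega> - step_integral W (L n) s \<omega>)\<^sup>2) \<partial>M)
        = (\<integral>\<^sup>+\<omega>. ennreal ((step_integral W (L n) s \<omega> - J \<omega>)\<^sup>2) \<partial>M)"
        by (simp add: power2_commute)
      finally show ?thesis by (simp add: add_mono mult_left_mono)
    qed
    have lim: "(\<lambda>n. 2 * (\<integral>\<^sup>+\<omega>. ennreal ((step_integral W (L' n) t \<omega> - J' \<omega>)\<^sup>2) \<partial>M)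
        + 2 * (2 * (\<integral>\<^sup>+\<omega>. ennreal ((step_integral W (L n) s \<omega> - J \<omega>)\<^sup>2) \<partial>M)
          + 2 * (2 * e s (L n) + 2 * e t (L' n)))) \<longlonglongrightarrow> 2 * 0 + 2 * (2 * 0 + 2 * (2 * 0 + 2 * 0))"
      by (intro tendsto_add ennreal_tendsto_cmult L L') auto
    have z: "2 * 0 + 2 * (2 * 0 + 2 * (2 * 0 + 2 * 0)) = (0::ennreal)" by simp
    show "(\<lambda>n. \<integral>\<^sup>+\<omega>. ennreal ((step_integral W (N n) T \<omega> - (J' \<omega> - J \<omega>))\<^sup>2) \<partial>M) \<longlonglongrightarrow> 0"
      by (rule tendsto_sandwich[OF always_eventually always_eventually tendsto_const lim[unfolded z]])
        (simp_all only: zero_le bound simp_thms)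
  qed
qed

text \<open>\<open>Y\<close> times the increment of W is the integral of the single step
  \<open>(s, t, Y)\<close>, so the left side is a limit of step integrals of differences. The factor
  4 is the price of two applications of (a + b)^2 \<le> 2 a^2 + 2 b^2.\<close>

lemma ito_increment_bound:
  assumes "0 \<le> s" "s \<le> t" "t \<le> T"
    and X [measurable]: "(\<lambda>(\<omega>, u). indicator {0..T} u * X u \<omega>) \<in> borel_measurable (M \<Otimes>\<^sub>M lborel)"
    and J: "has_ito_integral M F T W X s J" and J': "has_ito_integral M F T W X t J'"
    and Y: "Y \<in> borel_measurable (F s)" "integrable M (\<lambda>\<omega>. (Y \<omega>)\<^sup>2)"
  shows "(\<integral>\<^sup>+\<omega>. ennreal ((J' \<omega> - J \<omega> - Y \<omega> * (W t \<omega> - W s \<omega>))\<^sup>2) \<partial>M)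
    \<le> 4 * norm2_sq (\<lambda>\<omega> u. indicator {s<..t} u * (X u \<omega> - Y \<omega>))" (is "?l \<le> 4 * ?r")
proof -
  obtain N where N: "\<And>n. adapted_steps M F T (N n)"
    and N_lim: "(\<lambda>n::nat. norm2_sq (\<lambda>\<omega> u. step_process (N n) u \<omega> - indicator {s<..t} u * X u \<omega>)) \<longlonglongrightarrow> 0"
    "(\<lambda>n. \<integral>\<^sup>+\<omega>. ennreal ((step_integral W (N n) T \<omega> - (J' \<omega> - J \<omega>))\<^sup>2) \<partial>M) \<longlonglongrightarrow> 0"
    using ito_increment_approx[OF assms(1-6)] by blast
  have [measurable]: "J \<in> borel_measurable M" "J' \<in> borel_measurable M"
    using J J' by (auto simp: has_ito_integral_def)
  have [measurable]: "W s \<in> borel_measurable M" "W t \<in> borel_measurable M" "Y \<in> borel_measurable M"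
    using assms by (auto intro!: W_measurable F_measurable[of s Y])
  have [measurable]: "(\<lambda>(\<omega>, u). indicator {s<..t} u * X u \<omega>) \<in> borel_measurable (M \<Otimes>\<^sub>M lborel)"
  proof -
    have "(\<lambda>(\<omega>, u). indicator {s<..t} u * X u \<omega>) = (\<lambda>(\<omega>, u). indicator {s<..t} u * (indicator {0..T} u * X u \<omega>))"
      using assms by (auto simp: fun_eq_iff indicator_def)
    then show ?thesis by simp
  qed
  have bound: "?l \<le> 2 * (\<integral>\<^sup>+\<omega>. ennreal ((step_integral W (N n) T \<omega> - (J' \<omega> - J \<omega>))\<^sup>2) \<partial>M)
      + 2 * (2 * norm2_sq (\<lambda>\<omega> u. step_process (N n) u \<omega> - indicator {s<..t} u * X u \<omega>) + 2 * ?r)" for n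
  proof -
    have [measurable]: "step_integral W (N n) T \<in> borel_measurable M"
      using N(1) assms by (intro step_integral_measurable) auto
    have [measurable]: "(\<lambda>(\<omega>, u). step_process (N n) u \<omega>) \<in> borel_measurable (M \<Otimes>\<^sub>M lborel)"
      using N(1) by (intro step_process_measurable) auto
    have "?l = (\<integral>\<^sup>+\<omega>. ennreal ((J' \<omega> - J \<omega> - step_integral W (N n) T \<omega> + 
        (step_integral W (N n) T \<omega> - Y \<omega> * (W t \<omega> - W s \<omega>)))\<^sup>2) \<partial>M)"
      by (simp add: algebra_simps)
    also have "\<dots> \<le> 2 * (\<integral>\<^sup>+\<omega>. ennreal ((J' \<omega> - J \<omega> - step_integral W (N n) T \<omega>)\<^sup>2) \<partial>M)
        + 2 * (\<integral>\<^sup>+\<omega>. ennreal ((step_integral W (N n) T \<omega> - Y \<omega> * (W t \<omega> - W s \<omega>))\<^sup>2) \<partial>M)"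
      by (intro nn_integral_square_add_le) measurable
    also have "(\<integral>\<^sup>+\<omega>. ennreal ((step_integral W (N n) T \<omega> - Y \<omega> * (W t \<omega> - W s \<omega>))\<^sup>2) \<partial>M)
        = norm2_sq (\<lambda>\<omega> u. step_process (N n @ neg_steps [(s, t, Y)]) u \<omega>)"
      using N(1) assms
      by (subst norm2_sq_step_process)
        (auto simp: adapted_steps_Cons intro!: adapted_steps_neg_steps)
    also have "\<dots> = norm2_sq (\<lambda>\<omega> u. (step_process (N n) u \<omega> - indicator {s<..t} u * X u \<omega>)
        + indicator {s<..t} u * (X u \<omega> - Y \<omega>))"
      by (simp add: algebra_simps)
    also have "\<dots> \<le> 2 * norm2_sq (\<lambda>\<omega> u. step_process (N n) u \<omega> - indicator {s<..t} u * X u \<omega>) + 2 * ?r"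
      by (intro norm2_sq_add_le) (simp_all add: right_diff_distrib split_beta')
    finally show ?thesis by (simp add: power2_commute add_mono mult_left_mono)
  qed
  have lim: "(\<lambda>n. 2 * (\<integral>\<^sup>+\<omega>. ennreal ((step_integral W (N n) T \<omega> - (J' \<omega> - J \<omega>))\<^sup>2) \<partial>M)
      + 2 * (2 * norm2_sq (\<lambda>\<omega> u. step_process (N n) u \<omega> - indicator {s<..t} u * X u \<omega>) + 2 * ?r))
    \<longlonglongrightarrow> 2 * 0 + 2 * (2 * 0 + 2 * ?r)"
    by (intro tendsto_add ennreal_tendsto_cmult N_lim tendsto_const) auto
  have "?l \<le> 2 * 0 + 2 * (2 * 0 + 2 * ?r)"
    using bound by (intro LIMSEQ_le_const[OF lim]) blast
  also have "\<dots> = 4 * ?r" by (simp add: mult.assoc[symmetric])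
  finally show ?thesis .
qed

text \<open>On each interval, Y times the coefficient is already known at the start of the interval,
  so the following increment has mean zero against it.\<close>

lemma step_integral_orthogonal:
  assumes "0 \<le> s" "adapted_steps M F T L" "\<And>x. x \<in> set L \<Longrightarrow> s \<le> fst x"
    and Y: "Y \<in> borel_measurable (F s)" "integrable M (\<lambda>\<omega>. (Y \<omega>)\<^sup>2)"
  shows "has_bochner_integral M (\<lambda>\<omega>. Y \<omega> * step_integral W L T \<omega>) 0"
  using assms(2,3)
proof (induction L)
  case (Cons x L)
  obtain u v X where x: "x = (u, v, X)" by (cases x) auto
  note X = Cons.prems(1)[unfolded x adapted_steps_Cons]
  have su: "s \<le> u" using Cons.prems(2)[of x] by (simp add: x)
  have Yu: "Y \<in> borel_measurable (F u)" using F_mono_measurable[OF su Y(1)] .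
  have IH: "has_bochner_integral M (\<lambda>\<omega>. Y \<omega> * step_integral W L T \<omega>) 0"
    using Cons.IH X Cons.prems(2) by (metis list.set_intros(2))
  have "has_bochner_integral M (\<lambda>\<omega>. (Y \<omega> * X \<omega>) * (W v \<omega> - W u \<omega>)) 0"
    using X Yu Y(2) F_measurable[OF _ _ Yu] F_measurable[of u X]
    by (intro mult_increment_1 integrable_mult_square_integrable) auto
  from has_bochner_integral_add[OF this IH] show ?case
    using X by (simp add: x algebra_simps)
qed (simp add: has_bochner_integral_iff)

text \<open>Orthogonality holds for the approximating step integrals, and it passes to the L2 limit
  by the Cauchy-Schwarz inequality.\<close>

lemma ito_increment_orthogonal:
  assumes "0 \<le> s" "s \<le> t" "t \<le> T"
    and X: "(\<lambda>(\<omega>, u). indicator {0..T} u * X u \<omega>) \<in> borel_measurable (M \<Otimes>\<^sub>M lborel)"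
    and J: "has_ito_integral M F T W X s J" and J': "has_ito_integral M F T W X t J'"
    and D: "integrable M (\<lambda>\<omega>. (J' \<omega> - J \<omega>)\<^sup>2)"
    and Y: "Y \<in> borel_measurable (F s)" "integrable M (\<lambda>\<omega>. (Y \<omega>)\<^sup>2)"
  shows "has_bochner_integral M (\<lambda>\<omega>. Y \<omega> * (J' \<omega> - J \<omega>)) 0"
proof -
  obtain N where N: "\<And>n. adapted_steps M F T (N n)"
    and N_start: "\<And>n x. x \<in> set (N n) \<Longrightarrow> s \<le> fst x"
    and N_lim: "(\<lambda>n::nat. \<integral>\<^sup>+\<omega>. ennreal ((step_integral W (N n) T \<omega> - (J' \<omega> - J \<omega>))\<^sup>2) \<partial>M) \<longlonglongrightarrow> 0"
    using ito_increment_approx[OF assms(1-6)] by blast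
  have [measurable]: "J \<in> borel_measurable M" "J' \<in> borel_measurable M"
    using J J' by (auto simp: has_ito_integral_def)
  have [measurable]: "Y \<in> borel_measurable M"
    using assms by (auto intro!: F_measurable[of s Y])
  have I: "integrable M (\<lambda>\<omega>. Y \<omega> * (J' \<omega> - J \<omega>))"
    using D Y(2) by (intro integrable_mult_square_integrable) auto
  define C where "C = (\<integral>\<^sup>+\<omega>. ennreal ((Y \<omega>)\<^sup>2) \<partial>M)"
  have C: "C < \<infinity>" using Y(2) integrable_square_iff_nn_integral[of Y M] by (simp add: C_def)
  have bound: "(ennreal \<bar>\<integral>\<omega>. Y \<omega> * (J' \<omega> - J \<omega>) \<partial>M\<bar>)\<^sup>2
      \<le> C * (\<integral>\<^sup>+\<omega>. ennreal ((step_integral W (N n) T \<omega> - (J' \<omega> - J \<omega>))\<^sup>2) \<partial>M)" for n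
  proof -
    have [measurable]: "step_integral W (N n) T \<in> borel_measurable M"
      using N(1) assms by (intro step_integral_measurable) auto
    have O: "has_bochner_integral M (\<lambda>\<omega>. Y \<omega> * step_integral W (N n) T \<omega>) 0"
      using assms N N_start by (intro step_integral_orthogonal) blast+
    have I2: "integrable M (\<lambda>\<omega>. Y \<omega> * (step_integral W (N n) T \<omega> - (J' \<omega> - J \<omega>)))"
      and E: "(\<integral>\<omega>. Y \<omega> * (step_integral W (N n) T \<omega> - (J' \<omega> - J \<omega>)) \<partial>M) = - (\<integral>\<omega>. Y \<omega> * (J' \<omega> - J \<omega>) \<partial>M)"
      using O I by (simp_all add: right_diff_distrib has_bochner_integral_iff)
    have "ennreal \<bar>\<integral>\<omega>. Y \<omega> * (J' \<omega> - J \<omega>) \<partial>M\<bar>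
        \<le> (\<integral>\<^sup>+\<omega>. ennreal (norm (Y \<omega> * (step_integral W (N n) T \<omega> - (J' \<omega> - J \<omega>)))) \<partial>M)"
      using integral_norm_bound_ennreal[OF I2] E by simp
    also have "\<dots> = (\<integral>\<^sup>+\<omega>. ennreal \<bar>Y \<omega>\<bar> * ennreal \<bar>step_integral W (N n) T \<omega> - (J' \<omega> - J \<omega>)\<bar> \<partial>M)"
      by (simp add: abs_mult ennreal_mult)
    finally have "(ennreal \<bar>\<integral>\<omega>. Y \<omega> * (J' \<omega> - J \<omega>) \<partial>M\<bar>)\<^sup>2
      \<le> (\<integral>\<^sup>+\<omega>. ennreal \<bar>Y \<omega>\<bar> * ennreal \<bar>step_integral W (N n) T \<omega> - (J' \<omega> - J \<omega>)\<bar> \<partial>M)\<^sup>2"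
      by (rule power_mono) simp
    also have "\<dots> \<le> (\<integral>\<^sup>+\<omega>. (ennreal \<bar>Y \<omega>\<bar>)\<^sup>2 \<partial>M) * (\<integral>\<^sup>+\<omega>. (ennreal \<bar>step_integral W (N n) T \<omega> - (J' \<omega> - J \<omega>)\<bar>)\<^sup>2 \<partial>M)"
      by (intro Cauchy_Schwarz_nn_integral) measurable
    finally show ?thesis by (simp add: C_def ennreal_power)
  qed
  have lim: "(\<lambda>n. C * (\<integral>\<^sup>+\<omega>. ennreal ((step_integral W (N n) T \<omega> - (J' \<omega> - J \<omega>))\<^sup>2) \<partial>M)) \<longlonglongrightarrow> C * 0"
    using C by (intro ennreal_tendsto_cmult N_lim) auto
  have "(ennreal \<bar>\<integral>\<omega>. Y \<omega> * (J' \<omega> - J \<omega>) \<partial>M\<bar>)\<^sup>2 \<le> C * 0"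
    using bound by (intro LIMSEQ_le_const[OF lim]) blast
  then show ?thesis using I by (simp add: has_bochner_integral_iff ennreal_power)
qed

text \<open>All step integrals vanish at time 0. \<open>solves_sde\<close> states the initial value
  only through its integral equation, and this recovers it.\<close>

lemma ito_integral_0:
  assumes "has_ito_integral M F T W X 0 J"
  shows "AE \<omega> in M. J \<omega> = 0"
proof -
  from assms obtain L where L: "\<And>n. adapted_steps M F T (L n)"
      "(\<lambda>n::nat. \<integral>\<^sup>+\<omega>. ennreal ((step_integral W (L n) 0 \<omega> - J \<omega>)\<^sup>2) \<partial>M) \<longlonglongrightarrow> 0" and
      [measurable]: "J \<in> borel_measurable M"
    unfolding has_ito_integral_def by blast
  have "(\<lambda>n::nat. \<integral>\<^sup>+\<omega>. ennreal ((J \<omega>)\<^sup>2) \<partial>M) \<longlonglongrightarrow> 0"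
    using L(2) by (simp add: step_integral_0[OF L(1)])
  then have "(\<integral>\<^sup>+\<omega>. ennreal ((J \<omega>)\<^sup>2) \<partial>M) = 0" by (simp add: LIMSEQ_const_iff)
  then show ?thesis by (subst (asm) nn_integral_0_iff_AE) (auto simp: ennreal_eq_0_iff)
qed

end

section \<open>Linear stochastic differential equations\<close>

text \<open>Measurability is given for each fixed time only; continuity of the paths makes the
  process a limit of processes with countably many time values, which are jointly
  measurable.\<close>

lemma continuous_process_measurable:
  fixes S :: "real \<Rightarrow> 'a \<Rightarrow> real"
  assumes "0 \<le> T" and S: "\<And>t. t \<in> {0..T} \<Longrightarrow> S t \<in> borel_measurable M"
    and cont: "\<And>\<omega>. \<omega> \<in> space M \<Longrightarrow> continuous_on {0..T} (\<lambda>t. S t \<omega>)"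
  shows "(\<lambda>(\<omega>, u). indicator {0..T} u * S u \<omega>) \<in> borel_measurable (M \<Otimes>\<^sub>M lborel)"
proof -
  \<comment> \<open>Clamping time to [0, T]: nothing is known about S outside, and the clamped
    process is continuous in u on the whole line.\<close>
  define c where "c u = max 0 (min T u)" for u
  have c: "c u \<in> {0..T}" for u using assms(1) by (auto simp: c_def)
  \<comment> \<open>Rounding down to the grid of mesh 1/(n+1), so that only countably many times
    occur.\<close>
  define q where "q n u = real_of_int \<lfloor>real (Suc n) * u\<rfloor> / real (Suc n)" for n and u :: real
  have q_lim: "(\<lambda>n. q n u) \<longlonglongrightarrow> u" for u
  proof (rule tendsto_sandwich)
    show "\<forall>\<^sub>F n in sequentially. u - 1 / real (Suc n) \<le> q n u"
    proof (intro always_eventually allI)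
      fix n
      have "real (Suc n) * u - 1 \<le> real_of_int \<lfloor>real (Suc n) * u\<rfloor>" by linarith
      then have "(real (Suc n) * u - 1) / real (Suc n) \<le> q n u"
        unfolding q_def by (rule divide_right_mono) simp
      then show "u - 1 / real (Suc n) \<le> q n u" by (simp add: diff_divide_distrib)
    qed
    show "\<forall>\<^sub>F n in sequentially. q n u \<le> u"
    proof (intro always_eventually allI)
      fix n
      have "real_of_int \<lfloor>real (Suc n) * u\<rfloor> \<le> u * real (Suc n)"
        by (subst mult.commute) (rule of_int_floor_le)
      then show "q n u \<le> u" unfolding q_def by (simp add: pos_divide_le_eq)
    qed
    show "(\<lambda>n. u - 1 / real (Suc n)) \<longlonglongrightarrow> u"
      using tendsto_diff[OF tendsto_const lim_1_over_n[THEN LIMSEQ_Suc]] by simp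
  qed simp
  have "(\<lambda>x. S (c (snd x)) (fst x)) \<in> borel_measurable (M \<Otimes>\<^sub>M lborel)"
  proof (rule borel_measurable_LIMSEQ_metric)
    fix n
    have [measurable]: "(\<lambda>x. S (c (real_of_int i / real (Suc n))) (fst x)) \<in> borel_measurable (M \<Otimes>\<^sub>M lborel)" for i
      using S[OF c] by (rule measurable_compose[OF measurable_fst])
    have "(\<lambda>x :: 'a \<times> real. \<lfloor>real (Suc n) * snd x\<rfloor>) \<in> measurable (M \<Otimes>\<^sub>M lborel) (count_space UNIV)"
      by measurable
    then show "(\<lambda>x. S (c (q n (snd x))) (fst x)) \<in> borel_measurable (M \<Otimes>\<^sub>M lborel)"
      unfolding q_def by (rule measurable_compose_countable[rotated]) measurable
  next
    fix x :: "'a \<times> real" assume "x \<in> space (M \<Otimes>\<^sub>M lborel)"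
    then have x: "fst x \<in> space M" by (auto simp: space_pair_measure)
    have "(\<lambda>n. c (q n (snd x))) \<longlonglongrightarrow> c (snd x)"
      unfolding c_def by (intro tendsto_max tendsto_min tendsto_const q_lim)
    then show "(\<lambda>n. S (c (q n (snd x))) (fst x)) \<longlonglongrightarrow> S (c (snd x)) (fst x)"
      using cont[OF x] c by (auto simp: continuous_on_sequentially comp_def)
  qed
  then have "(\<lambda>x. indicator {0..T} (snd x) * S (c (snd x)) (fst x)) \<in> borel_measurable (M \<Otimes>\<^sub>M lborel)"
    by measurable
  also have "(\<lambda>x. indicator {0..T} (snd x) * S (c (snd x)) (fst x)) = (\<lambda>(\<omega>, u). indicator {0..T} u * S u \<omega>)"
    by (auto simp: fun_eq_iff c_def indicator_def)
  finally show ?thesis .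
qed

text \<open>Cauchy-Schwarz against the indicator of A. The factor \<open>emeasure lborel A\<close>
  is what later makes drift errors one order smaller than noise errors.\<close>

lemma square_integral_le:
  fixes f :: "real \<Rightarrow> real"
  assumes [measurable]: "f \<in> borel_measurable lborel" and A [measurable]: "A \<in> sets lborel"
    and f: "integrable lborel (\<lambda>u. indicator A u * f u)"
  shows "ennreal ((\<integral>u. indicator A u * f u \<partial>lborel)\<^sup>2)
    \<le> emeasure lborel A * (\<integral>\<^sup>+u. ennreal ((indicator A u * f u)\<^sup>2) \<partial>lborel)"
proof -
  have "ennreal \<bar>\<integral>u. indicator A u * f u \<partial>lborel\<bar> \<le> (\<integral>\<^sup>+u. ennreal (norm (indicator A u * f u)) \<partial>lborel)"
    using integral_norm_bound_ennreal[OF f] by simp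
  also have "\<dots> = (\<integral>\<^sup>+u. indicator A u * ennreal \<bar>indicator A u * f u\<bar> \<partial>lborel)"
    by (intro nn_integral_cong) (auto simp: indicator_def)
  finally have "(ennreal \<bar>\<integral>u. indicator A u * f u \<partial>lborel\<bar>)\<^sup>2
      \<le> (\<integral>\<^sup>+u. indicator A u * ennreal \<bar>indicator A u * f u\<bar> \<partial>lborel)\<^sup>2"
    by (rule power_mono) simp
  also have "\<dots> \<le> (\<integral>\<^sup>+u. (indicator A u)\<^sup>2 \<partial>lborel) * (\<integral>\<^sup>+u. (ennreal \<bar>indicator A u * f u\<bar>)\<^sup>2 \<partial>lborel)"
    by (intro Cauchy_Schwarz_nn_integral) measurable
  also have "(\<integral>\<^sup>+u. (indicator A u)\<^sup>2 \<partial>lborel) = emeasure lborel A"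
    by (subst nn_integral_indicator[OF A, symmetric], intro nn_integral_cong) (auto simp: indicator_def)
  finally show ?thesis by (simp add: ennreal_power)
qed

lemma nn_integral_square_leD:
  fixes f :: "'a \<Rightarrow> real"
  assumes [measurable]: "f \<in> borel_measurable M" and "(\<integral>\<^sup>+x. ennreal ((f x)\<^sup>2) \<partial>M) \<le> ennreal c" "0 \<le> c"
  shows "integrable M (\<lambda>x. (f x)\<^sup>2)" and "(\<integral>x. (f x)\<^sup>2 \<partial>M) \<le> c"
proof -
  show I: "integrable M (\<lambda>x. (f x)\<^sup>2)"
    using assms(2) by (subst integrable_square_iff_nn_integral) (auto simp: less_top[symmetric] top_unique)
  have "ennreal (\<integral>x. (f x)\<^sup>2 \<partial>M) \<le> ennreal c"
    using assms(2) nn_integral_eq_integral[OF I] by simp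
  then show "(\<integral>x. (f x)\<^sup>2 \<partial>M) \<le> c" using assms(3) by (simp add: ennreal_le_iff)
qed

context scalar_wiener
begin

lemma norm2_sq_cmult:
  assumes [measurable]: "case_prod X \<in> borel_measurable (M \<Otimes>\<^sub>M lborel)"
  shows "norm2_sq (\<lambda>\<omega> u. c * X \<omega> u) = ennreal (c\<^sup>2) * norm2_sq X"
proof -
  have "norm2_sq (\<lambda>\<omega> u. c * X \<omega> u) = (\<integral>\<^sup>+\<omega>. ennreal (c\<^sup>2) * (\<integral>\<^sup>+u. ennreal ((X \<omega> u)\<^sup>2) \<partial>lborel) \<partial>M)"
    unfolding norm2_sq_def power_mult_distrib
    by (intro nn_integral_cong) (simp add: ennreal_mult nn_integral_cmult)
  then show ?thesis
    unfolding norm2_sq_def by (simp add: nn_integral_cmult)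
qed

text \<open>Square integrability of the integrand is extracted from the approximation: some step
  process lies at squared distance less than 1, and step processes have finite norm by the
  isometry.\<close>

lemma ito_integrand_norm2_finite:
  assumes "0 \<le> s" "s \<le> t" "t \<le> T"
    and X [measurable]: "(\<lambda>(\<omega>, u). indicator {0..T} u * X u \<omega>) \<in> borel_measurable (M \<Otimes>\<^sub>M lborel)"
    and J: "has_ito_integral M F T W X s J" and J': "has_ito_integral M F T W X t J'"
  shows "norm2_sq (\<lambda>\<omega> u. indicator {s<..t} u * X u \<omega>) < \<infinity>"
proof -
  obtain N where N: "\<And>n. adapted_steps M F T (N n)"
    and N_lim: "(\<lambda>n::nat. norm2_sq (\<lambda>\<omega> u. step_process (N n) u \<omega> - indicator {s<..t} u * X u \<omega>)) \<longlonglongrightarrow> 0"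
    using ito_increment_approx[OF assms] by blast
  have [measurable]: "(\<lambda>(\<omega>, u). indicator {s<..t} u * X u \<omega>) \<in> borel_measurable (M \<Otimes>\<^sub>M lborel)"
  proof -
    have "(\<lambda>(\<omega>, u). indicator {s<..t} u * X u \<omega>) = (\<lambda>(\<omega>, u). indicator {s<..t} u * (indicator {0..T} u * X u \<omega>))"
      using assms by (auto simp: fun_eq_iff indicator_def)
    then show ?thesis by simp
  qed
  have "\<forall>\<^sub>F n in sequentially. norm2_sq (\<lambda>\<omega> u. step_process (N n) u \<omega> - indicator {s<..t} u * X u \<omega>) < 1"
    using N_lim by (rule order_tendstoD) simp
  then obtain n where n: "norm2_sq (\<lambda>\<omega> u. step_process (N n) u \<omega> - indicator {s<..t} u * X u \<omega>) < 1"
    by (auto simp: eventually_sequentially)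
  have [measurable]: "(\<lambda>(\<omega>, u). step_process (N n) u \<omega>) \<in> borel_measurable (M \<Otimes>\<^sub>M lborel)"
    using N by (rule step_process_measurable)
  have "norm2_sq (\<lambda>\<omega> u. step_process (N n) u \<omega>) < \<infinity>"
    unfolding norm2_sq_step_process[OF N] using step_integral_square_integrable[OF N, of n] assms
    by (subst integrable_square_iff_nn_integral[symmetric]) (auto intro!: step_integral_measurable N)
  have "norm2_sq (\<lambda>\<omega> u. indicator {s<..t} u * X u \<omega>)
      = norm2_sq (\<lambda>\<omega> u. step_process (N n) u \<omega>
          + (-1) * (step_process (N n) u \<omega> - indicator {s<..t} u * X u \<omega>))" by simp
  also have "\<dots> \<le> 2 * norm2_sq (\<lambda>\<omega> u. step_process (N n) u \<omega>)
      + 2 * norm2_sq (\<lambda>\<omega> u. (-1) * (step_process (N n) u \<omega> - indicator {s<..t} u * X u \<omega>))"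
    by (intro norm2_sq_add_le) (simp_all add: split_beta')
  also have "norm2_sq (\<lambda>\<omega> u. (-1) * (step_process (N n) u \<omega> - indicator {s<..t} u * X u \<omega>))
      = norm2_sq (\<lambda>\<omega> u. step_process (N n) u \<omega> - indicator {s<..t} u * X u \<omega>)"
    by (subst norm2_sq_cmult) (simp_all add: split_beta')
  also have "2 * norm2_sq (\<lambda>\<omega> u. step_process (N n) u \<omega>) + 2 * \<dots> < \<infinity>"
    using n \<open>norm2_sq (\<lambda>\<omega> u. step_process (N n) u \<omega>) < \<infinity>\<close>
    by (auto simp: ennreal_mult_less_top ennreal_add_less_top intro: less_trans)
  finally show ?thesis .
qed

end

locale linear_sde = scalar_wiener +
  fixes \<alpha> \<sigma> x0 :: real and S :: "real \<Rightarrow> 'a \<Rightarrow> real"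
  assumes T_pos: "0 < T" and \<sigma>_pos: "0 < \<sigma>"
    and sde: "solves_sde M F T W (\<lambda>x. \<alpha> * x) (\<lambda>x. \<sigma> * x) x0 S"
begin

section \<open>Measurability, drift part and stochastic part of the solution\<close>

lemma S_adapted: "t \<in> {0..T} \<Longrightarrow> S t \<in> borel_measurable (F t)"
  using sde by (auto simp: solves_sde_def)

lemma S_measurable: "t \<in> {0..T} \<Longrightarrow> S t \<in> borel_measurable M"
  using F_measurable[of t] S_adapted by auto

lemma S_continuous: "\<omega> \<in> space M \<Longrightarrow> continuous_on {0..T} (\<lambda>t. S t \<omega>)"
  using sde by (auto simp: solves_sde_def)

lemma S_joint_measurable [measurable]:
  "(\<lambda>(\<omega>, u). indicator {0..T} u * S u \<omega>) \<in> borel_measurable (M \<Otimes>\<^sub>M lborel)"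
  using T_pos by (intro continuous_process_measurable S_measurable S_continuous) auto

lemma S_restrict_measurable:
  assumes "A \<subseteq> {0..T}" and [measurable]: "A \<in> sets borel"
  shows "(\<lambda>(\<omega>, u). indicator A u * S u \<omega>) \<in> borel_measurable (M \<Otimes>\<^sub>M lborel)"
proof -
  have "(\<lambda>(\<omega>, u). indicator A u * S u \<omega>) = (\<lambda>(\<omega>, u). indicator A u * (indicator {0..T} u * S u \<omega>))"
    using assms by (auto simp: fun_eq_iff indicator_def)
  then show ?thesis by simp
qed

lemma S_integrable:
  assumes "\<omega> \<in> space M" "A \<subseteq> {0..T}" "A \<in> sets borel"
  shows "integrable lborel (\<lambda>u. indicator A u * S u \<omega>)"
proof -
  have "set_integrable lborel {0..T} (\<lambda>u. S u \<omega>)"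
    using S_continuous[OF assms(1)] by (rule borel_integrable_atLeastAtMost')
  then have "set_integrable lborel A (\<lambda>u. S u \<omega>)"
    by (rule set_integrable_subset) (use assms in auto)
  then show ?thesis by (simp add: set_integrable_def)
qed

definition drift :: "real \<Rightarrow> real \<Rightarrow> 'a \<Rightarrow> real" where
  "drift s t \<omega> = \<alpha> * (\<integral>u. indicator {s<..t} u * S u \<omega> \<partial>lborel)"

lemma drift_measurable:
  assumes "0 \<le> s" "t \<le> T"
  shows "drift s t \<in> borel_measurable M"
proof -
  have [measurable]: "(\<lambda>(\<omega>, u). indicator {s<..t} u * S u \<omega>) \<in> borel_measurable (M \<Otimes>\<^sub>M lborel)"
    using assms by (intro S_restrict_measurable) auto
  show ?thesis unfolding drift_def[abs_def] by measurable
qed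

lemma drift_eq_LBINT:
  assumes "0 \<le> t" "t \<le> T"
  shows "(LBINT s=ereal 0..ereal t. \<alpha> * S s \<omega>) = drift 0 t \<omega>"
  using assms by (simp add: interval_integral_Ioc set_lebesgue_integral_def drift_def)

lemma drift_diff:
  assumes "0 \<le> s" "s \<le> t" "t \<le> T" "\<omega> \<in> space M"
  shows "drift 0 t \<omega> - drift 0 s \<omega> = drift s t \<omega>"
proof -
  have I: "integrable lborel (\<lambda>u. indicator {0<..s} u * S u \<omega>)" "integrable lborel (\<lambda>u. indicator {s<..t} u * S u \<omega>)"
    using assms by (auto intro!: S_integrable)
  have "(\<integral>u. indicator {0<..t} u * S u \<omega> \<partial>lborel)
      = (\<integral>u. indicator {0<..s} u * S u \<omega> + indicator {s<..t} u * S u \<omega> \<partial>lborel)"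
    using assms by (intro Bochner_Integration.integral_cong) (auto simp: indicator_def)
  also have "\<dots> = (\<integral>u. indicator {0<..s} u * S u \<omega> \<partial>lborel) + (\<integral>u. indicator {s<..t} u * S u \<omega> \<partial>lborel)"
    using I by (rule Bochner_Integration.integral_add)
  finally show ?thesis
    unfolding drift_def by (simp only: distrib_left add_diff_cancel_left')
qed

text \<open>The equation provides a stochastic integral separately for each time; choice bundles
  them into a family. No regularity in t is claimed for it, as only finitely many times are used
  together.\<close>

lemma ito_parts:
  obtains J where "\<And>t. t \<in> {0..T} \<Longrightarrow> has_ito_integral M F T W (\<lambda>s \<omega>. \<sigma> * S s \<omega>) t (J t)"
    and "\<And>t. t \<in> {0..T} \<Longrightarrow> AE \<omega> in M. S t \<omega> = x0 + drift 0 t \<omega> + J t \<omega>"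
proof -
  have "\<forall>t\<in>{0..T}. \<exists>J. has_ito_integral M F T W (\<lambda>s \<omega>. \<sigma> * S s \<omega>) t J \<and>
        (AE \<omega> in M. S t \<omega> = x0 + drift 0 t \<omega> + J \<omega>)"
    using sde drift_eq_LBINT unfolding solves_sde_def by auto
  from bchoice[OF this] obtain J where "\<forall>t\<in>{0..T}. has_ito_integral M F T W (\<lambda>s \<omega>. \<sigma> * S s \<omega>) t (J t) \<and>
        (AE \<omega> in M. S t \<omega> = x0 + drift 0 t \<omega> + J t \<omega>)" ..
  then show thesis using that[of J] by blast
qed

text \<open>The time integral over (s, t] of the square mean of S - Y: the error made by freezing S
  at Y. It is used with Y = 0 for a priori bounds and with Y = S_s for the local error.\<close>

definition variation :: "real \<Rightarrow> real \<Rightarrow> ('a \<Rightarrow> real) \<Rightarrow> ennreal" where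
  "variation s t Y = norm2_sq (\<lambda>\<omega> u. indicator {s<..t} u * (S u \<omega> - Y \<omega>))"

lemma variation_measurable [measurable]:
  assumes "0 \<le> s" "t \<le> T" and [measurable]: "Y \<in> borel_measurable M"
  shows "(\<lambda>(\<omega>, u). indicator {s<..t} u * (S u \<omega> - Y \<omega>)) \<in> borel_measurable (M \<Otimes>\<^sub>M lborel)"
proof -
  have [measurable]: "(\<lambda>(\<omega>, u). indicator {s<..t} u * S u \<omega>) \<in> borel_measurable (M \<Otimes>\<^sub>M lborel)"
    using assms by (intro S_restrict_measurable) auto
  show ?thesis by (simp add: right_diff_distrib split_beta')
qed

text \<open>Cauchy-Schwarz in time gains the factor t - s compared with the bound for the stochastic
  part.\<close>

lemma drift_bound:
  assumes "0 \<le> s" "s \<le> t" "t \<le> T" and [measurable]: "Y \<in> borel_measurable M"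
  shows "(\<integral>\<^sup>+\<omega>. ennreal ((drift s t \<omega> - \<alpha> * (t - s) * Y \<omega>)\<^sup>2) \<partial>M) \<le> ennreal (\<alpha>\<^sup>2 * (t - s)) * variation s t Y"
proof -
  note [measurable] = variation_measurable[OF assms(1,3,4)]
  have "ennreal ((drift s t \<omega> - \<alpha> * (t - s) * Y \<omega>)\<^sup>2)
      \<le> ennreal (\<alpha>\<^sup>2 * (t - s)) * (\<integral>\<^sup>+u. ennreal ((indicator {s<..t} u * (S u \<omega> - Y \<omega>))\<^sup>2) \<partial>lborel)"
    if \<omega>: "\<omega> \<in> space M" for \<omega>
  proof -
    have I: "integrable lborel (\<lambda>u. indicator {s<..t} u * S u \<omega>)"
      using assms \<omega> by (intro S_integrable) auto
    have C: "integrable lborel (\<lambda>u. indicator {s<..t} u * Y \<omega>)"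
      using assms(2) by simp
    have m [measurable]: "(\<lambda>u. indicator {s<..t} u * (S u \<omega> - Y \<omega>)) \<in> borel_measurable lborel"
      using I C by (auto simp: right_diff_distrib)
    have i: "integrable lborel (\<lambda>u. indicator {s<..t} u * (indicator {s<..t} u * (S u \<omega> - Y \<omega>)))"
      using Bochner_Integration.integrable_diff[OF I C]
      by (rule Bochner_Integration.integrable_cong[THEN iffD1, rotated 2]) (auto simp: indicator_def)
    have "(\<integral>u. indicator {s<..t} u * (indicator {s<..t} u * (S u \<omega> - Y \<omega>)) \<partial>lborel)
      = (\<integral>u. indicator {s<..t} u * S u \<omega> - indicator {s<..t} u * Y \<omega> \<partial>lborel)"
      by (intro Bochner_Integration.integral_cong) (auto simp: indicator_def)
    also have "\<dots> = (\<integral>u. indicator {s<..t} u * S u \<omega> \<partial>lborel) - (t - s) * Y \<omega>"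
      using assms(2) by (subst Bochner_Integration.integral_diff[OF I C]) simp
    finally have eq: "(\<integral>u. indicator {s<..t} u * (indicator {s<..t} u * (S u \<omega> - Y \<omega>)) \<partial>lborel)
      = (\<integral>u. indicator {s<..t} u * S u \<omega> \<partial>lborel) - (t - s) * Y \<omega>" .
    have "drift s t \<omega> - \<alpha> * (t - s) * Y \<omega> = \<alpha> * (\<integral>u. indicator {s<..t} u * (indicator {s<..t} u * (S u \<omega> - Y \<omega>)) \<partial>lborel)"
      unfolding eq by (simp add: drift_def algebra_simps)
    then have "ennreal ((drift s t \<omega> - \<alpha> * (t - s) * Y \<omega>)\<^sup>2)
      = ennreal (\<alpha>\<^sup>2) * ennreal ((\<integral>u. indicator {s<..t} u * (indicator {s<..t} u * (S u \<omega> - Y \<omega>)) \<partial>lborel)\<^sup>2)"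
      by (simp add: power_mult_distrib ennreal_mult)
    also have "\<dots> \<le> ennreal (\<alpha>\<^sup>2) * (emeasure lborel {s<..t} *
        (\<integral>\<^sup>+u. ennreal ((indicator {s<..t} u * (indicator {s<..t} u * (S u \<omega> - Y \<omega>)))\<^sup>2) \<partial>lborel))"
      by (intro mult_left_mono square_integral_le i m) auto
    also have "(\<integral>\<^sup>+u. ennreal ((indicator {s<..t} u * (indicator {s<..t} u * (S u \<omega> - Y \<omega>)))\<^sup>2) \<partial>lborel)
      = (\<integral>\<^sup>+u. ennreal ((indicator {s<..t} u * (S u \<omega> - Y \<omega>))\<^sup>2) \<partial>lborel)"
      by (intro nn_integral_cong) (auto simp: indicator_def)
    finally show ?thesis
      using assms(2) by (simp add: ennreal_mult mult.assoc)
  qed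
  then have "(\<integral>\<^sup>+\<omega>. ennreal ((drift s t \<omega> - \<alpha> * (t - s) * Y \<omega>)\<^sup>2) \<partial>M)
      \<le> (\<integral>\<^sup>+\<omega>. ennreal (\<alpha>\<^sup>2 * (t - s)) * (\<integral>\<^sup>+u. ennreal ((indicator {s<..t} u * (S u \<omega> - Y \<omega>))\<^sup>2) \<partial>lborel) \<partial>M)"
    by (intro nn_integral_mono) auto
  also have "\<dots> = ennreal (\<alpha>\<^sup>2 * (t - s)) * variation s t Y"
    unfolding variation_def norm2_sq_def by (intro nn_integral_cmult) measurable
  finally show ?thesis .
qed

lemma variation_le_integral:
  assumes "0 \<le> s" "s \<le> t" "t \<le> T" and [measurable]: "Y \<in> borel_measurable M"
    and c: "0 \<le> c" "\<And>u. u \<in> {s<..t} \<Longrightarrow> (\<integral>\<^sup>+\<omega>. ennreal ((S u \<omega> - Y \<omega>)\<^sup>2) \<partial>M) \<le> ennreal c"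
  shows "variation s t Y \<le> ennreal (c * (t - s))"
proof -
  interpret P: pair_sigma_finite M lborel ..
  note [measurable] = variation_measurable[OF assms(1,3,4)]
  have "variation s t Y = (\<integral>\<^sup>+u. (\<integral>\<^sup>+\<omega>. ennreal ((indicator {s<..t} u * (S u \<omega> - Y \<omega>))\<^sup>2) \<partial>M) \<partial>lborel)"
    unfolding variation_def norm2_sq_def by (rule P.Fubini'[symmetric]) measurable
  also have "\<dots> \<le> (\<integral>\<^sup>+u. ennreal c * indicator {s<..t} u \<partial>lborel)"
    using c(2) by (intro nn_integral_mono) (auto simp: indicator_def)
  also have "\<dots> = ennreal (c * (t - s))"
    using assms(2) c(1) by (simp add: nn_integral_cmult ennreal_mult)
  finally show ?thesis .
qed

end

section \<open>A priori bounds and the Euler recursion for the solution\<close>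

lemma ennreal_double_add:
  assumes "0 \<le> a" "0 \<le> b"
  shows "2 * ennreal a + 2 * ennreal b = ennreal (2 * a + 2 * b)"
  using assms by (simp add: ennreal_plus ennreal_mult')

text \<open>Freezing the coefficients at Y leaves a drift error \<open>\<mu>\<close> and a
  stochastic error \<open>\<nu>\<close>. They are functions of Y because the choice Y = S_s requires
  S_s to be square integrable, which is obtained from the choice Y = 0 first. For Y = 0,
  \<open>\<nu>\<close> is the bare increment of the stochastic integral; its square integrability is
  what the orthogonality clause asks for.\<close>

lemma (in linear_sde) S_increment_decomposition:
  obtains \<mu> \<nu> :: "real \<Rightarrow> real \<Rightarrow> ('a \<Rightarrow> real) \<Rightarrow> 'a \<Rightarrow> real"
  where "\<And>s t Y. 0 \<le> s \<Longrightarrow> s \<le> t \<Longrightarrow> t \<le> T \<Longrightarrow> Y \<in> borel_measurable M \<Longrightarrow>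
      \<mu> s t Y \<in> borel_measurable M \<and> \<nu> s t Y \<in> borel_measurable M"
    and "\<And>s t Y. 0 \<le> s \<Longrightarrow> s \<le> t \<Longrightarrow> t \<le> T \<Longrightarrow>
      AE \<omega> in M. S t \<omega> = S s \<omega> + (\<alpha> * (t - s) + \<sigma> * (W t \<omega> - W s \<omega>)) * Y \<omega> + \<mu> s t Y \<omega> + \<nu> s t Y \<omega>"
    and "\<And>s t Y. 0 \<le> s \<Longrightarrow> s \<le> t \<Longrightarrow> t \<le> T \<Longrightarrow> Y \<in> borel_measurable M \<Longrightarrow>
      (\<integral>\<^sup>+\<omega>. ennreal ((\<mu> s t Y \<omega>)\<^sup>2) \<partial>M) \<le> ennreal (\<alpha>\<^sup>2 * (t - s)) * variation s t Y"
    and "\<And>s t Y. 0 \<le> s \<Longrightarrow> s \<le> t \<Longrightarrow> t \<le> T \<Longrightarrow> Y \<in> borel_measurable (F s) \<Longrightarrow>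
      integrable M (\<lambda>\<omega>. (Y \<omega>)\<^sup>2) \<Longrightarrow>
      (\<integral>\<^sup>+\<omega>. ennreal ((\<nu> s t Y \<omega>)\<^sup>2) \<partial>M) \<le> ennreal (4 * \<sigma>\<^sup>2) * variation s t Y"
    and "\<And>s t Y X. 0 \<le> s \<Longrightarrow> s \<le> t \<Longrightarrow> t \<le> T \<Longrightarrow> Y \<in> borel_measurable (F s) \<Longrightarrow>
      integrable M (\<lambda>\<omega>. (Y \<omega>)\<^sup>2) \<Longrightarrow> X \<in> borel_measurable (F s) \<Longrightarrow>
      integrable M (\<lambda>\<omega>. (X \<omega>)\<^sup>2) \<Longrightarrow> integrable M (\<lambda>\<omega>. (\<nu> s t (\<lambda>_. 0) \<omega>)\<^sup>2) \<Longrightarrow>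
      has_bochner_integral M (\<lambda>\<omega>. X \<omega> * \<nu> s t Y \<omega>) 0"
    and "AE \<omega> in M. S 0 \<omega> = x0"
proof -
  obtain J where J: "\<And>t. t \<in> {0..T} \<Longrightarrow> has_ito_integral M F T W (\<lambda>s \<omega>. \<sigma> * S s \<omega>) t (J t)"
    and S: "\<And>t. t \<in> {0..T} \<Longrightarrow> AE \<omega> in M. S t \<omega> = x0 + drift 0 t \<omega> + J t \<omega>"
    by (rule ito_parts) blast
  have Jm: "J t \<in> borel_measurable M" if "t \<in> {0..T}" for t
    using J[OF that] by (simp add: has_ito_integral_def)
  have X: "(\<lambda>(\<omega>, u). indicator {0..T} u * (\<sigma> * S u \<omega>)) \<in> borel_measurable (M \<Otimes>\<^sub>M lborel)"
    using borel_measurable_times[OF borel_measurable_const[of \<sigma>] S_joint_measurable]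
    by (simp add: split_beta' mult.left_commute)
  define \<mu> where "\<mu> s t Y \<omega> = drift s t \<omega> - \<alpha> * (t - s) * Y \<omega>" for s t Y \<omega>
  define \<nu> where "\<nu> s t Y \<omega> = J t \<omega> - J s \<omega> - (\<sigma> * Y \<omega>) * (W t \<omega> - W s \<omega>)" for s t Y \<omega>
  show thesis
  proof (rule that[of \<mu> \<nu>])
    fix s t :: real and Y assume st: "0 \<le> s" "s \<le> t" "t \<le> T"
    show "AE \<omega> in M. S t \<omega> = S s \<omega> + (\<alpha> * (t - s) + \<sigma> * (W t \<omega> - W s \<omega>)) * Y \<omega> + \<mu> s t Y \<omega> + \<nu> s t Y \<omega>"
    proof -
      have "AE \<omega> in M. S s \<omega> = x0 + drift 0 s \<omega> + J s \<omega>" "AE \<omega> in M. S t \<omega> = x0 + drift 0 t \<omega> + J t \<omega>"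
        using S st by auto
      then show ?thesis
        using AE_space
      proof eventually_elim
        case (elim \<omega>)
        then show ?case using st drift_diff[of s t \<omega>] by (simp add: \<mu>_def \<nu>_def algebra_simps)
      qed
    qed
    {
      assume [measurable]: "Y \<in> borel_measurable M"
      have [measurable]: "drift s t \<in> borel_measurable M" "J s \<in> borel_measurable M" "J t \<in> borel_measurable M"
        "W s \<in> borel_measurable M" "W t \<in> borel_measurable M"
        using st by (auto intro!: drift_measurable Jm W_measurable)
      show "\<mu> s t Y \<in> borel_measurable M \<and> \<nu> s t Y \<in> borel_measurable M"
        unfolding \<mu>_def[abs_def] \<nu>_def[abs_def] by auto
      show "(\<integral>\<^sup>+\<omega>. ennreal ((\<mu> s t Y \<omega>)\<^sup>2) \<partial>M) \<le> ennreal (\<alpha>\<^sup>2 * (t - s)) * variation s t Y"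
        unfolding \<mu>_def using st by (intro drift_bound) auto
    }
    assume Y: "Y \<in> borel_measurable (F s)" "integrable M (\<lambda>\<omega>. (Y \<omega>)\<^sup>2)"
    have Ym [measurable]: "Y \<in> borel_measurable M" using F_measurable[of s Y] Y st by auto
    note [measurable] = variation_measurable[OF st(1,3) Ym]
    have "(\<integral>\<^sup>+\<omega>. ennreal ((\<nu> s t Y \<omega>)\<^sup>2) \<partial>M)
        \<le> 4 * norm2_sq (\<lambda>\<omega> u. indicator {s<..t} u * (\<sigma> * S u \<omega> - \<sigma> * Y \<omega>))"
      unfolding \<nu>_def using st Y X by (intro ito_increment_bound J integrable_square_cmult) auto
    also have "norm2_sq (\<lambda>\<omega> u. indicator {s<..t} u * (\<sigma> * S u \<omega> - \<sigma> * Y \<omega>))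
      = norm2_sq (\<lambda>\<omega> u. \<sigma> * (indicator {s<..t} u * (S u \<omega> - Y \<omega>)))"
      by (simp add: algebra_simps)
    also have "\<dots> = ennreal (\<sigma>\<^sup>2) * variation s t Y"
      unfolding variation_def using st by (intro norm2_sq_cmult variation_measurable) auto
    finally show "(\<integral>\<^sup>+\<omega>. ennreal ((\<nu> s t Y \<omega>)\<^sup>2) \<partial>M) \<le> ennreal (4 * \<sigma>\<^sup>2) * variation s t Y"
      by (simp add: ennreal_mult mult.assoc)
    fix X' :: "'a \<Rightarrow> real" assume X': "X' \<in> borel_measurable (F s)" "integrable M (\<lambda>\<omega>. (X' \<omega>)\<^sup>2)"
      and I0: "integrable M (\<lambda>\<omega>. (\<nu> s t (\<lambda>_. 0) \<omega>)\<^sup>2)"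
    have "has_bochner_integral M (\<lambda>\<omega>. X' \<omega> * (J t \<omega> - J s \<omega>)) 0"
      using st I0 by (intro ito_increment_orthogonal[OF st X J[of s] J[of t] _ X']) (auto simp: \<nu>_def)
    moreover have "has_bochner_integral M (\<lambda>\<omega>. (X' \<omega> * (\<sigma> * Y \<omega>)) * (W t \<omega> - W s \<omega>)) 0"
    proof (rule mult_increment_1[OF st])
      have sT: "s \<le> T" using st by simp
      note [measurable] = F_measurable[OF st(1) sT X'(1)]
      show "integrable M (\<lambda>\<omega>. X' \<omega> * (\<sigma> * Y \<omega>))"
        by (rule integrable_mult_square_integrable[OF _ _ X'(2) integrable_square_cmult[OF Y(2)]]) measurable
      show "(\<lambda>\<omega>. X' \<omega> * (\<sigma> * Y \<omega>)) \<in> borel_measurable (F s)" using X'(1) Y(1) by measurable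
    qed
    ultimately have "has_bochner_integral M (\<lambda>\<omega>. X' \<omega> * (J t \<omega> - J s \<omega>) - (X' \<omega> * (\<sigma> * Y \<omega>)) * (W t \<omega> - W s \<omega>)) (0 - 0)"
      by (rule has_bochner_integral_diff)
    then show "has_bochner_integral M (\<lambda>\<omega>. X' \<omega> * \<nu> s t Y \<omega>) 0"
      by (simp add: \<nu>_def right_diff_distrib mult.assoc)
  next
    have "has_ito_integral M F T W (\<lambda>s \<omega>. \<sigma> * S s \<omega>) 0 (J 0)" using J[of 0] T_pos by auto
    from ito_integral_0[OF this] S[of 0] show "AE \<omega> in M. S 0 \<omega> = x0"
      using T_pos by (auto simp: drift_def)
  qed
qed

text \<open>Starting point of the bootstrap: the stochastic integral up to T exists, so its
  integrand \<open>\<sigma> * S\<close> has finite norm, and \<open>\<sigma>\<^sup>2\<close> can be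
  cancelled because it is positive.\<close>

lemma (in linear_sde) variation_0_finite: "variation 0 T (\<lambda>_. 0) < \<infinity>"
proof -
  obtain J where J: "\<And>t. t \<in> {0..T} \<Longrightarrow> has_ito_integral M F T W (\<lambda>s \<omega>. \<sigma> * S s \<omega>) t (J t)"
    by (rule ito_parts) blast
  have X: "(\<lambda>(\<omega>, u). indicator {0..T} u * (\<sigma> * S u \<omega>)) \<in> borel_measurable (M \<Otimes>\<^sub>M lborel)"
    using borel_measurable_times[OF borel_measurable_const[of \<sigma>] S_joint_measurable]
    by (simp add: split_beta' mult.left_commute)
  have "norm2_sq (\<lambda>\<omega> u. indicator {0<..T} u * (\<sigma> * S u \<omega>)) < \<infinity>"
    using T_pos by (intro ito_integrand_norm2_finite[OF _ _ _ X J J]) auto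
  also have "norm2_sq (\<lambda>\<omega> u. indicator {0<..T} u * (\<sigma> * S u \<omega>))
      = norm2_sq (\<lambda>\<omega> u. \<sigma> * (indicator {0<..T} u * (S u \<omega> - 0)))"
    by (simp add: mult.left_commute)
  also have "\<dots> = ennreal (\<sigma>\<^sup>2) * variation 0 T (\<lambda>_. 0)"
    unfolding variation_def by (intro norm2_sq_cmult variation_measurable) auto
  finally show ?thesis using \<sigma>_pos by (auto simp: ennreal_mult_less_top ennreal_eq_0_iff)
qed

text \<open>With s = 0 and Y = 0, S_t is x0 plus the two errors, and both are controlled by the
  finite number \<open>variation 0 T (\<lambda>_. 0)\<close>, uniformly in t.\<close>

lemma (in linear_sde) S_square_bounded:
  obtains c where "0 \<le> c" "\<And>t. t \<in> {0..T} \<Longrightarrow> (\<integral>\<^sup>+\<omega>. ennreal ((S t \<omega>)\<^sup>2) \<partial>M) \<le> ennreal c"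
proof -
  obtain \<mu> \<nu> :: "real \<Rightarrow> real \<Rightarrow> ('a \<Rightarrow> real) \<Rightarrow> 'a \<Rightarrow> real"
  where m: "\<And>s t Y. 0 \<le> s \<Longrightarrow> s \<le> t \<Longrightarrow> t \<le> T \<Longrightarrow> Y \<in> borel_measurable M \<Longrightarrow>
      \<mu> s t Y \<in> borel_measurable M \<and> \<nu> s t Y \<in> borel_measurable M"
    and S: "\<And>s t Y. 0 \<le> s \<Longrightarrow> s \<le> t \<Longrightarrow> t \<le> T \<Longrightarrow>
      AE \<omega> in M. S t \<omega> = S s \<omega> + (\<alpha> * (t - s) + \<sigma> * (W t \<omega> - W s \<omega>)) * Y \<omega> + \<mu> s t Y \<omega> + \<nu> s t Y \<omega>"
    and \<mu>: "\<And>s t Y. 0 \<le> s \<Longrightarrow> s \<le> t \<Longrightarrow> t \<le> T \<Longrightarrow> Y \<in> borel_measurable M \<Longrightarrow>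
      (\<integral>\<^sup>+\<omega>. ennreal ((\<mu> s t Y \<omega>)\<^sup>2) \<partial>M) \<le> ennreal (\<alpha>\<^sup>2 * (t - s)) * variation s t Y"
    and \<nu>: "\<And>s t Y. 0 \<le> s \<Longrightarrow> s \<le> t \<Longrightarrow> t \<le> T \<Longrightarrow> Y \<in> borel_measurable (F s) \<Longrightarrow>
      integrable M (\<lambda>\<omega>. (Y \<omega>)\<^sup>2) \<Longrightarrow>
      (\<integral>\<^sup>+\<omega>. ennreal ((\<nu> s t Y \<omega>)\<^sup>2) \<partial>M) \<le> ennreal (4 * \<sigma>\<^sup>2) * variation s t Y"
    and S0: "AE \<omega> in M. S 0 \<omega> = x0"
    by (rule S_increment_decomposition) blast
  have V: "variation 0 T (\<lambda>_. 0) < \<infinity>"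
    by (rule variation_0_finite)
  define V where "V = enn2real (variation 0 T (\<lambda>_. 0))"
  have V_nonneg: "0 \<le> V" by (simp add: V_def)
  have V_eq: "variation 0 T (\<lambda>_. 0) = ennreal V" using V by (simp add: V_def less_top)
  \<comment> \<open>Two applications of (a + b)^2 \<le> 2 a^2 + 2 b^2 to x0, the drift error and the
    stochastic error, with t replaced by T in the drift bound.\<close>
  define c where "c = 2 * x0\<^sup>2 + 2 * (2 * (\<alpha>\<^sup>2 * T * V) + 2 * (4 * \<sigma>\<^sup>2 * V))"
  show thesis
  proof (rule that)
    show "0 \<le> c" using T_pos V_nonneg by (simp add: c_def)
    fix t assume t: "t \<in> {0..T}"
    then have [measurable]: "\<mu> 0 t (\<lambda>_. 0) \<in> borel_measurable M" "\<nu> 0 t (\<lambda>_. 0) \<in> borel_measurable M"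
      using m[of 0 t "\<lambda>_. 0"] by auto
    have Vt: "variation 0 t (\<lambda>_. 0) \<le> ennreal V"
      unfolding V_eq[symmetric] variation_def using t by (intro norm2_sq_mono) (auto simp: indicator_def)
    have "(\<integral>\<^sup>+\<omega>. ennreal ((\<mu> 0 t (\<lambda>_. 0) \<omega>)\<^sup>2) \<partial>M) \<le> ennreal (\<alpha>\<^sup>2 * (t - 0)) * variation 0 t (\<lambda>_. 0)"
      using t by (intro \<mu>) auto
    also have "\<dots> \<le> ennreal (\<alpha>\<^sup>2 * T) * ennreal V"
      using t Vt by (intro mult_mono ennreal_leI mult_left_mono) auto
    finally have 1: "(\<integral>\<^sup>+\<omega>. ennreal ((\<mu> 0 t (\<lambda>_. 0) \<omega>)\<^sup>2) \<partial>M) \<le> ennreal (\<alpha>\<^sup>2 * T * V)"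
      using T_pos V_nonneg by (simp add: ennreal_mult)
    have "(\<integral>\<^sup>+\<omega>. ennreal ((\<nu> 0 t (\<lambda>_. 0) \<omega>)\<^sup>2) \<partial>M) \<le> ennreal (4 * \<sigma>\<^sup>2) * variation 0 t (\<lambda>_. 0)"
      using t by (intro \<nu>) auto
    also have "\<dots> \<le> ennreal (4 * \<sigma>\<^sup>2) * ennreal V"
      using Vt by (intro mult_mono) auto
    finally have 2: "(\<integral>\<^sup>+\<omega>. ennreal ((\<nu> 0 t (\<lambda>_. 0) \<omega>)\<^sup>2) \<partial>M) \<le> ennreal (4 * \<sigma>\<^sup>2 * V)"
      using V_nonneg by (simp add: ennreal_mult)
    have "(\<integral>\<^sup>+\<omega>. ennreal ((S t \<omega>)\<^sup>2) \<partial>M) = (\<integral>\<^sup>+\<omega>. ennreal ((x0 + (\<mu> 0 t (\<lambda>_. 0) \<omega> + \<nu> 0 t (\<lambda>_. 0) \<omega>))\<^sup>2) \<partial>M)"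
      using S[of 0 t "\<lambda>_. 0"] S0 t by (intro nn_integral_cong_AE) (auto simp: add.assoc)
    also have "\<dots> \<le> 2 * (\<integral>\<^sup>+\<omega>. ennreal (x0\<^sup>2) \<partial>M) + 2 * (\<integral>\<^sup>+\<omega>. ennreal ((\<mu> 0 t (\<lambda>_. 0) \<omega> + \<nu> 0 t (\<lambda>_. 0) \<omega>)\<^sup>2) \<partial>M)"
      by (intro nn_integral_square_add_le) measurable
    also have "(\<integral>\<^sup>+\<omega>. ennreal ((\<mu> 0 t (\<lambda>_. 0) \<omega> + \<nu> 0 t (\<lambda>_. 0) \<omega>)\<^sup>2) \<partial>M)
        \<le> 2 * (\<integral>\<^sup>+\<omega>. ennreal ((\<mu> 0 t (\<lambda>_. 0) \<omega>)\<^sup>2) \<partial>M) + 2 * (\<integral>\<^sup>+\<omega>. ennreal ((\<nu> 0 t (\<lambda>_. 0) \<omega>)\<^sup>2) \<partial>M)"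
      by (intro nn_integral_square_add_le) measurable
    also note 1
    also note 2
    also have "2 * (\<integral>\<^sup>+\<omega>. ennreal (x0\<^sup>2) \<partial>M) + 2 * (2 * ennreal (\<alpha>\<^sup>2 * T * V) + 2 * ennreal (4 * \<sigma>\<^sup>2 * V))
        = 2 * ennreal (x0\<^sup>2) + 2 * ennreal (2 * (\<alpha>\<^sup>2 * T * V) + 2 * (4 * \<sigma>\<^sup>2 * V))"
      using T_pos V_nonneg by (subst ennreal_double_add) (auto simp: emeasure_space_1)
    also have "\<dots> = ennreal c"
      unfolding c_def using T_pos V_nonneg by (intro ennreal_double_add) auto
    finally show "(\<integral>\<^sup>+\<omega>. ennreal ((S t \<omega>)\<^sup>2) \<partial>M) \<le> ennreal c"
      by (simp add: add_mono mult_left_mono)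
  qed
qed


text \<open>Only now may the coefficients be frozen at S_s. The orders come from a
  \<open>variation\<close> of order (t - s)^2: the drift error gains one more factor t - s, the
  stochastic error none.\<close>

lemma (in linear_sde) S_increment:
  obtains C where "0 \<le> C"
    and "\<And>t. t \<in> {0..T} \<Longrightarrow> integrable M (\<lambda>\<omega>. (S t \<omega>)\<^sup>2)"
    and "\<And>s t. 0 \<le> s \<Longrightarrow> s < t \<Longrightarrow> t \<le> T \<Longrightarrow> \<exists>\<mu> \<nu>. \<mu> \<in> borel_measurable M \<and> \<nu> \<in> borel_measurable M \<and>
      (AE \<omega> in M. S t \<omega> = S s \<omega> * (1 + \<alpha> * (t - s) + \<sigma> * (W t \<omega> - W s \<omega>)) + \<mu> \<omega> + \<nu> \<omega>) \<and>
      integrable M (\<lambda>\<omega>. (\<mu> \<omega>)\<^sup>2) \<and> (\<integral>\<omega>. (\<mu> \<omega>)\<^sup>2 \<partial>M) \<le> C * (t - s)^3 \<and>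
      integrable M (\<lambda>\<omega>. (\<nu> \<omega>)\<^sup>2) \<and> (\<integral>\<omega>. (\<nu> \<omega>)\<^sup>2 \<partial>M) \<le> C * (t - s)\<^sup>2 \<and>
      (\<forall>X \<in> borel_measurable (F s). integrable M (\<lambda>\<omega>. (X \<omega>)\<^sup>2) \<longrightarrow> has_bochner_integral M (\<lambda>\<omega>. X \<omega> * \<nu> \<omega>) 0)"
proof -
  obtain \<mu> \<nu> :: "real \<Rightarrow> real \<Rightarrow> ('a \<Rightarrow> real) \<Rightarrow> 'a \<Rightarrow> real"
  where m: "\<And>s t Y. 0 \<le> s \<Longrightarrow> s \<le> t \<Longrightarrow> t \<le> T \<Longrightarrow> Y \<in> borel_measurable M \<Longrightarrow>
      \<mu> s t Y \<in> borel_measurable M \<and> \<nu> s t Y \<in> borel_measurable M"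
    and S: "\<And>s t Y. 0 \<le> s \<Longrightarrow> s \<le> t \<Longrightarrow> t \<le> T \<Longrightarrow>
      AE \<omega> in M. S t \<omega> = S s \<omega> + (\<alpha> * (t - s) + \<sigma> * (W t \<omega> - W s \<omega>)) * Y \<omega> + \<mu> s t Y \<omega> + \<nu> s t Y \<omega>"
    and \<mu>: "\<And>s t Y. 0 \<le> s \<Longrightarrow> s \<le> t \<Longrightarrow> t \<le> T \<Longrightarrow> Y \<in> borel_measurable M \<Longrightarrow>
      (\<integral>\<^sup>+\<omega>. ennreal ((\<mu> s t Y \<omega>)\<^sup>2) \<partial>M) \<le> ennreal (\<alpha>\<^sup>2 * (t - s)) * variation s t Y"
    and \<nu>: "\<And>s t Y. 0 \<le> s \<Longrightarrow> s \<le> t \<Longrightarrow> t \<le> T \<Longrightarrow> Y \<in> borel_measurable (F s) \<Longrightarrow>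
      integrable M (\<lambda>\<omega>. (Y \<omega>)\<^sup>2) \<Longrightarrow>
      (\<integral>\<^sup>+\<omega>. ennreal ((\<nu> s t Y \<omega>)\<^sup>2) \<partial>M) \<le> ennreal (4 * \<sigma>\<^sup>2) * variation s t Y"
    and orth: "\<And>s t Y X. 0 \<le> s \<Longrightarrow> s \<le> t \<Longrightarrow> t \<le> T \<Longrightarrow> Y \<in> borel_measurable (F s) \<Longrightarrow>
      integrable M (\<lambda>\<omega>. (Y \<omega>)\<^sup>2) \<Longrightarrow> X \<in> borel_measurable (F s) \<Longrightarrow>
      integrable M (\<lambda>\<omega>. (X \<omega>)\<^sup>2) \<Longrightarrow> integrable M (\<lambda>\<omega>. (\<nu> s t (\<lambda>_. 0) \<omega>)\<^sup>2) \<Longrightarrow>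
      has_bochner_integral M (\<lambda>\<omega>. X \<omega> * \<nu> s t Y \<omega>) 0"
    by (rule S_increment_decomposition) blast
  obtain c where c: "0 \<le> c" "\<And>t. t \<in> {0..T} \<Longrightarrow> (\<integral>\<^sup>+\<omega>. ennreal ((S t \<omega>)\<^sup>2) \<partial>M) \<le> ennreal c"
    by (rule S_square_bounded) blast
  have S2: "integrable M (\<lambda>\<omega>. (S t \<omega>)\<^sup>2)" if "t \<in> {0..T}" for t
    using nn_integral_square_leD(1)[OF S_measurable[OF that] c(2)[OF that] c(1)] .
  have V0: "variation s t (\<lambda>_. 0) \<le> ennreal (c * (t - s))" if "0 \<le> s" "s \<le> t" "t \<le> T" for s t
    using that c by (intro variation_le_integral) auto
  have \<nu>0: "(\<integral>\<^sup>+\<omega>. ennreal ((\<nu> s t (\<lambda>_. 0) \<omega>)\<^sup>2) \<partial>M) \<le> ennreal (4 * \<sigma>\<^sup>2 * (c * (t - s)))"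
    if st: "0 \<le> s" "s \<le> t" "t \<le> T" for s t
  proof -
    have "(\<integral>\<^sup>+\<omega>. ennreal ((\<nu> s t (\<lambda>_. 0) \<omega>)\<^sup>2) \<partial>M) \<le> ennreal (4 * \<sigma>\<^sup>2) * variation s t (\<lambda>_. 0)"
      using st by (intro \<nu>) auto
    also have "\<dots> \<le> ennreal (4 * \<sigma>\<^sup>2) * ennreal (c * (t - s))"
      using V0[OF st] by (intro mult_left_mono) auto
    finally show ?thesis by (simp add: ennreal_mult')
  qed
  define c1 where "c1 = 2 * (\<alpha>\<^sup>2 * T * c) + 2 * (4 * \<sigma>\<^sup>2 * c)"
  have c1: "0 \<le> c1" using c(1) T_pos by (simp add: c1_def)
  \<comment> \<open>Again Y = 0, but the variation is now at most c (t - s), no longer merely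
    finite.\<close>
  have diff: "(\<integral>\<^sup>+\<omega>. ennreal ((S t \<omega> - S s \<omega>)\<^sup>2) \<partial>M) \<le> ennreal (c1 * (t - s))"
    if st: "0 \<le> s" "s \<le> t" "t \<le> T" for s t
  proof -
    have [measurable]: "\<mu> s t (\<lambda>_. 0) \<in> borel_measurable M" "\<nu> s t (\<lambda>_. 0) \<in> borel_measurable M"
      using m[OF st, of "\<lambda>_. 0"] by auto
    have "(\<integral>\<^sup>+\<omega>. ennreal ((\<mu> s t (\<lambda>_. 0) \<omega>)\<^sup>2) \<partial>M) \<le> ennreal (\<alpha>\<^sup>2 * (t - s)) * variation s t (\<lambda>_. 0)"
      using st by (intro \<mu>) auto
    also have "\<dots> \<le> ennreal (\<alpha>\<^sup>2 * T) * ennreal (c * (t - s))"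
      using st V0[OF st] by (intro mult_mono ennreal_leI mult_left_mono) auto
    also have "\<dots> = ennreal (\<alpha>\<^sup>2 * T * (c * (t - s)))"
      using T_pos by (subst ennreal_mult') auto
    finally have 1: "(\<integral>\<^sup>+\<omega>. ennreal ((\<mu> s t (\<lambda>_. 0) \<omega>)\<^sup>2) \<partial>M) \<le> ennreal (\<alpha>\<^sup>2 * T * (c * (t - s)))" .
    have "(\<integral>\<^sup>+\<omega>. ennreal ((S t \<omega> - S s \<omega>)\<^sup>2) \<partial>M) = (\<integral>\<^sup>+\<omega>. ennreal ((\<mu> s t (\<lambda>_. 0) \<omega> + \<nu> s t (\<lambda>_. 0) \<omega>)\<^sup>2) \<partial>M)"
      using S[OF st, of "\<lambda>_. 0"] by (intro nn_integral_cong_AE) auto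
    also have "\<dots> \<le> 2 * (\<integral>\<^sup>+\<omega>. ennreal ((\<mu> s t (\<lambda>_. 0) \<omega>)\<^sup>2) \<partial>M) + 2 * (\<integral>\<^sup>+\<omega>. ennreal ((\<nu> s t (\<lambda>_. 0) \<omega>)\<^sup>2) \<partial>M)"
      by (intro nn_integral_square_add_le) measurable
    also note 1
    also note \<nu>0[OF st]
    also have "2 * ennreal (\<alpha>\<^sup>2 * T * (c * (t - s))) + 2 * ennreal (4 * \<sigma>\<^sup>2 * (c * (t - s)))
      = ennreal (2 * (\<alpha>\<^sup>2 * T * (c * (t - s))) + 2 * (4 * \<sigma>\<^sup>2 * (c * (t - s))))"
      using T_pos c(1) st by (intro ennreal_double_add) auto
    also have "2 * (\<alpha>\<^sup>2 * T * (c * (t - s))) + 2 * (4 * \<sigma>\<^sup>2 * (c * (t - s))) = c1 * (t - s)"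
      by (simp add: c1_def algebra_simps)
    finally show ?thesis by (simp add: add_mono mult_left_mono)
  qed
  \<comment> \<open>Integrating the increment bound over (s, t] produces the second factor t -
    s.\<close>
  have V: "variation s t (S s) \<le> ennreal (c1 * (t - s)\<^sup>2)" if st: "0 \<le> s" "s \<le> t" "t \<le> T" for s t
  proof -
    have "variation s t (S s) \<le> ennreal (c1 * (t - s) * (t - s))"
    proof (rule variation_le_integral[OF st])
      show "S s \<in> borel_measurable M" using st by (intro S_measurable) auto
      show "0 \<le> c1 * (t - s)" using st c1 by simp
      fix u assume u: "u \<in> {s<..t}"
      then have "(\<integral>\<^sup>+\<omega>. ennreal ((S u \<omega> - S s \<omega>)\<^sup>2) \<partial>M) \<le> ennreal (c1 * (u - s))"
        using st by (intro diff) auto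
      also have "\<dots> \<le> ennreal (c1 * (t - s))"
        using u c1 by (intro ennreal_leI mult_left_mono) auto
      finally show "(\<integral>\<^sup>+\<omega>. ennreal ((S u \<omega> - S s \<omega>)\<^sup>2) \<partial>M) \<le> ennreal (c1 * (t - s))" .
    qed
    then show ?thesis by (simp add: power2_eq_square mult.assoc)
  qed
  define C where "C = \<alpha>\<^sup>2 * c1 + 4 * \<sigma>\<^sup>2 * c1"
  show thesis
  proof (rule that[of C])
    show C: "0 \<le> C" using c1 by (simp add: C_def)
    show "integrable M (\<lambda>\<omega>. (S t \<omega>)\<^sup>2)" if "t \<in> {0..T}" for t using S2[OF that] .
    fix s t :: real assume st': "0 \<le> s" "s < t" "t \<le> T"
    then have st: "0 \<le> s" "s \<le> t" "t \<le> T" by auto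
    have sT: "s \<in> {0..T}" using st by auto
    note mm = m[OF st S_measurable[OF sT]]
    have "(\<integral>\<^sup>+\<omega>. ennreal ((\<mu> s t (S s) \<omega>)\<^sup>2) \<partial>M) \<le> ennreal (\<alpha>\<^sup>2 * (t - s)) * variation s t (S s)"
      using S_measurable[OF sT] by (intro \<mu> st)
    also have "\<dots> \<le> ennreal (\<alpha>\<^sup>2 * (t - s)) * ennreal (c1 * (t - s)\<^sup>2)"
      using V[OF st] by (intro mult_left_mono) auto
    also have "\<dots> = ennreal (\<alpha>\<^sup>2 * (t - s) * (c1 * (t - s)\<^sup>2))"
      using st by (subst ennreal_mult') auto
    also have "\<alpha>\<^sup>2 * (t - s) * (c1 * (t - s)\<^sup>2) = (\<alpha>\<^sup>2 * c1) * (t - s)^3"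
      by (simp add: power2_eq_square power3_eq_cube)
    also have "ennreal \<dots> \<le> ennreal (C * (t - s)^3)"
      unfolding C_def using st c1 by (intro ennreal_leI mult_right_mono) auto
    finally have 1: "(\<integral>\<^sup>+\<omega>. ennreal ((\<mu> s t (S s) \<omega>)\<^sup>2) \<partial>M) \<le> ennreal (C * (t - s)^3)" .
    have "(\<integral>\<^sup>+\<omega>. ennreal ((\<nu> s t (S s) \<omega>)\<^sup>2) \<partial>M) \<le> ennreal (4 * \<sigma>\<^sup>2) * variation s t (S s)"
      by (intro \<nu> st S_adapted S2 sT)
    also have "\<dots> \<le> ennreal (4 * \<sigma>\<^sup>2) * ennreal (c1 * (t - s)\<^sup>2)"
      using V[OF st] by (intro mult_left_mono) auto
    also have "\<dots> = ennreal ((4 * \<sigma>\<^sup>2 * c1) * (t - s)\<^sup>2)"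
      by (simp add: ennreal_mult'[symmetric] mult.assoc)
    also have "\<dots> \<le> ennreal (C * (t - s)\<^sup>2)"
      unfolding C_def using st c1 by (intro ennreal_leI mult_right_mono) auto
    finally have 2: "(\<integral>\<^sup>+\<omega>. ennreal ((\<nu> s t (S s) \<omega>)\<^sup>2) \<partial>M) \<le> ennreal (C * (t - s)\<^sup>2)" .
    have "integrable M (\<lambda>\<omega>. (\<nu> s t (\<lambda>_. 0) \<omega>)\<^sup>2)"
      using m[OF st, of "\<lambda>_. 0"] c(1) st by (intro nn_integral_square_leD(1)[OF _ \<nu>0[OF st]]) auto
    then have 3: "\<forall>X \<in> borel_measurable (F s). integrable M (\<lambda>\<omega>. (X \<omega>)\<^sup>2) \<longrightarrow>
        has_bochner_integral M (\<lambda>\<omega>. X \<omega> * \<nu> s t (S s) \<omega>) 0"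
      using orth[OF st S_adapted[OF sT] S2[OF sT]] by blast
    have 4: "AE \<omega> in M. S t \<omega> = S s \<omega> * (1 + \<alpha> * (t - s) + \<sigma> * (W t \<omega> - W s \<omega>)) + \<mu> s t (S s) \<omega> + \<nu> s t (S s) \<omega>"
      using S[OF st, of "S s"] by eventually_elim (simp add: algebra_simps)
    have p: "0 \<le> C * (t - s)^3" "0 \<le> C * (t - s)\<^sup>2" using C st by auto
    show "\<exists>\<mu> \<nu>. \<mu> \<in> borel_measurable M \<and> \<nu> \<in> borel_measurable M \<and>
      (AE \<omega> in M. S t \<omega> = S s \<omega> * (1 + \<alpha> * (t - s) + \<sigma> * (W t \<omega> - W s \<omega>)) + \<mu> \<omega> + \<nu> \<omega>) \<and>
      integrable M (\<lambda>\<omega>. (\<mu> \<omega>)\<^sup>2) \<and> (\<integral>\<omega>. (\<mu> \<omega>)\<^sup>2 \<partial>M) \<le> C * (t - s)^3 \<and>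
      integrable M (\<lambda>\<omega>. (\<nu> \<omega>)\<^sup>2) \<and> (\<integral>\<omega>. (\<nu> \<omega>)\<^sup>2 \<partial>M) \<le> C * (t - s)\<^sup>2 \<and>
      (\<forall>X \<in> borel_measurable (F s). integrable M (\<lambda>\<omega>. (X \<omega>)\<^sup>2) \<longrightarrow> has_bochner_integral M (\<lambda>\<omega>. X \<omega> * \<nu> \<omega>) 0)"
      by (intro exI[of _ "\<mu> s t (S s)"] exI[of _ "\<nu> s t (S s)"] conjI conjunct1[OF mm] conjunct2[OF mm] 3 4
        nn_integral_square_leD[OF conjunct1[OF mm] 1 p(1)] nn_integral_square_leD[OF conjunct2[OF mm] 2 p(2)])
  qed
qed

section \<open>Geometric Brownian motion\<close>

text \<open>The cross term of \<open>e\<close> and \<open>b\<close> vanishes. The cross term with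
  \<open>d\<close> is split by 2 x y \<le> h x^2 + y^2 / h: the factor 1 + h stays bounded when
  iterated T/h times, at the price of 1 + 1/h in front of \<open>d\<close>.\<close>

lemma expectation_square_sum_le:
  fixes e b d :: "'a \<Rightarrow> real"
  assumes [measurable]: "e \<in> borel_measurable M" "b \<in> borel_measurable M" "d \<in> borel_measurable M"
    and e: "integrable M (\<lambda>x. (e x)\<^sup>2)" and b: "integrable M (\<lambda>x. (b x)\<^sup>2)" and d: "integrable M (\<lambda>x. (d x)\<^sup>2)"
    and orth: "has_bochner_integral M (\<lambda>x. e x * b x) 0" and h: "0 < h"
  shows "(\<integral>x. (k * e x + b x + d x)\<^sup>2 \<partial>M)
    \<le> (1 + h) * (k\<^sup>2 * (\<integral>x. (e x)\<^sup>2 \<partial>M) + (\<integral>x. (b x)\<^sup>2 \<partial>M)) + (1 + 1 / h) * (\<integral>x. (d x)\<^sup>2 \<partial>M)"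
proof -
  have pw: "(x + y)\<^sup>2 \<le> (1 + h) * x\<^sup>2 + (1 + 1 / h) * y\<^sup>2" for x y :: real
  proof -
    have "0 \<le> (h * x - y)\<^sup>2 / h" using h by simp
    also have "\<dots> = h * x\<^sup>2 - 2 * x * y + y\<^sup>2 / h"
      using h by (simp add: power2_eq_square field_simps)
    finally show ?thesis by (simp add: power2_sum algebra_simps)
  qed
  have I: "integrable M (\<lambda>x. (k * e x + b x)\<^sup>2)" "integrable M (\<lambda>x. (k * e x + b x + d x)\<^sup>2)"
    using e b d by (auto intro!: integrable_square_add integrable_square_cmult)
  have O: "integrable M (\<lambda>x. e x * b x)" "(\<integral>x. e x * b x \<partial>M) = 0"
    using orth by (auto simp: has_bochner_integral_iff)
  have "(\<integral>x. (k * e x + b x)\<^sup>2 \<partial>M) = (\<integral>x. k\<^sup>2 * (e x)\<^sup>2 + (b x)\<^sup>2 + (2 * k) * (e x * b x) \<partial>M)"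
    by (simp add: power2_sum power_mult_distrib mult.assoc)
  also have "\<dots> = k\<^sup>2 * (\<integral>x. (e x)\<^sup>2 \<partial>M) + (\<integral>x. (b x)\<^sup>2 \<partial>M)"
    using e b O by simp
  finally have eq: "(\<integral>x. (k * e x + b x)\<^sup>2 \<partial>M) = k\<^sup>2 * (\<integral>x. (e x)\<^sup>2 \<partial>M) + (\<integral>x. (b x)\<^sup>2 \<partial>M)" .
  have "(\<integral>x. (k * e x + b x + d x)\<^sup>2 \<partial>M) \<le> (\<integral>x. (1 + h) * (k * e x + b x)\<^sup>2 + (1 + 1 / h) * (d x)\<^sup>2 \<partial>M)"
    using I d by (intro integral_mono pw) auto
  also have "\<dots> = (1 + h) * (\<integral>x. (k * e x + b x)\<^sup>2 \<partial>M) + (1 + 1 / h) * (\<integral>x. (d x)\<^sup>2 \<partial>M)"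
    using I d by simp
  finally show ?thesis unfolding eq .
qed

lemma expectation_square_sum3_le:
  fixes e b d :: "'a \<Rightarrow> real"
  assumes [measurable]: "e \<in> borel_measurable M" "b \<in> borel_measurable M" "d \<in> borel_measurable M"
    and e: "integrable M (\<lambda>x. (e x)\<^sup>2)" and b: "integrable M (\<lambda>x. (b x)\<^sup>2)" and d: "integrable M (\<lambda>x. (d x)\<^sup>2)"
  shows "(\<integral>x. (e x + b x + d x)\<^sup>2 \<partial>M)
    \<le> 3 * (\<integral>x. (e x)\<^sup>2 \<partial>M) + 3 * (\<integral>x. (b x)\<^sup>2 \<partial>M) + 3 * (\<integral>x. (d x)\<^sup>2 \<partial>M)"
proof -
  have pw: "(x + y + z)\<^sup>2 \<le> 3 * x\<^sup>2 + 3 * y\<^sup>2 + 3 * z\<^sup>2" for x y z :: real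
  proof -
    have "0 \<le> (x - y)\<^sup>2 + (x - z)\<^sup>2 + (y - z)\<^sup>2" by simp
    then show ?thesis by (simp add: power2_eq_square algebra_simps)
  qed
  have I: "integrable M (\<lambda>x. (e x + b x + d x)\<^sup>2)"
    using e b d by (auto intro!: integrable_square_add)
  have "(\<integral>x. (e x + b x + d x)\<^sup>2 \<partial>M) \<le> (\<integral>x. 3 * (e x)\<^sup>2 + 3 * (b x)\<^sup>2 + 3 * (d x)\<^sup>2 \<partial>M)"
    using I e b d by (intro integral_mono pw) auto
  then show ?thesis using e b d by simp
qed

text \<open>Induction with the cruder bound k \<delta> (1 + K)^k in place of the geometric sum
  avoids a division by K. The exponential enters through 1 + K \<le> exp K.\<close>

lemma discrete_gronwall:
  fixes a :: "nat \<Rightarrow> real"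
  assumes "a 0 = 0" "0 \<le> K" "0 \<le> \<delta>" and step: "\<And>k. k < n \<Longrightarrow> a (Suc k) \<le> (1 + K) * a k + \<delta>"
  shows "a n \<le> real n * \<delta> * exp (K * real n)"
proof -
  have "a k \<le> real k * \<delta> * (1 + K)^k" if "k \<le> n" for k
    using that
  proof (induction k)
    case (Suc k)
    have "a (Suc k) \<le> (1 + K) * a k + \<delta>" using step Suc by simp
    also have "\<dots> \<le> (1 + K) * (real k * \<delta> * (1 + K)^k) + \<delta> * (1 + K)^Suc k"
    proof (rule add_mono)
      show "(1 + K) * a k \<le> (1 + K) * (real k * \<delta> * (1 + K)^k)"
        using Suc assms(2) by (intro mult_left_mono) auto
      have "1 \<le> (1 + K)^Suc k" using assms(2) by (intro one_le_power) simp
      then show "\<delta> \<le> \<delta> * (1 + K)^Suc k" using mult_left_mono[of 1 "(1 + K)^Suc k" \<delta>] assms(3) by simp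
    qed
    finally show ?case by (simp add: algebra_simps)
  qed (use assms(1) in simp)
  then have "a n \<le> real n * \<delta> * (1 + K)^n" by simp
  also have "\<dots> \<le> real n * \<delta> * exp K^n"
    using assms(2,3) by (intro mult_left_mono power_mono exp_ge_add_one_self) auto
  finally show ?thesis by (simp add: exp_of_nat2_mult)
qed

section \<open>Gaussian moments for geometric Brownian motion\<close>

context scalar_wiener
begin

text \<open>The growth factor of G over one step, minus its mean \<open>exp (\<alpha> * h)\<close>
  and its linear noise term. Subtracting the mean makes the remainder orthogonal to the past; its
  second moment is computed exactly from the moments of the increment and of its
  exponential.\<close>

lemma gbm_increment_remainder:
  assumes "0 \<le> s" "s < t" "t \<le> T"
  defines "h \<equiv> t - s"
  shows "has_bochner_integral M (\<lambda>\<omega>. exp ((\<alpha> - \<sigma>\<^sup>2 / 2) * h + \<sigma> * (W t \<omega> - W s \<omega>)) - exp (\<alpha> * h) - \<sigma> * (W t \<omega> - W s \<omega>)) 0"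
    and "has_bochner_integral M (\<lambda>\<omega>. (exp ((\<alpha> - \<sigma>\<^sup>2 / 2) * h + \<sigma> * (W t \<omega> - W s \<omega>)) - exp (\<alpha> * h) - \<sigma> * (W t \<omega> - W s \<omega>))\<^sup>2)
      (exp ((2 * \<alpha> + \<sigma>\<^sup>2) * h) - exp (2 * \<alpha> * h) + \<sigma>\<^sup>2 * h - 2 * \<sigma>\<^sup>2 * h * exp (\<alpha> * h))"
proof -
  define c where "c = (\<alpha> - \<sigma>\<^sup>2 / 2) * h"
  have c1: "exp c * exp (\<sigma>\<^sup>2 * h / 2) = exp (\<alpha> * h)"
    unfolding exp_add[symmetric] by (simp add: c_def field_simps)
  have c2: "exp (2 * c) * exp ((2 * \<sigma>)\<^sup>2 * h / 2) = exp ((2 * \<alpha> + \<sigma>\<^sup>2) * h)"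
    unfolding exp_add[symmetric] by (simp add: c_def field_simps power2_eq_square)
  note e1 = increment_exp[OF assms(1-3), of \<sigma>, folded h_def]
  note e2 = increment_exp[OF assms(1-3), of "2 * \<sigma>", folded h_def]
  note x1 = increment_exp_1[OF assms(1-3), of \<sigma>, folded h_def]
  have x0: "has_bochner_integral M (\<lambda>\<omega>. W t \<omega> - W s \<omega>) 0"
    using increment_exp_1[OF assms(1-3), of 0] by simp
  note sq = increment_square[OF assms(1-3), folded h_def]
  have 1: "has_bochner_integral M (\<lambda>\<omega>. x) x" for x :: real
    by (simp add: has_bochner_integral_iff prob_space)
  have "has_bochner_integral M (\<lambda>\<omega>. exp c * exp (\<sigma> * (W t \<omega> - W s \<omega>)) - exp (\<alpha> * h) - \<sigma> * (W t \<omega> - W s \<omega>))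
      (exp c * exp (\<sigma>\<^sup>2 * h / 2) - exp (\<alpha> * h) - \<sigma> * 0)"
    by (intro has_bochner_integral_diff has_bochner_integral_mult_right e1 1 x0)
  then show "has_bochner_integral M (\<lambda>\<omega>. exp ((\<alpha> - \<sigma>\<^sup>2 / 2) * h + \<sigma> * (W t \<omega> - W s \<omega>)) - exp (\<alpha> * h) - \<sigma> * (W t \<omega> - W s \<omega>)) 0"
    unfolding c1 by (simp add: exp_add c_def)
  have "has_bochner_integral M (\<lambda>\<omega>. exp (2 * c) * exp (2 * \<sigma> * (W t \<omega> - W s \<omega>)) + exp (2 * \<alpha> * h) + \<sigma>\<^sup>2 * (W t \<omega> - W s \<omega>)\<^sup>2
      - (2 * exp (\<alpha> * h) * exp c) * exp (\<sigma> * (W t \<omega> - W s \<omega>))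
      - (2 * \<sigma> * exp c) * ((W t \<omega> - W s \<omega>) * exp (\<sigma> * (W t \<omega> - W s \<omega>)))
      + (2 * exp (\<alpha> * h) * \<sigma>) * (W t \<omega> - W s \<omega>))
    (exp (2 * c) * exp ((2 * \<sigma>)\<^sup>2 * h / 2) + exp (2 * \<alpha> * h) + \<sigma>\<^sup>2 * h
      - (2 * exp (\<alpha> * h) * exp c) * exp (\<sigma>\<^sup>2 * h / 2)
      - (2 * \<sigma> * exp c) * (\<sigma> * h * exp (\<sigma>\<^sup>2 * h / 2)) + (2 * exp (\<alpha> * h) * \<sigma>) * 0)"
    by (intro has_bochner_integral_diff has_bochner_integral_add has_bochner_integral_mult_right e1 e2 x1 x0 sq 1)
  also have "(exp (2 * c) * exp ((2 * \<sigma>)\<^sup>2 * h / 2) + exp (2 * \<alpha> * h) + \<sigma>\<^sup>2 * h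
      - (2 * exp (\<alpha> * h) * exp c) * exp (\<sigma>\<^sup>2 * h / 2)
      - (2 * \<sigma> * exp c) * (\<sigma> * h * exp (\<sigma>\<^sup>2 * h / 2)) + (2 * exp (\<alpha> * h) * \<sigma>) * 0)
    = exp ((2 * \<alpha> + \<sigma>\<^sup>2) * h) + exp (2 * \<alpha> * h) + \<sigma>\<^sup>2 * h
      - 2 * exp (\<alpha> * h) * (exp c * exp (\<sigma>\<^sup>2 * h / 2)) - 2 * \<sigma>\<^sup>2 * h * (exp c * exp (\<sigma>\<^sup>2 * h / 2))"
    unfolding c2 by (simp add: power2_eq_square)
  also have "\<dots> = exp ((2 * \<alpha> + \<sigma>\<^sup>2) * h) - exp (2 * \<alpha> * h) + \<sigma>\<^sup>2 * h - 2 * \<sigma>\<^sup>2 * h * exp (\<alpha> * h)"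
  proof -
    have "exp (\<alpha> * h) * exp (\<alpha> * h) = exp (2 * \<alpha> * h)" unfolding exp_add[symmetric] by simp
    then show ?thesis unfolding c1 by simp
  qed
  also have "(\<lambda>\<omega>. exp (2 * c) * exp (2 * \<sigma> * (W t \<omega> - W s \<omega>)) + exp (2 * \<alpha> * h) + \<sigma>\<^sup>2 * (W t \<omega> - W s \<omega>)\<^sup>2
      - (2 * exp (\<alpha> * h) * exp c) * exp (\<sigma> * (W t \<omega> - W s \<omega>))
      - (2 * \<sigma> * exp c) * ((W t \<omega> - W s \<omega>) * exp (\<sigma> * (W t \<omega> - W s \<omega>)))
      + (2 * exp (\<alpha> * h) * \<sigma>) * (W t \<omega> - W s \<omega>))
    = (\<lambda>\<omega>. (exp (c + \<sigma> * (W t \<omega> - W s \<omega>)) - exp (\<alpha> * h) - \<sigma> * (W t \<omega> - W s \<omega>))\<^sup>2)"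
  proof
    fix \<omega>
    have poly: "a\<^sup>2 * b\<^sup>2 + d\<^sup>2 + s\<^sup>2 * x\<^sup>2 - (2 * d * a) * b - (2 * s * a) * (x * b) + (2 * d * s) * x
        = (a * b - d - s * x)\<^sup>2" for a b d s x :: real
      by (simp add: power2_eq_square algebra_simps)
    have "exp (2 * c) = (exp c)\<^sup>2" "exp (2 * \<alpha> * h) = (exp (\<alpha> * h))\<^sup>2"
      "exp (2 * \<sigma> * (W t \<omega> - W s \<omega>)) = (exp (\<sigma> * (W t \<omega> - W s \<omega>)))\<^sup>2"
      by (simp_all add: exp_double[symmetric] mult.assoc)
    then show "exp (2 * c) * exp (2 * \<sigma> * (W t \<omega> - W s \<omega>)) + exp (2 * \<alpha> * h) + \<sigma>\<^sup>2 * (W t \<omega> - W s \<omega>)\<^sup>2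
      - (2 * exp (\<alpha> * h) * exp c) * exp (\<sigma> * (W t \<omega> - W s \<omega>))
      - (2 * \<sigma> * exp c) * ((W t \<omega> - W s \<omega>) * exp (\<sigma> * (W t \<omega> - W s \<omega>)))
      + (2 * exp (\<alpha> * h) * \<sigma>) * (W t \<omega> - W s \<omega>)
      = (exp (c + \<sigma> * (W t \<omega> - W s \<omega>)) - exp (\<alpha> * h) - \<sigma> * (W t \<omega> - W s \<omega>))\<^sup>2"
      unfolding exp_add by (simp only: poly)
  qed
  finally show "has_bochner_integral M (\<lambda>\<omega>. (exp ((\<alpha> - \<sigma>\<^sup>2 / 2) * h + \<sigma> * (W t \<omega> - W s \<omega>)) - exp (\<alpha> * h) - \<sigma> * (W t \<omega> - W s \<omega>))\<^sup>2)
      (exp ((2 * \<alpha> + \<sigma>\<^sup>2) * h) - exp (2 * \<alpha> * h) + \<sigma>\<^sup>2 * h - 2 * \<sigma>\<^sup>2 * h * exp (\<alpha> * h))"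
    by (simp only: c_def)
qed

text \<open>Time 0 is treated separately because the increment has no density there; the starting
  value is 0 only almost surely, hence the passage to almost everywhere equality.\<close>

lemma W_exp:
  assumes "0 \<le> t" "t \<le> T"
  shows "has_bochner_integral M (\<lambda>\<omega>. exp (a * W t \<omega>)) (exp (a\<^sup>2 * t / 2))"
proof (cases "t = 0")
  case True
  have "has_bochner_integral M (\<lambda>\<omega>. exp (a * W t \<omega>)) 1 \<longleftrightarrow> has_bochner_integral M (\<lambda>\<omega>. 1::real) 1"
    using starts_0 True W_measurable[OF assms] by (intro has_bochner_integral_cong_AE) auto
  then show ?thesis using True by (simp add: has_bochner_integral_iff prob_space)
next
  case False
  have "has_bochner_integral M (\<lambda>\<omega>. exp (a * (W t \<omega> - W 0 \<omega>))) (exp (a\<^sup>2 * (t - 0) / 2))"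
    using False assms by (intro increment_exp) auto
  also have "has_bochner_integral M (\<lambda>\<omega>. exp (a * (W t \<omega> - W 0 \<omega>))) (exp (a\<^sup>2 * (t - 0) / 2))
    \<longleftrightarrow> has_bochner_integral M (\<lambda>\<omega>. exp (a * W t \<omega>)) (exp (a\<^sup>2 * (t - 0) / 2))"
    using starts_0 W_measurable[OF assms] W_measurable[of 0] assms by (intro has_bochner_integral_cong_AE) auto
  finally show ?thesis by simp
qed

end

section \<open>Comparison of the solution with geometric Brownian motion\<close>

context linear_sde
begin

definition G :: "real \<Rightarrow> 'a \<Rightarrow> real" where
  "G t \<omega> = x0 * exp ((\<alpha> - \<sigma>\<^sup>2 / 2) * t + \<sigma> * W t \<omega>)"

lemma G_adapted: "t \<in> {0..T} \<Longrightarrow> G t \<in> borel_measurable (F t)"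
  using adapted[of t] unfolding G_def[abs_def] by auto

lemma G_measurable: "t \<in> {0..T} \<Longrightarrow> G t \<in> borel_measurable M"
  using F_measurable[of t "G t"] G_adapted by simp

lemma G_square:
  assumes "t \<in> {0..T}"
  shows "has_bochner_integral M (\<lambda>\<omega>. (G t \<omega>)\<^sup>2) (x0\<^sup>2 * exp ((2 * \<alpha> + \<sigma>\<^sup>2) * t))"
proof -
  have "has_bochner_integral M (\<lambda>\<omega>. (x0\<^sup>2 * exp (2 * ((\<alpha> - \<sigma>\<^sup>2 / 2) * t))) * exp (2 * \<sigma> * W t \<omega>))
      ((x0\<^sup>2 * exp (2 * ((\<alpha> - \<sigma>\<^sup>2 / 2) * t))) * exp ((2 * \<sigma>)\<^sup>2 * t / 2))"
    using assms by (intro has_bochner_integral_mult_right W_exp) auto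
  also have "(x0\<^sup>2 * exp (2 * ((\<alpha> - \<sigma>\<^sup>2 / 2) * t))) * exp ((2 * \<sigma>)\<^sup>2 * t / 2) = x0\<^sup>2 * exp ((2 * \<alpha> + \<sigma>\<^sup>2) * t)"
    unfolding mult.assoc exp_add[symmetric] by (simp add: field_simps power2_eq_square)
  also have "(\<lambda>\<omega>. (x0\<^sup>2 * exp (2 * ((\<alpha> - \<sigma>\<^sup>2 / 2) * t))) * exp (2 * \<sigma> * W t \<omega>)) = (\<lambda>\<omega>. (G t \<omega>)\<^sup>2)"
    unfolding G_def power_mult_distrib mult.assoc exp_add[symmetric] exp_double[symmetric]
    by (simp add: algebra_simps)
  finally show ?thesis .
qed

text \<open>The new error is (1 + \<alpha> h) times the old one, plus noise orthogonal to the old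
  error (three terms, hence the factors 3), plus drift terms for which no orthogonality is available
  (two terms, hence the factors 2 and the weight 1 + 1/h).\<close>

lemma error_step:
  assumes "0 \<le> s" "s < t" "t \<le> T" and "0 \<le> C"
    and \<mu>\<nu> [measurable]: "\<mu> \<in> borel_measurable M" "\<nu> \<in> borel_measurable M"
    and AE_S: "AE \<omega> in M. S t \<omega> = S s \<omega> * (1 + \<alpha> * (t - s) + \<sigma> * (W t \<omega> - W s \<omega>)) + \<mu> \<omega> + \<nu> \<omega>"
    and \<mu>: "integrable M (\<lambda>\<omega>. (\<mu> \<omega>)\<^sup>2)" "(\<integral>\<omega>. (\<mu> \<omega>)\<^sup>2 \<partial>M) \<le> C * (t - s)^3"
    and \<nu>: "integrable M (\<lambda>\<omega>. (\<nu> \<omega>)\<^sup>2)" "(\<integral>\<omega>. (\<nu> \<omega>)\<^sup>2 \<partial>M) \<le> C * (t - s)\<^sup>2"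
    and orth: "\<And>X. X \<in> borel_measurable (F s) \<Longrightarrow> integrable M (\<lambda>\<omega>. (X \<omega>)\<^sup>2) \<Longrightarrow> has_bochner_integral M (\<lambda>\<omega>. X \<omega> * \<nu> \<omega>) 0"
    and S2: "integrable M (\<lambda>\<omega>. (S s \<omega>)\<^sup>2)"
    and Gb: "\<And>u. u \<in> {0..T} \<Longrightarrow> (\<integral>\<omega>. (G u \<omega>)\<^sup>2 \<partial>M) \<le> Gb"
  defines "h \<equiv> t - s"
  defines "q \<equiv> exp ((2 * \<alpha> + \<sigma>\<^sup>2) * h) - exp (2 * \<alpha> * h) + \<sigma>\<^sup>2 * h - 2 * \<sigma>\<^sup>2 * h * exp (\<alpha> * h)"
  defines "m \<equiv> exp (\<alpha> * h) - 1 - \<alpha> * h"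
  shows "(\<integral>\<omega>. (S t \<omega> - G t \<omega>)\<^sup>2 \<partial>M) \<le> (1 + h) * ((1 + \<alpha> * h)\<^sup>2 * (\<integral>\<omega>. (S s \<omega> - G s \<omega>)\<^sup>2 \<partial>M)
      + (3 * (\<sigma>\<^sup>2 * h * (\<integral>\<omega>. (S s \<omega> - G s \<omega>)\<^sup>2 \<partial>M)) + 3 * (C * h\<^sup>2) + 3 * (Gb * q)))
      + (1 + 1 / h) * (2 * (C * h^3) + 2 * (m\<^sup>2 * Gb))"
proof -
  have h: "0 < h" using assms by (simp add: h_def)
  have sT: "s \<in> {0..T}" and tT: "t \<in> {0..T}" using assms by auto
  have [measurable]: "W s \<in> borel_measurable M" "W t \<in> borel_measurable M" "S s \<in> borel_measurable M"
    "S t \<in> borel_measurable M" "G s \<in> borel_measurable M" "G t \<in> borel_measurable M"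
    using sT tT by (simp_all add: W_measurable S_measurable G_measurable)
  define r where "r x = exp ((\<alpha> - \<sigma>\<^sup>2 / 2) * h + \<sigma> * x) - exp (\<alpha> * h) - \<sigma> * x" for x
  have [measurable]: "r \<in> borel_measurable borel" unfolding r_def[abs_def] by measurable
  define D where "D \<omega> = W t \<omega> - W s \<omega>" for \<omega>
  have [measurable]: "D \<in> borel_measurable M" unfolding D_def[abs_def] by measurable
  note r1 = gbm_increment_remainder(1)[OF assms(1-3), of \<alpha> \<sigma>, folded h_def, folded r_def]
  note r2 = gbm_increment_remainder(2)[OF assms(1-3), of \<alpha> \<sigma>, folded h_def, folded r_def q_def]
  define e where "e \<omega> = S s \<omega> - G s \<omega>" for \<omega>
  have eF: "e \<in> borel_measurable (F s)" using S_adapted[OF sT] G_adapted[OF sT] by (simp add: e_def[abs_def])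
  have [measurable]: "e \<in> borel_measurable M" by (simp add: e_def[abs_def])
  have G2: "integrable M (\<lambda>\<omega>. (G s \<omega>)\<^sup>2)" using G_square[OF sT] by (simp add: has_bochner_integral_iff)
  have e2: "integrable M (\<lambda>\<omega>. (e \<omega>)\<^sup>2)"
    using integrable_square_add[of "S s" M "\<lambda>\<omega>. (-1) * G s \<omega>"] S2 G2 by (simp add: e_def)
  \<comment> \<open>\<open>b1\<close> is the linear noise acting on the old error and
    \<open>b3\<close> the nonlinear noise remainder of G. \<open>d2\<close>, below, is the gap
    between the mean growth exp (\<alpha> h) of G and the Euler factor 1 + \<alpha> h.\<close>
  define b1 where "b1 \<omega> = \<sigma> * (e \<omega> * D \<omega>)" for \<omega>
  define b3 where "b3 \<omega> = (-1) * (G s \<omega> * r (D \<omega>))" for \<omega>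
  define d2 where "d2 \<omega> = - m * G s \<omega>" for \<omega>
  have [measurable]: "b1 \<in> borel_measurable M" "b3 \<in> borel_measurable M" "d2 \<in> borel_measurable M"
    by (simp_all add: b1_def[abs_def] b3_def[abs_def] d2_def[abs_def])
  have B1: "has_bochner_integral M (\<lambda>\<omega>. (e \<omega>)\<^sup>2 * (D \<omega>)\<^sup>2) ((\<integral>\<omega>. (e \<omega>)\<^sup>2 \<partial>M) * h)"
    unfolding D_def h_def using eF e2 assms by (intro mult_increment_square) auto
  have b1: "integrable M (\<lambda>\<omega>. (b1 \<omega>)\<^sup>2)" "(\<integral>\<omega>. (b1 \<omega>)\<^sup>2 \<partial>M) = \<sigma>\<^sup>2 * h * (\<integral>\<omega>. (e \<omega>)\<^sup>2 \<partial>M)"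
    using B1 by (auto simp: b1_def power_mult_distrib has_bochner_integral_iff)
  have B3: "has_bochner_integral M (\<lambda>\<omega>. (G s \<omega>)\<^sup>2 * (r (D \<omega>))\<^sup>2) ((\<integral>\<omega>. (G s \<omega>)\<^sup>2 \<partial>M) * q)"
    unfolding D_def using assms(1-3) G_adapted[OF sT] G2 r2
    by (intro mult_increment[where g="\<lambda>x. (r x)\<^sup>2"]) auto
  have b3: "integrable M (\<lambda>\<omega>. (b3 \<omega>)\<^sup>2)" "(\<integral>\<omega>. (b3 \<omega>)\<^sup>2 \<partial>M) = (\<integral>\<omega>. (G s \<omega>)\<^sup>2 \<partial>M) * q"
    using B3 by (auto simp: b3_def power_mult_distrib has_bochner_integral_iff)
  \<comment> \<open>The sign of \<open>q\<close> is not visible from its formula; it is an expected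
    square.\<close>
  have q_nonneg: "0 \<le> q"
    using r2 by (metis (no_types, lifting) has_bochner_integral_integral_eq Bochner_Integration.integral_nonneg zero_le_power2)
  have o1: "has_bochner_integral M (\<lambda>\<omega>. \<sigma> * ((e \<omega>)\<^sup>2 * D \<omega>)) (\<sigma> * 0)"
    unfolding D_def using eF e2 assms(1-3) by (intro has_bochner_integral_mult_right mult_increment_1) auto
  have eG: "integrable M (\<lambda>\<omega>. e \<omega> * G s \<omega>)"
    using e2 G2 by (intro integrable_mult_square_integrable) auto
  have o3: "has_bochner_integral M (\<lambda>\<omega>. (-1) * ((e \<omega> * G s \<omega>) * r (D \<omega>))) ((-1) * ((\<integral>\<omega>. e \<omega> * G s \<omega> \<partial>M) * 0))"
    unfolding D_def using assms(1-3) G_adapted[OF sT] eF eG r1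
    by (intro has_bochner_integral_mult_right mult_increment[where g=r]) auto
  have o2: "has_bochner_integral M (\<lambda>\<omega>. e \<omega> * \<nu> \<omega>) 0" using orth[OF eF e2] .
  have O: "has_bochner_integral M (\<lambda>\<omega>. e \<omega> * (b1 \<omega> + \<nu> \<omega> + b3 \<omega>)) 0"
    using has_bochner_integral_add[OF has_bochner_integral_add[OF o1 o2] o3]
    by (simp add: b1_def b3_def algebra_simps power2_eq_square)
  have b: "integrable M (\<lambda>\<omega>. (b1 \<omega> + \<nu> \<omega> + b3 \<omega>)\<^sup>2)"
    using b1 b3 \<nu> by (auto intro!: integrable_square_add)
  have d2: "integrable M (\<lambda>\<omega>. (d2 \<omega>)\<^sup>2)" "(\<integral>\<omega>. (d2 \<omega>)\<^sup>2 \<partial>M) = m\<^sup>2 * (\<integral>\<omega>. (G s \<omega>)\<^sup>2 \<partial>M)"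
    using G2 by (auto simp: d2_def power_mult_distrib)
  have d: "integrable M (\<lambda>\<omega>. (\<mu> \<omega> + d2 \<omega>)\<^sup>2)"
    using \<mu> d2 by (auto intro!: integrable_square_add)
  have "(\<integral>\<omega>. (\<mu> \<omega> + d2 \<omega>)\<^sup>2 \<partial>M) \<le> (\<integral>\<omega>. 2 * (\<mu> \<omega>)\<^sup>2 + 2 * (d2 \<omega>)\<^sup>2 \<partial>M)"
  proof (rule integral_mono[OF d])
    show "integrable M (\<lambda>\<omega>. 2 * (\<mu> \<omega>)\<^sup>2 + 2 * (d2 \<omega>)\<^sup>2)" using \<mu> d2 by simp
    show "(\<mu> \<omega> + d2 \<omega>)\<^sup>2 \<le> 2 * (\<mu> \<omega>)\<^sup>2 + 2 * (d2 \<omega>)\<^sup>2" for \<omega>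
      using sum_squares_bound[of "\<mu> \<omega>" "d2 \<omega>"] by (simp add: power2_sum)
  qed
  also have "\<dots> = 2 * (\<integral>\<omega>. (\<mu> \<omega>)\<^sup>2 \<partial>M) + 2 * (\<integral>\<omega>. (d2 \<omega>)\<^sup>2 \<partial>M)" using \<mu> d2 by simp
  also have "\<dots> \<le> 2 * (C * h^3) + 2 * (m\<^sup>2 * Gb)"
    unfolding d2(2) h_def using \<mu>(2) Gb[OF sT] by (intro add_mono mult_left_mono) auto
  finally have d_le: "(\<integral>\<omega>. (\<mu> \<omega> + d2 \<omega>)\<^sup>2 \<partial>M) \<le> 2 * (C * h^3) + 2 * (m\<^sup>2 * Gb)" .
  have "(\<integral>\<omega>. (b1 \<omega> + \<nu> \<omega> + b3 \<omega>)\<^sup>2 \<partial>M) \<le> 3 * (\<integral>\<omega>. (b1 \<omega>)\<^sup>2 \<partial>M) + 3 * (\<integral>\<omega>. (\<nu> \<omega>)\<^sup>2 \<partial>M) + 3 * (\<integral>\<omega>. (b3 \<omega>)\<^sup>2 \<partial>M)"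
    using b1 b3 \<nu> by (intro expectation_square_sum3_le) auto
  also have "\<dots> \<le> 3 * (\<sigma>\<^sup>2 * h * (\<integral>\<omega>. (e \<omega>)\<^sup>2 \<partial>M)) + 3 * (C * h\<^sup>2) + 3 * (Gb * q)"
    unfolding b1(2) b3(2) h_def using \<nu>(2) mult_right_mono[OF Gb[OF sT] q_nonneg] h[unfolded h_def] by (intro add_mono mult_left_mono) auto
  finally have b_le: "(\<integral>\<omega>. (b1 \<omega> + \<nu> \<omega> + b3 \<omega>)\<^sup>2 \<partial>M)
    \<le> 3 * (\<sigma>\<^sup>2 * h * (\<integral>\<omega>. (e \<omega>)\<^sup>2 \<partial>M)) + 3 * (C * h\<^sup>2) + 3 * (Gb * q)" .
  have Gt: "G t \<omega> = G s \<omega> * (1 + \<alpha> * h + \<sigma> * D \<omega> + m + r (D \<omega>))" for \<omega>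
  proof -
    have "G t \<omega> = G s \<omega> * exp ((\<alpha> - \<sigma>\<^sup>2 / 2) * h + \<sigma> * D \<omega>)"
      unfolding G_def mult.assoc exp_add[symmetric] by (simp add: h_def D_def field_simps)
    then show ?thesis by (simp add: m_def r_def)
  qed
  have "(\<integral>\<omega>. (S t \<omega> - G t \<omega>)\<^sup>2 \<partial>M) = (\<integral>\<omega>. ((1 + \<alpha> * h) * e \<omega> + (b1 \<omega> + \<nu> \<omega> + b3 \<omega>) + (\<mu> \<omega> + d2 \<omega>))\<^sup>2 \<partial>M)"
  proof (rule integral_cong_AE)
    show "AE \<omega> in M. (S t \<omega> - G t \<omega>)\<^sup>2 = ((1 + \<alpha> * h) * e \<omega> + (b1 \<omega> + \<nu> \<omega> + b3 \<omega>) + (\<mu> \<omega> + d2 \<omega>))\<^sup>2"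
      using AE_S
    proof eventually_elim
      case (elim \<omega>)
      have "S t \<omega> - G t \<omega> = (1 + \<alpha> * h) * e \<omega> + (b1 \<omega> + \<nu> \<omega> + b3 \<omega>) + (\<mu> \<omega> + d2 \<omega>)"
        unfolding Gt elim[folded h_def] b1_def b3_def d2_def e_def D_def by (simp add: algebra_simps)
      then show ?case by simp
    qed
  qed measurable
  also have "\<dots> \<le> (1 + h) * ((1 + \<alpha> * h)\<^sup>2 * (\<integral>\<omega>. (e \<omega>)\<^sup>2 \<partial>M) + (\<integral>\<omega>. (b1 \<omega> + \<nu> \<omega> + b3 \<omega>)\<^sup>2 \<partial>M))
      + (1 + 1 / h) * (\<integral>\<omega>. (\<mu> \<omega> + d2 \<omega>)\<^sup>2 \<partial>M)"
    using e2 b d O h by (intro expectation_square_sum_le) auto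
  also have "\<dots> \<le> (1 + h) * ((1 + \<alpha> * h)\<^sup>2 * (\<integral>\<omega>. (e \<omega>)\<^sup>2 \<partial>M) + 
      (3 * (\<sigma>\<^sup>2 * h * (\<integral>\<omega>. (e \<omega>)\<^sup>2 \<partial>M)) + 3 * (C * h\<^sup>2) + 3 * (Gb * q)))
      + (1 + 1 / h) * (2 * (C * h^3) + 2 * (m\<^sup>2 * Gb))"
    using h b_le d_le by (intro add_mono mult_left_mono order_refl) auto
  finally show ?thesis by (simp only: e_def)
qed


lemma S_0: "AE \<omega> in M. S 0 \<omega> = x0"
  by (rule S_increment_decomposition) blast

text \<open>Brings the step into the form (1 + K h) a + h \<eta>(h) of the Gronwall argument, where
  \<eta> contains \<open>q\<close> and \<open>m\<close> only through difference quotients at 0.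
  Since h \<le> 1, h^2 is bounded by h, 1 + h by 2, and 1 + 1/h by 2/h.\<close>

lemma error_coefficient_bound:
  fixes a h :: real
  assumes "0 < h" "h \<le> 1" "0 \<le> a" "0 \<le> C" "0 \<le> Gb"
  defines "K \<equiv> 1 + 2 * (2 * \<bar>\<alpha>\<bar> + \<alpha>\<^sup>2 + 3 * \<sigma>\<^sup>2)"
  shows "(1 + h) * ((1 + \<alpha> * h)\<^sup>2 * a + (3 * (\<sigma>\<^sup>2 * h * a) + 3 * (C * h\<^sup>2) + 3 * (Gb * q)))
      + (1 + 1 / h) * (2 * (C * h^3) + 2 * (m\<^sup>2 * Gb))
    \<le> (1 + K * h) * a + h * (2 * (3 * C * h + 3 * Gb * \<bar>q / h\<bar>) + (4 * C * h + 4 * Gb * (m / h)\<^sup>2))"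
proof -
  \<comment> \<open>The linear coefficient of (1 + \<alpha> h)^2 + 3 \<sigma>^2 h after bounding h^2
    by h. Multiplication by 1 + h then gives at most 1 + (1 + 2 K1) h, which explains
    \<open>K\<close>.\<close>
  define K1 where "K1 = 2 * \<bar>\<alpha>\<bar> + \<alpha>\<^sup>2 + 3 * \<sigma>\<^sup>2"
  have K1: "0 \<le> K1" by (simp add: K1_def)
  have hh: "h * h \<le> h" using assms mult_left_mono[of h 1 h] by simp
  have "(1 + \<alpha> * h)\<^sup>2 + 3 * \<sigma>\<^sup>2 * h = 1 + 2 * \<alpha> * h + \<alpha>\<^sup>2 * (h * h) + 3 * \<sigma>\<^sup>2 * h"
    by (simp add: power2_eq_square algebra_simps)
  also have "\<dots> \<le> 1 + 2 * \<bar>\<alpha>\<bar> * h + \<alpha>\<^sup>2 * h + 3 * \<sigma>\<^sup>2 * h"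
    using assms hh by (intro add_mono mult_left_mono mult_right_mono order_refl) auto
  finally have 1: "(1 + \<alpha> * h)\<^sup>2 + 3 * \<sigma>\<^sup>2 * h \<le> 1 + K1 * h" by (simp add: K1_def algebra_simps)
  have "(1 + h) * (1 + K1 * h) = 1 + h + K1 * h + K1 * (h * h)" by (simp add: algebra_simps)
  also have "\<dots> \<le> 1 + h + K1 * h + K1 * h" using K1 hh by (intro add_mono mult_left_mono order_refl)
  also have "\<dots> = 1 + K * h" by (simp add: K_def K1_def algebra_simps)
  finally have 2: "(1 + h) * (1 + K1 * h) \<le> 1 + K * h" .
  have "(1 + h) * ((1 + \<alpha> * h)\<^sup>2 + 3 * \<sigma>\<^sup>2 * h) \<le> 1 + K * h"
    by (rule order_trans[OF mult_left_mono[OF 1] 2]) (use assms(1) in simp)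
  from mult_right_mono[OF this \<open>0 \<le> a\<close>]
  have A: "(1 + h) * ((1 + \<alpha> * h)\<^sup>2 * a + 3 * (\<sigma>\<^sup>2 * h * a)) \<le> (1 + K * h) * a"
    by (simp add: algebra_simps)
  have q: "q \<le> h * \<bar>q / h\<bar>" using assms by (simp add: abs_divide)
  have "3 * (C * h\<^sup>2) + 3 * (Gb * q) \<le> 3 * (C * h\<^sup>2) + 3 * (Gb * (h * \<bar>q / h\<bar>))"
    using q assms by (intro add_mono mult_left_mono order_refl) auto
  also have "\<dots> = h * (3 * C * h + 3 * Gb * \<bar>q / h\<bar>)"
    by (simp add: power2_eq_square algebra_simps)
  finally have "(1 + h) * (3 * (C * h\<^sup>2) + 3 * (Gb * q)) \<le> (1 + h) * (h * (3 * C * h + 3 * Gb * \<bar>q / h\<bar>))"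
    using assms by (intro mult_left_mono) auto
  also have "\<dots> \<le> 2 * (h * (3 * C * h + 3 * Gb * \<bar>q / h\<bar>))"
    using assms by (intro mult_right_mono) auto
  finally have B: "(1 + h) * (3 * (C * h\<^sup>2) + 3 * (Gb * q)) \<le> h * (2 * (3 * C * h + 3 * Gb * \<bar>q / h\<bar>))"
    by (simp only: mult.left_commute)
  have "(1 + 1 / h) * (2 * (C * h^3) + 2 * (m\<^sup>2 * Gb)) \<le> (2 / h) * (2 * (C * h^3) + 2 * (m\<^sup>2 * Gb))"
    using assms by (intro mult_right_mono) (auto simp: field_simps)
  also have "\<dots> = h * (4 * C * h + 4 * Gb * (m / h)\<^sup>2)"
    using assms by (simp add: field_simps power2_eq_square power3_eq_cube)
  finally show ?thesis using A B by (simp add: algebra_simps)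
qed

theorem S_eq_G: "AE \<omega> in M. S T \<omega> = G T \<omega>"
proof -
  obtain C where C: "0 \<le> C"
    and S2: "\<And>t. t \<in> {0..T} \<Longrightarrow> integrable M (\<lambda>\<omega>. (S t \<omega>)\<^sup>2)"
    and inc: "\<And>s t. 0 \<le> s \<Longrightarrow> s < t \<Longrightarrow> t \<le> T \<Longrightarrow> \<exists>\<mu> \<nu>. \<mu> \<in> borel_measurable M \<and> \<nu> \<in> borel_measurable M \<and>
      (AE \<omega> in M. S t \<omega> = S s \<omega> * (1 + \<alpha> * (t - s) + \<sigma> * (W t \<omega> - W s \<omega>)) + \<mu> \<omega> + \<nu> \<omega>) \<and>
      integrable M (\<lambda>\<omega>. (\<mu> \<omega>)\<^sup>2) \<and> (\<integral>\<omega>. (\<mu> \<omega>)\<^sup>2 \<partial>M) \<le> C * (t - s)^3 \<and>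
      integrable M (\<lambda>\<omega>. (\<nu> \<omega>)\<^sup>2) \<and> (\<integral>\<omega>. (\<nu> \<omega>)\<^sup>2 \<partial>M) \<le> C * (t - s)\<^sup>2 \<and>
      (\<forall>X \<in> borel_measurable (F s). integrable M (\<lambda>\<omega>. (X \<omega>)\<^sup>2) \<longrightarrow> has_bochner_integral M (\<lambda>\<omega>. X \<omega> * \<nu> \<omega>) 0)"
    by (rule S_increment) blast
  \<comment> \<open>The exact second moment of G with |\<alpha>| for \<alpha> and T for u, so that
    it bounds all times at once.\<close>
  define Gb where "Gb = x0\<^sup>2 * exp ((2 * \<bar>\<alpha>\<bar> + \<sigma>\<^sup>2) * T)"
  have Gb: "(\<integral>\<omega>. (G u \<omega>)\<^sup>2 \<partial>M) \<le> Gb" if "u \<in> {0..T}" for u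
  proof -
    have "(2 * \<alpha> + \<sigma>\<^sup>2) * u \<le> (2 * \<bar>\<alpha>\<bar> + \<sigma>\<^sup>2) * T"
      using that by (intro mult_mono) auto
    then show ?thesis
      using G_square[OF that] by (simp add: has_bochner_integral_iff Gb_def mult_left_mono)
  qed
  have Gb_nonneg: "0 \<le> Gb" by (simp add: Gb_def)
  define q where "q h = exp ((2 * \<alpha> + \<sigma>\<^sup>2) * h) - exp (2 * \<alpha> * h) + \<sigma>\<^sup>2 * h - 2 * \<sigma>\<^sup>2 * h * exp (\<alpha> * h)" for h
  define m where "m h = exp (\<alpha> * h) - 1 - \<alpha> * h" for h
  define K where "K = 1 + 2 * (2 * \<bar>\<alpha>\<bar> + \<alpha>\<^sup>2 + 3 * \<sigma>\<^sup>2)"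
  define \<eta> where "\<eta> h = 2 * (3 * C * h + 3 * Gb * \<bar>q h / h\<bar>) + (4 * C * h + 4 * Gb * (m h / h)\<^sup>2)" for h
  define err where "err t = (\<integral>\<omega>. (S t \<omega> - G t \<omega>)\<^sup>2 \<partial>M)" for t
  have step: "err t \<le> (1 + K * (t - s)) * err s + (t - s) * \<eta> (t - s)"
    if st: "0 \<le> s" "s < t" "t \<le> T" "t - s \<le> 1" for s t
  proof -
    from inc[OF st(1-3)] obtain \<mu> \<nu> where \<mu>\<nu>: "\<mu> \<in> borel_measurable M" "\<nu> \<in> borel_measurable M"
      "AE \<omega> in M. S t \<omega> = S s \<omega> * (1 + \<alpha> * (t - s) + \<sigma> * (W t \<omega> - W s \<omega>)) + \<mu> \<omega> + \<nu> \<omega>"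
      "integrable M (\<lambda>\<omega>. (\<mu> \<omega>)\<^sup>2)" "(\<integral>\<omega>. (\<mu> \<omega>)\<^sup>2 \<partial>M) \<le> C * (t - s)^3"
      "integrable M (\<lambda>\<omega>. (\<nu> \<omega>)\<^sup>2)" "(\<integral>\<omega>. (\<nu> \<omega>)\<^sup>2 \<partial>M) \<le> C * (t - s)\<^sup>2"
      and orth: "\<And>X. X \<in> borel_measurable (F s) \<Longrightarrow> integrable M (\<lambda>\<omega>. (X \<omega>)\<^sup>2) \<Longrightarrow> has_bochner_integral M (\<lambda>\<omega>. X \<omega> * \<nu> \<omega>) 0"
      by blast
    have s: "s \<in> {0..T}" using st by auto
    have "err t \<le> (1 + (t - s)) * ((1 + \<alpha> * (t - s))\<^sup>2 * err s
      + (3 * (\<sigma>\<^sup>2 * (t - s) * err s) + 3 * (C * (t - s)\<^sup>2) + 3 * (Gb * q (t - s))))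
      + (1 + 1 / (t - s)) * (2 * (C * (t - s)^3) + 2 * ((m (t - s))\<^sup>2 * Gb))"
      unfolding err_def q_def m_def
      by (rule error_step[OF st(1-3) C \<mu>\<nu> orth S2[OF s] Gb])
    also have "\<dots> \<le> (1 + K * (t - s)) * err s + (t - s) * \<eta> (t - s)"
      unfolding K_def \<eta>_def using st C Gb_nonneg by (intro error_coefficient_bound) (auto simp: err_def)
    finally show ?thesis .
  qed
  have err_0: "err 0 = 0"
  proof -
    have "AE \<omega> in M. (S 0 \<omega> - G 0 \<omega>)\<^sup>2 = 0"
      using S_0 starts_0 by eventually_elim (simp add: G_def)
    then show ?thesis unfolding err_def by (rule integral_eq_zero_AE)
  qed
  \<comment> \<open>With n steps of length h = T/n, the n local errors h \<eta>(h) add up to T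
    \<eta>(h), and the exponent K h n equals K T, so the Gronwall factor does not grow with
    n.\<close>
  have bound: "err T \<le> T * \<eta> (T / real n) * exp (K * T)" if n: "0 < n" "T / real n \<le> 1" for n
  proof -
    define h where "h = T / real n"
    have h: "0 < h" "h \<le> 1" "real n * h = T" using n T_pos by (auto simp: h_def)
    have \<eta>: "0 \<le> \<eta> h" using h C Gb_nonneg by (simp add: \<eta>_def)
    have "err (real n * h) \<le> real n * (h * \<eta> h) * exp ((K * h) * real n)"
    proof (rule discrete_gronwall[where a="\<lambda>k. err (real k * h)"])
      show "0 \<le> K * h" "0 \<le> h * \<eta> h" using h \<eta> by (auto simp: K_def)
      fix k assume "k < n"
      then have "real (Suc k) * h \<le> real n * h" using h by (intro mult_right_mono) auto
      then have "real k * h + h \<le> T" using h by (simp add: algebra_simps)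
      then show "err (real (Suc k) * h) \<le> (1 + K * h) * err (real k * h) + h * \<eta> h"
        using step[of "real k * h" "real k * h + h"] h by (simp add: algebra_simps)
    qed (use err_0 in simp)
    also have "real n * (h * \<eta> h) * exp ((K * h) * real n) = T * \<eta> (T / real n) * exp (K * T)"
      using h(3) by (metis h_def mult.assoc mult.commute)
    finally show ?thesis using h(3) by simp
  qed
  \<comment> \<open>The difference quotients converge along the punctured neighbourhood of 0, so T/n
    has to be nonzero, which excludes n = 0.\<close>
  have lim0: "filterlim (\<lambda>n. T / real n) (at 0) sequentially"
  proof (rule filterlim_atI)
    show "(\<lambda>n. T / real n) \<longlonglongrightarrow> 0" by (rule lim_const_over_n)
    show "\<forall>\<^sub>F n in sequentially. T / real n \<noteq> 0"
      using eventually_gt_at_top[of 0] by eventually_elim (use T_pos in auto)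
  qed
  \<comment> \<open>The terms of this derivative cancel. Since q also vanishes at 0, q h / h tends
    to 0: the noise remainder of G is o(h) in square mean. In the same way m is o(h), so its square
    is o(h^2).\<close>
  have "(q has_real_derivative (2 * \<alpha> + \<sigma>\<^sup>2) - 2 * \<alpha> + \<sigma>\<^sup>2 - 2 * \<sigma>\<^sup>2) (at 0)"
    unfolding q_def[abs_def] by (auto intro!: derivative_eq_intros)
  then have q_lim: "((\<lambda>h. q h / h) \<longlongrightarrow> 0) (at 0)"
    by (simp add: DERIV_def q_def)
  have "(m has_real_derivative \<alpha> - \<alpha>) (at 0)"
    unfolding m_def[abs_def] by (auto intro!: derivative_eq_intros)
  then have m_lim: "((\<lambda>h. m h / h) \<longlongrightarrow> 0) (at 0)"
    by (simp add: DERIV_def m_def)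
  have id_lim: "((\<lambda>h::real. h) \<longlongrightarrow> 0) (at 0)" by (rule tendsto_ident_at)
  have "(\<eta> \<longlongrightarrow> 2 * (3 * C * 0 + 3 * Gb * \<bar>0\<bar>) + (4 * C * 0 + 4 * Gb * 0\<^sup>2)) (at 0)"
    unfolding \<eta>_def[abs_def] by (intro tendsto_intros q_lim m_lim id_lim)
  then have "(\<eta> \<longlongrightarrow> 0) (at 0)" by simp
  from filterlim_compose[OF this lim0] have \<eta>_lim: "(\<lambda>n. \<eta> (T / real n)) \<longlonglongrightarrow> 0" .
  have lim: "(\<lambda>n. T * \<eta> (T / real n) * exp (K * T)) \<longlonglongrightarrow> 0"
    using tendsto_mult[OF tendsto_mult[OF tendsto_const[of T] \<eta>_lim] tendsto_const[of "exp (K * T)"]] by simp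
  have "\<forall>\<^sub>F n in sequentially. T / real n < 1"
    using lim_const_over_n[of T] by (rule order_tendstoD) simp
  with eventually_gt_at_top[of 0]
  have "\<forall>\<^sub>F n in sequentially. err T \<le> T * \<eta> (T / real n) * exp (K * T)"
    by eventually_elim (use bound in simp)
  from tendsto_le[OF _ lim tendsto_const this] have "err T \<le> 0" by simp
  moreover have T: "T \<in> {0..T}" using T_pos by auto
  moreover have "integrable M (\<lambda>\<omega>. (S T \<omega> - G T \<omega>)\<^sup>2)"
    using integrable_square_add[of "S T" M "\<lambda>\<omega>. (-1) * G T \<omega>"] S2[OF T] G_square[OF T] S_measurable[OF T] G_measurable[OF T]
    by (simp add: has_bochner_integral_iff)
  moreover have "0 \<le> err T" by (simp add: err_def)
  ultimately have "AE \<omega> in M. (S T \<omega> - G T \<omega>)\<^sup>2 = 0"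
    unfolding err_def by (subst integral_nonneg_eq_0_iff_AE[symmetric]) auto
  then show ?thesis by simp
qed

end

section \<open>Joint and conditional densities\<close>

text \<open>\<open>matrix_inv\<close> is defined by choice; uniqueness of two-sided inverses
  identifies the chosen one.\<close>

lemma matrix_inv_eqI:
  fixes A B :: "real^'n^'n"
  assumes "A ** B = mat 1" "B ** A = mat 1"
  shows "matrix_inv A = B"
proof -
  have "A ** matrix_inv A = mat 1"
    unfolding matrix_inv_def by (rule someI2[of _ B]) (use assms in auto)
  then have "B ** (A ** matrix_inv A) = B" by simp
  then show ?thesis unfolding matrix_mul_assoc assms(2) by simp
qed

text \<open>Disintegration of the Gaussian law: the second coordinate, given the value x of the
  first, is normal with mean \<rho> x and variance h (1 - \<rho>^2). It rests on the explicit
  inverse \<open>R\<close> and on completing the square in y.\<close>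

lemma gauss2_density_eq:
  fixes \<rho> h :: real
  assumes h: "0 < h" and \<rho>: "\<rho>\<^sup>2 < 1" and Q: "Q = (vector [vector [1, \<rho>], vector [\<rho>, 1]] :: real^2^2)"
  shows "gauss2_density (h *\<^sub>R Q) (x, y)
    = normal_density 0 (sqrt h) x * normal_density (\<rho> * x) (sqrt (h * (1 - \<rho>\<^sup>2))) y"
proof -
  define d where "d = 1 - \<rho>\<^sup>2"
  have d: "0 < d" using \<rho> by (simp add: d_def)
  define R :: "real^2^2" where "R = vector [vector [1 / (h * d), - \<rho> / (h * d)], vector [- \<rho> / (h * d), 1 / (h * d)]]"
  have "(h *\<^sub>R Q) ** R = mat 1" "R ** (h *\<^sub>R Q) = mat 1"
    using h d by (auto simp: vec_eq_iff forall_2 matrix_matrix_mult_def sum_2 Q R_def mat_def field_simps)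
      (simp_all add: d_def power2_eq_square)
  then have inv: "matrix_inv (h *\<^sub>R Q) = R" by (rule matrix_inv_eqI)
  have "det (h *\<^sub>R Q) = h\<^sup>2 * d"
    by (simp add: det_2 Q d_def power2_eq_square algebra_simps)
  then have det: "sqrt (det (h *\<^sub>R Q)) = h * sqrt d" using h by (simp add: real_sqrt_mult)
  have quad: "(vector [x, y] :: real^2) \<bullet> (R *v vector [x, y]) = (x\<^sup>2 - 2 * \<rho> * x * y + y\<^sup>2) / (h * d)"
    using h d by (simp add: inner_vec_def sum_2 matrix_vector_mult_def R_def field_simps power2_eq_square)
  have ex: "- ((x\<^sup>2 - 2 * \<rho> * x * y + y\<^sup>2) / (h * d)) / 2 = - x\<^sup>2 / (2 * h) + - (y - \<rho> * x)\<^sup>2 / (2 * (h * d))"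
    using h d by (simp add: d_def field_simps power2_eq_square)
  have den: "sqrt (2 * pi * h) * sqrt (2 * pi * (h * d)) = 2 * pi * (h * sqrt d)"
  proof -
    have "sqrt (2 * pi * h) * sqrt (2 * pi * (h * d)) = sqrt ((2 * pi * h)\<^sup>2 * d)"
      unfolding real_sqrt_mult[symmetric] by (simp add: power2_eq_square mult_ac)
    also have "\<dots> = (2 * pi * h) * sqrt d" using h by (simp only: real_sqrt_mult real_sqrt_abs) simp
    finally show ?thesis by (simp add: mult.assoc)
  qed
  have "gauss2_density (h *\<^sub>R Q) (x, y)
      = exp (- x\<^sup>2 / (2 * h)) * exp (- (y - \<rho> * x)\<^sup>2 / (2 * (h * d))) / (2 * pi * (h * sqrt d))"
    unfolding gauss2_density_def Let_def prod.case inv det quad ex exp_add by (simp add: mult.assoc)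
  also have "\<dots> = normal_density 0 (sqrt h) x * normal_density (\<rho> * x) (sqrt (h * d)) y"
    unfolding den[symmetric] using h d by (simp add: normal_density_def)
  finally show ?thesis by (simp only: d_def)
qed

text \<open>Transfers the marginal, computed only for the first coordinate, to the second.\<close>

lemma gauss2_density_sym:
  fixes \<rho> h :: real
  assumes h: "0 < h" and \<rho>: "\<rho>\<^sup>2 < 1" and Q: "Q = (vector [vector [1, \<rho>], vector [\<rho>, 1]] :: real^2^2)"
  shows "gauss2_density (h *\<^sub>R Q) (x, y) = gauss2_density (h *\<^sub>R Q) (y, x)"
  unfolding gauss2_density_eq[OF assms] normal_density_def using h \<rho>
  by (simp add: exp_add[symmetric] field_simps power2_eq_square)

lemma gauss2_density_marginal:
  fixes \<rho> h :: real
  assumes h: "0 < h" and \<rho>: "\<rho>\<^sup>2 < 1" and Q: "Q = (vector [vector [1, \<rho>], vector [\<rho>, 1]] :: real^2^2)"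
  shows "(\<integral>\<^sup>+y. ennreal (gauss2_density (h *\<^sub>R Q) (x, y)) \<partial>lborel) = ennreal (normal_density 0 (sqrt h) x)"
proof -
  have s: "0 < sqrt (h * (1 - \<rho>\<^sup>2))" using h \<rho> by simp
  have "(\<integral>\<^sup>+y. ennreal (gauss2_density (h *\<^sub>R Q) (x, y)) \<partial>lborel)
    = ennreal (normal_density 0 (sqrt h) x) * (\<integral>\<^sup>+y. ennreal (normal_density (\<rho> * x) (sqrt (h * (1 - \<rho>\<^sup>2))) y) \<partial>lborel)"
    unfolding gauss2_density_eq[OF assms] by (simp add: ennreal_mult nn_integral_cmult)
  also have "(\<integral>\<^sup>+y. ennreal (normal_density (\<rho> * x) (sqrt (h * (1 - \<rho>\<^sup>2))) y) \<partial>lborel) = 1"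
    using s by (subst nn_integral_eq_integral) auto
  finally show ?thesis by simp
qed

lemma correlation_less_1:
  assumes "Q = (vector [vector [1, \<rho>], vector [\<rho>, 1]] :: real^2^2)" "positive_definite Q"
  shows "\<rho>\<^sup>2 < 1"
proof -
  \<comment> \<open>The quadratic form of Q takes the value 1 - \<rho>^2 at this vector.\<close>
  have "(vector [- \<rho>, 1] :: real^2) \<noteq> 0" by (simp add: vec_eq_iff forall_2)
  then have "0 < (vector [- \<rho>, 1] :: real^2) \<bullet> (Q *v vector [- \<rho>, 1])"
    using assms(2) by (simp add: positive_definite_def)
  then show ?thesis
    by (simp add: assms(1) inner_vec_def sum_2 matrix_vector_mult_def power2_eq_square)
qed

text \<open>Independence passes to smaller sigma-algebras: Y generates a part of N, and a function
  of D generates a part of what D generates. With g a projection, this isolates one coordinate of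
  the increment.\<close>

lemma (in prob_space) indep_var_increment:
  fixes D :: "'a \<Rightarrow> real \<times> real" and Y :: "'a \<Rightarrow> real"
  assumes indep: "indep_set (sets N) (sets (vimage_algebra (space M) D (borel \<Otimes>\<^sub>M borel)))"
    and N: "space N = space M" and Y: "Y \<in> borel_measurable N"
    and g [measurable]: "g \<in> borel_measurable (borel \<Otimes>\<^sub>M borel)"
  shows "indep_var borel Y borel (\<lambda>\<omega>. g (D \<omega>))"
proof -
  let ?V = "vimage_algebra (space M) D (borel \<Otimes>\<^sub>M borel)"
  have ev: "sets N \<subseteq> events" "sets ?V \<subseteq> events"
    using indep_setD_ev1[OF indep] indep_setD_ev2[OF indep] by auto
  have gD: "(\<lambda>\<omega>. g (D \<omega>)) \<in> borel_measurable ?V"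
  proof (rule measurable_compose[OF _ g])
    show "D \<in> ?V \<rightarrow>\<^sub>M borel \<Otimes>\<^sub>M borel" by (rule measurable_vimage_algebra1) (auto simp: space_pair_measure)
  qed
  have A: "sigma_sets (space M) {Y -` A \<inter> space M |A. A \<in> sets borel} \<subseteq> sets N"
    using measurable_sets[OF Y] unfolding N[symmetric] by (intro sets.sigma_sets_subset) auto
  have sV: "space ?V = space M" by simp
  have B: "sigma_sets (space M) {(\<lambda>\<omega>. g (D \<omega>)) -` A \<inter> space M |A. A \<in> sets borel} \<subseteq> sets ?V"
    using measurable_sets[OF gD] sets.sigma_sets_subset[of "{(\<lambda>\<omega>. g (D \<omega>)) -` A \<inter> space M |A. A \<in> sets borel}" ?V]
    unfolding sV by auto
  have "Y \<in> borel_measurable M" "(\<lambda>\<omega>. g (D \<omega>)) \<in> borel_measurable M"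
    using Y gD ev N unfolding measurable_def by auto
  then show ?thesis
    unfolding indep_var_eq using indep A B ev unfolding indep_sets2_eq by blast
qed

lemma wiener2_scalar_wiener:
  assumes W: "wiener2 M F T Q W1 W2" and Q: "Q = vector [vector [1, \<rho>], vector [\<rho>, 1]]" "positive_definite Q"
  shows "scalar_wiener M F T W1" and "scalar_wiener M F T W2"
proof -
  have M: "prob_space M" and F: "filtration (space M) F" using W by (auto simp: wiener2_def)
  interpret prob_space M by fact
  interpret filtration "space M" F by fact
  note \<rho> = correlation_less_1[OF Q]
  have inc: "indep_set (sets (F s)) (sets (vimage_algebra (space M) (\<lambda>\<omega>. (W1 t \<omega> - W1 s \<omega>, W2 t \<omega> - W2 s \<omega>)) (borel \<Otimes>\<^sub>M borel)))"
      "distributed M (lborel \<Otimes>\<^sub>M lborel) (\<lambda>\<omega>. (W1 t \<omega> - W1 s \<omega>, W2 t \<omega> - W2 s \<omega>))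
            (\<lambda>z. ennreal (gauss2_density ((t - s) *\<^sub>R Q) z))"
    if "0 \<le> s" "s < t" "t \<le> T" for s t
    using W that by (auto simp: wiener2_def Let_def)
  show "scalar_wiener M F T W1"
  proof unfold_locales
    show "0 \<le> t \<Longrightarrow> t \<le> T \<Longrightarrow> subalgebra M (F t)" "0 \<le> t \<Longrightarrow> t \<le> T \<Longrightarrow> W1 t \<in> borel_measurable (F t)" for t
      using W by (auto simp: wiener2_def)
    show "AE \<omega> in M. W1 0 \<omega> = 0" using W by (auto simp: wiener2_def)
    fix s t :: real assume st: "0 \<le> s" "s < t" "t \<le> T"
    show "indep_var borel Y borel (\<lambda>\<omega>. W1 t \<omega> - W1 s \<omega>)" if "Y \<in> borel_measurable (F s)" for Y
      using indep_var_increment[OF inc(1)[OF st] space_F that measurable_fst] by simp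
    show "distributed M lborel (\<lambda>\<omega>. W1 t \<omega> - W1 s \<omega>) (\<lambda>x. ennreal (normal_density 0 (sqrt (t - s)) x))"
      using distr_marginal1[OF lborel.sigma_finite_measure_axioms lborel.sigma_finite_measure_axioms inc(2)[OF st]]
        gauss2_density_marginal[OF _ \<rho> Q(1), of "t - s"] st by simp
  qed
  show "scalar_wiener M F T W2"
  proof unfold_locales
    show "0 \<le> t \<Longrightarrow> t \<le> T \<Longrightarrow> subalgebra M (F t)" "0 \<le> t \<Longrightarrow> t \<le> T \<Longrightarrow> W2 t \<in> borel_measurable (F t)" for t
      using W by (auto simp: wiener2_def)
    show "AE \<omega> in M. W2 0 \<omega> = 0" using W by (auto simp: wiener2_def)
    fix s t :: real assume st: "0 \<le> s" "s < t" "t \<le> T"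
    show "indep_var borel Y borel (\<lambda>\<omega>. W2 t \<omega> - W2 s \<omega>)" if "Y \<in> borel_measurable (F s)" for Y
      using indep_var_increment[OF inc(1)[OF st] space_F that measurable_snd] by simp
    have "(\<integral>\<^sup>+x. ennreal (gauss2_density ((t - s) *\<^sub>R Q) (x, y)) \<partial>lborel) = ennreal (normal_density 0 (sqrt (t - s)) y)" for y
      using gauss2_density_marginal[OF _ \<rho> Q(1), of "t - s" y] gauss2_density_sym[OF _ \<rho> Q(1), of "t - s" _ y] st by simp
    then show "distributed M lborel (\<lambda>\<omega>. W2 t \<omega> - W2 s \<omega>) (\<lambda>x. ennreal (normal_density 0 (sqrt (t - s)) x))"
      using distr_marginal2[OF lborel.sigma_finite_measure_axioms lborel.sigma_finite_measure_axioms inc(2)[OF st]] by simp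
  qed
qed

text \<open>As the upper limits are infinite, no interval is reversed, whatever extended value w x
  takes; w x = \<infinity> gives an empty range. The inequalities are strict because interval
  integrals run over open intervals.\<close>

lemma LBINT_region:
  fixes \<Phi> :: "real \<Rightarrow> real \<Rightarrow> real" and w :: "real \<Rightarrow> ereal"
  shows "(LBINT x=ereal a..\<infinity>. (LBINT y=w x..\<infinity>. \<Phi> x y))
    = (\<integral>x. \<integral>y. (if a < x \<and> w x < ereal y then \<Phi> x y else 0) \<partial>lborel \<partial>lborel)"
proof -
  have "(LBINT x=ereal a..\<infinity>. (LBINT y=w x..\<infinity>. \<Phi> x y))
    = (\<integral>x. indicator {a<..} x * (\<integral>y. indicator {y. w x < ereal y} y * \<Phi> x y \<partial>lborel) \<partial>lborel)"
    by (simp add: interval_integral_to_infinity_eq interval_lebesgue_integral_le_eq set_lebesgue_integral_def einterval_def)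
  also have "\<dots> = (\<integral>x. \<integral>y. (if a < x \<and> w x < ereal y then \<Phi> x y else 0) \<partial>lborel \<partial>lborel)"
    by (intro Bochner_Integration.integral_cong refl) (auto simp: indicator_def intro!: Bochner_Integration.integral_cong)
  finally show ?thesis .
qed

text \<open>Passes from an expectation to the iterated integrals of the theorem. The assumption on
  \<open>\<phi>\<close> leaves its value at y = w x open, so that strict and weak inequalities need
  not be distinguished when thresholds are computed.\<close>

lemma cond_density_integral:
  fixes \<phi> :: "real \<times> real \<Rightarrow> real" and X Y :: "'a \<Rightarrow> real"
  assumes f: "is_density M X f" and k: "is_cond_density M Y X k"
    and [measurable]: "\<phi> \<in> borel_measurable (borel \<Otimes>\<^sub>M borel)" and I: "integrable M (\<lambda>\<omega>. \<phi> (X \<omega>, Y \<omega>))"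
    and \<phi>: "\<And>x y. w x \<noteq> ereal y \<Longrightarrow> \<phi> (x, y) = (if a < x \<and> w x < ereal y then \<Phi> x y else 0)"
  shows "(\<integral>\<omega>. \<phi> (X \<omega>, Y \<omega>) \<partial>M) = (LBINT x=ereal a..\<infinity>. (LBINT y=w x..\<infinity>. \<Phi> x y * k x y * f x))"
proof -
  have d: "distributed M (lborel \<Otimes>\<^sub>M lborel) (\<lambda>\<omega>. (X \<omega>, Y \<omega>)) (\<lambda>z. ennreal (k (fst z) (snd z) * f (fst z)))"
    using f k by (simp add: is_cond_density_def split_beta')
  have nn: "0 \<le> k x y" "0 \<le> f x" for x y using f k by (auto simp: is_cond_density_def is_density_def)
  have [measurable]: "(\<lambda>z. k (fst z) (snd z)) \<in> borel_measurable (borel \<Otimes>\<^sub>M borel)"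
    using k by (simp add: is_cond_density_def split_beta')
  have [measurable]: "f \<in> borel_measurable borel"
    using distributed_real_measurable[of lborel f M X] f by (simp add: is_density_def)
  have "\<phi> \<in> borel_measurable (lborel \<Otimes>\<^sub>M lborel)" by simp
  note d' = distributed_integral[OF d this] distributed_integrable[OF d this]
  have I': "integrable (lborel \<Otimes>\<^sub>M lborel) (\<lambda>z. k (fst z) (snd z) * f (fst z) * \<phi> z)"
    using d'(2) I nn by simp
  have "(\<integral>\<omega>. \<phi> (X \<omega>, Y \<omega>) \<partial>M) = (\<integral>z. k (fst z) (snd z) * f (fst z) * \<phi> z \<partial>(lborel \<Otimes>\<^sub>M lborel))"
    using d'(1) nn by simp
  also have "\<dots> = (\<integral>x. \<integral>y. k x y * f x * \<phi> (x, y) \<partial>lborel \<partial>lborel)"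
    using lborel_pair.integral_fst'[OF I'] by simp
  also have "\<dots> = (\<integral>x. \<integral>y. (if a < x \<and> w x < ereal y then \<Phi> x y * k x y * f x else 0) \<partial>lborel \<partial>lborel)"
  proof (rule Bochner_Integration.integral_cong[OF refl])
    fix x :: real
    show "(\<integral>y. k x y * f x * \<phi> (x, y) \<partial>lborel)
      = (\<integral>y. (if a < x \<and> w x < ereal y then \<Phi> x y * k x y * f x else 0) \<partial>lborel)"
    \<comment> \<open>For each x a single point is removed from the inner integral. If w x is
      infinite, this is the point 0, which is equally null.\<close>
    proof (rule integral_discrete_difference[of "{real_of_ereal (w x)}"])
      fix y assume "y \<notin> {real_of_ereal (w x)}"
      then have "w x \<noteq> ereal y" by auto
      then show "k x y * f x * \<phi> (x, y) = (if a < x \<and> w x < ereal y then \<Phi> x y * k x y * f x else 0)"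
        by (simp add: \<phi>)
    qed auto
  qed
  also have "\<dots> = (LBINT x=ereal a..\<infinity>. (LBINT y=w x..\<infinity>. \<Phi> x y * k x y * f x))"
    by (rule LBINT_region[symmetric])
  finally show ?thesis .
qed

section \<open>The quanto option\<close>

text \<open>Common form of both halves of the theorem: \<open>M\<close> is the original measure, with \<open>\<beta>\<^sub>i = \<alpha>\<^sub>i\<close> and
  \<open>b = B\<close>, or the martingale measure, with \<open>\<beta>\<^sub>i = r\<close> and \<open>b = Bt\<close>; \<open>X\<close> and \<open>Y\<close> are the
  values at time \<open>T\<close> of the corresponding Wiener processes.\<close>

locale quanto_option =
  fixes M :: "'a measure" and X Y Z H :: "'a \<Rightarrow> real" and f :: "real \<Rightarrow> real" and k :: "real \<Rightarrow> real \<Rightarrow> real"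
    and T \<sigma>1 \<sigma>2 S10 S20 K A1 A2 b \<beta>1 \<beta>2 c a :: real
  assumes \<sigma>1: "0 < \<sigma>1" and S10: "0 < S10" and S20: "0 < S20" and K: "0 < K" and c: "0 \<le> c"
    and f: "is_density M X f" and k: "is_cond_density M Y X k"
    and exp_integrable: "\<And>u v. integrable M (\<lambda>\<omega>. exp (u * X \<omega> + v * Y \<omega>))"
    and Z: "\<And>\<omega>. Z \<omega> = exp (- A1 * X \<omega> - A2 * Y \<omega> - b * T)"
    and H: "AE \<omega> in M. H \<omega> = S20 * exp ((\<beta>2 - 1 / 2 * \<sigma>2\<^sup>2) * T + \<sigma>2 * Y \<omega>)
      * max (S10 * exp ((\<beta>1 - 1 / 2 * \<sigma>1\<^sup>2) * T + \<sigma>1 * X \<omega>) - K) 0"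
    and H_measurable [measurable]: "H \<in> borel_measurable M"
    and a: "a = 1 / \<sigma>1 * (ln (K / S10) - (\<beta>1 - 1 / 2 * \<sigma>1\<^sup>2) * T)"
begin

section \<open>Payoff, integrability and the linear loss\<close>

lemma X_measurable [measurable]: "X \<in> borel_measurable M"
  using f distributed_measurable[of M lborel X] by (auto simp: is_density_def)

lemma Y_measurable [measurable]: "Y \<in> borel_measurable M"
proof -
  have "(\<lambda>\<omega>. (X \<omega>, Y \<omega>)) \<in> measurable M (lborel \<Otimes>\<^sub>M lborel)"
    using f k distributed_measurable by (auto simp: is_cond_density_def)
  from measurable_compose[OF this measurable_snd] show ?thesis by simp
qed

lemma Z_measurable [measurable]: "Z \<in> borel_measurable M"
  unfolding Z[abs_def] by measurable

definition d :: "real \<Rightarrow> real" where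
  "d x = S10 * exp ((\<beta>1 - 1 / 2 * \<sigma>1\<^sup>2) * T + \<sigma>1 * x) - K"

lemma d_measurable [measurable]: "d \<in> borel_measurable borel"
  unfolding d_def[abs_def] by measurable

text \<open>The first stock is increasing in its Wiener value, and \<open>a\<close> is the value at
  which it equals the strike.\<close>

lemma d_pos: "0 < d x \<longleftrightarrow> a < x"
proof -
  have "0 < d x \<longleftrightarrow> K / S10 < exp ((\<beta>1 - 1 / 2 * \<sigma>1\<^sup>2) * T + \<sigma>1 * x)"
    unfolding d_def using S10 by (simp add: field_simps)
  also have "\<dots> \<longleftrightarrow> exp (ln (K / S10)) < exp ((\<beta>1 - 1 / 2 * \<sigma>1\<^sup>2) * T + \<sigma>1 * x)"
    using K S10 by simp
  also have "\<dots> \<longleftrightarrow> ln (K / S10) < (\<beta>1 - 1 / 2 * \<sigma>1\<^sup>2) * T + \<sigma>1 * x" by simp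
  also have "\<dots> \<longleftrightarrow> a < x" unfolding a using \<sigma>1 by (simp add: field_simps)
  finally show ?thesis .
qed

lemma d_le: "d x \<le> S10 * exp ((\<beta>1 - 1 / 2 * \<sigma>1\<^sup>2) * T) * exp (\<sigma>1 * x)"
  unfolding d_def using K by (simp add: exp_add)

text \<open>All integrands grow at most like exponentials of linear forms in X and Y, so
  \<open>exp_integrable\<close> is the only tail information needed, under either measure.\<close>

lemma integrable_exp_bound:
  assumes [measurable]: "\<phi> \<in> borel_measurable (borel \<Otimes>\<^sub>M borel)"
    and "\<And>x y. \<bar>\<phi> (x, y)\<bar> \<le> C * exp (u * x + v * y)"
  shows "integrable M (\<lambda>\<omega>. \<phi> (X \<omega>, Y \<omega>))"
proof (rule Bochner_Integration.integrable_bound)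
  show "integrable M (\<lambda>\<omega>. C * exp (u * X \<omega> + v * Y \<omega>))" using exp_integrable by simp
  show "AE \<omega> in M. norm (\<phi> (X \<omega>, Y \<omega>)) \<le> norm (C * exp (u * X \<omega> + v * Y \<omega>))"
    using assms(2) by (auto intro!: AE_I2 order_trans[OF _ abs_ge_self])
qed measurable

lemma H_eq: "AE \<omega> in M. H \<omega> = (if a < X \<omega> then S20 * exp ((\<beta>2 - 1 / 2 * \<sigma>2\<^sup>2) * T) * (d (X \<omega>) * exp (\<sigma>2 * Y \<omega>)) else 0)"
  using H
proof eventually_elim
  case (elim \<omega>)
  show ?case
  proof (cases "a < X \<omega>")
    case True
    then have "0 < d (X \<omega>)" by (simp add: d_pos)
    then show ?thesis using True unfolding elim[folded d_def] by (simp add: exp_add)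
  next
    case False
    then have "d (X \<omega>) \<le> 0" using d_pos[of "X \<omega>"] by linarith
    then show ?thesis using False unfolding elim[folded d_def] by simp
  qed
qed

text \<open>Taking logarithms and dividing by A2 > 0 keeps the direction of the inequality. For c =
  0 the condition always holds, which agrees with the threshold -\<infinity>. The weak inequality
  differs from the strict one only at y = l x, which is excluded.\<close>

lemma linear_threshold:
  assumes A2: "0 < A2"
  defines "l \<equiv> \<lambda>x. (ext_ln (ereal c) - ereal (b * T) - ereal (A1 * x)) / ereal A2"
  assumes "l x \<noteq> ereal y"
  shows "c \<le> exp (A1 * x + A2 * y + b * T) \<longleftrightarrow> l x < ereal y"
proof (cases "c = 0")
  case True
  then have "l x = - \<infinity>" using A2 by (simp add: l_def ext_ln_def)
  then show ?thesis using True by simp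
next
  case False
  then have c: "0 < c" using c by simp
  then have l: "l x = ereal ((ln c - b * T - A1 * x) / A2)"
    using A2 by (simp add: l_def ext_ln_def)
  have "c \<le> exp (A1 * x + A2 * y + b * T) \<longleftrightarrow> ln c \<le> A1 * x + A2 * y + b * T"
    using c ln_ge_iff by (metis ln_le_cancel_iff exp_gt_zero ln_exp)
  also have "\<dots> \<longleftrightarrow> (ln c - b * T - A1 * x) / A2 \<le> y"
    using A2 by (auto simp: field_simps)
  also have "\<dots> \<longleftrightarrow> (ln c - b * T - A1 * x) / A2 < y" using assms(3) l by auto
  finally show ?thesis unfolding l by simp
qed

lemma linear_risk_eq:
  assumes A2: "0 < A2"
  shows "linear_risk M Z H c = S20 * exp ((\<beta>2 - 1 / 2 * \<sigma>2\<^sup>2) * T) *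
    (LBINT x=ereal a..\<infinity>. (LBINT y=(ext_ln (ereal c) - ereal (b * T) - ereal (A1 * x)) / ereal A2..\<infinity>.
      d x * exp (\<sigma>2 * y) * k x y * f x))"
proof -
  define \<phi> where "\<phi> = (\<lambda>(x, y). if a < x \<and> c \<le> exp (A1 * x + A2 * y + b * T) then d x * exp (\<sigma>2 * y) else 0)"
  have [measurable]: "\<phi> \<in> borel_measurable (borel \<Otimes>\<^sub>M borel)" unfolding \<phi>_def by measurable
  have I: "integrable M (\<lambda>\<omega>. \<phi> (X \<omega>, Y \<omega>))"
  proof (rule integrable_exp_bound)
    fix x y
    have "d x * exp (\<sigma>2 * y) \<le> S10 * exp ((\<beta>1 - 1 / 2 * \<sigma>1\<^sup>2) * T) * exp (\<sigma>1 * x) * exp (\<sigma>2 * y)"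
      by (intro mult_right_mono d_le) simp
    then show "\<bar>\<phi> (x, y)\<bar> \<le> (S10 * exp ((\<beta>1 - 1 / 2 * \<sigma>1\<^sup>2) * T)) * exp (\<sigma>1 * x + \<sigma>2 * y)"
      using d_pos[of x] S10 by (auto simp: \<phi>_def exp_add mult.assoc abs_mult)
  qed measurable
  have iZ: "inverse (Z \<omega>) = exp (A1 * X \<omega> + A2 * Y \<omega> + b * T)" for \<omega>
    unfolding Z exp_minus[symmetric] by (simp add: algebra_simps)
  have "linear_risk M Z H c = (\<integral>\<omega>. S20 * exp ((\<beta>2 - 1 / 2 * \<sigma>2\<^sup>2) * T) * \<phi> (X \<omega>, Y \<omega>) \<partial>M)"
    unfolding linear_risk_def
  proof (rule integral_cong_AE)
    show "AE \<omega> in M. H \<omega> * indicator {\<omega>. c \<le> inverse (Z \<omega>)} \<omega> = S20 * exp ((\<beta>2 - 1 / 2 * \<sigma>2\<^sup>2) * T) * \<phi> (X \<omega>, Y \<omega>)"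
      using H_eq by eventually_elim (auto simp: \<phi>_def iZ indicator_def)
    have "(\<lambda>\<omega>. H \<omega> * indicator {\<omega>. c \<le> inverse (Z \<omega>)} \<omega>) = (\<lambda>\<omega>. if c \<le> inverse (Z \<omega>) then H \<omega> else 0)"
      by (auto simp: indicator_def)
    then show "(\<lambda>\<omega>. H \<omega> * indicator {\<omega>. c \<le> inverse (Z \<omega>)} \<omega>) \<in> borel_measurable M" by simp
  qed measurable
  also have "\<dots> = S20 * exp ((\<beta>2 - 1 / 2 * \<sigma>2\<^sup>2) * T) * (\<integral>\<omega>. \<phi> (X \<omega>, Y \<omega>) \<partial>M)"
    by simp
  also have "(\<integral>\<omega>. \<phi> (X \<omega>, Y \<omega>) \<partial>M) = (LBINT x=ereal a..\<infinity>.
      (LBINT y=(ext_ln (ereal c) - ereal (b * T) - ereal (A1 * x)) / ereal A2..\<infinity>.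
      d x * exp (\<sigma>2 * y) * k x y * f x))"
    using linear_threshold[OF A2] by (intro cond_density_integral[OF f k _ I]) (auto simp: \<phi>_def)
  finally show ?thesis .
qed

text \<open>Both thresholds of the theorem at once. The power 1 / (p - 1) acts on the whole exponent
  of Z, hence \<open>b / (p - 1)\<close> in the time term. For c = 0 and a < x the quotient is
  \<infinity>, and division by the negative denominator turns it into -\<infinity>.\<close>

definition w :: "real \<Rightarrow> real \<Rightarrow> ereal" where
  "w p x = (ereal (A1 / (p - 1) * x) + ext_ln (ereal (S20 * d x) / ereal (c powr (1 / (p - 1))))
     + ereal ((b / (p - 1) + \<beta>2 - 1 / 2 * \<sigma>2\<^sup>2) * T)) / ereal (- (A2 / (p - 1) + \<sigma>2))"

text \<open>The region H > (c Z)^(1/(p-1)), where the test is positive, in the coordinates of X and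
  Y. On its boundary the two branches of the minimum in \<open>power_test\<close> agree.\<close>

definition exercise :: "real \<Rightarrow> real \<Rightarrow> real \<Rightarrow> bool" where
  "exercise p x y \<longleftrightarrow> a < x \<and> c powr (1 / (p - 1)) * exp (- (b * T / (p - 1))) * exp (- (1 / (p - 1)) * (A1 * x + A2 * y))
     < S20 * exp ((\<beta>2 - 1 / 2 * \<sigma>2\<^sup>2) * T) * (d x * exp (\<sigma>2 * y))"

text \<open>In logarithmic form the inequality is linear in y with coefficient A2 / (p - 1) +
  \<sigma>2. As this is positive, the region is an upper half-line in y, whatever the sign of
  A2.\<close>

lemma exercise_iff:
  assumes p: "1 < p" and D: "0 < A2 / (p - 1) + \<sigma>2" and x: "a < x"
  shows "exercise p x y \<longleftrightarrow> w p x < ereal y"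
proof -
  have d: "0 < d x" using x by (simp add: d_pos)
  show ?thesis
  proof (cases "c = 0")
    case True
    have inf: "ereal (S20 * d x) / ereal (c powr (1 / (p - 1))) = \<infinity>"
      using True d S20 by (simp add: divide_ereal_def)
    have wm: "w p x = - \<infinity>" unfolding w_def inf using D by (simp add: ext_ln_def divide_ereal_def)
    show ?thesis unfolding exercise_def wm using d S20 x by (simp add: True)
  next
    case False
    define C where "C = c powr (1 / (p - 1))"
    have C: "0 < C" using False c by (simp add: C_def)
    define E where "E = A2 / (p - 1) + \<sigma>2"
    define N where "N = A1 / (p - 1) * x + ln (S20 * d x / C) + (b / (p - 1) + \<beta>2 - 1 / 2 * \<sigma>2\<^sup>2) * T"
    have E: "0 < E" using D by (simp add: E_def)
    have "0 < S20 * d x / C" using C S20 d by simp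
    then have pos: "\<not> S20 * d x / C \<le> 0" by linarith
    have w: "w p x = ereal (N / (- E))"
      unfolding w_def C_def[symmetric] E_def[symmetric] N_def using C E by (simp add: ext_ln_def pos)
    define u where "u = - (b * T / (p - 1)) + - (1 / (p - 1)) * (A1 * x + A2 * y)"
    define v where "v = (\<beta>2 - 1 / 2 * \<sigma>2\<^sup>2) * T + \<sigma>2 * y"
    have "exercise p x y \<longleftrightarrow> C * exp u < S20 * d x * exp v"
      unfolding exercise_def C_def u_def v_def exp_add using x by (simp add: mult_ac)
    also have "\<dots> \<longleftrightarrow> exp u / exp v < S20 * d x / C"
      using C by (simp add: field_simps)
    also have "\<dots> \<longleftrightarrow> exp (u - v) < exp (ln (S20 * d x / C))"
      using C S20 d by (simp add: exp_diff)
    also have "\<dots> \<longleftrightarrow> u - v < ln (S20 * d x / C)" by simp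
    \<comment> \<open>N contains the same logarithm, which cancels; what remains is N + E y >
      0.\<close>
    also have "u - v = ln (S20 * d x / C) - N - E * y"
      by (simp add: u_def v_def N_def E_def algebra_simps add_divide_distrib diff_divide_distrib)
    also have "ln (S20 * d x / C) - N - E * y < ln (S20 * d x / C) \<longleftrightarrow> N / (- E) < y"
      using E by (auto simp: field_simps)
    finally show ?thesis by (simp add: w)
  qed
qed

section \<open>The power test along paths, and the power loss\<close>

lemma exercise_measurable [measurable]: "Measurable.pred (borel \<Otimes>\<^sub>M borel) (\<lambda>z. exercise p (fst z) (snd z))"
  unfolding exercise_def by measurable

lemma Z_powr: "(c * Z \<omega>) powr (1 / (p - 1))
  = c powr (1 / (p - 1)) * exp (- (b * T / (p - 1))) * exp (- (1 / (p - 1)) * (A1 * X \<omega> + A2 * Y \<omega>))"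
proof -
  have "(c * Z \<omega>) powr (1 / (p - 1)) = c powr (1 / (p - 1)) * exp ((1 / (p - 1)) * (- A1 * X \<omega> - A2 * Y \<omega> - b * T))"
    using c unfolding Z by (simp add: powr_mult exp_powr_real)
  also have "(1 / (p - 1)) * (- A1 * X \<omega> - A2 * Y \<omega> - b * T) = - (b * T / (p - 1)) + - (1 / (p - 1)) * (A1 * X \<omega> + A2 * Y \<omega>)"
    by (simp add: add_divide_distrib diff_divide_distrib algebra_simps)
  finally show ?thesis by (simp only: exp_add mult.assoc)
qed

text \<open>H times the test is the positive part of H - (c Z)^(1/(p-1)), and the remaining part of
  H is the minimum of the two. Where the first stock ends at or below the strike, H vanishes and
  both products are 0.\<close>

lemma power_test_mult_H:
  "AE \<omega> in M. H \<omega> * power_test p Z H c \<omega>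
    = (if exercise p (X \<omega>) (Y \<omega>) then S20 * exp ((\<beta>2 - 1 / 2 * \<sigma>2\<^sup>2) * T) * (d (X \<omega>) * exp (\<sigma>2 * Y \<omega>))
        - c powr (1 / (p - 1)) * exp (- (b * T / (p - 1))) * exp (- (1 / (p - 1)) * (A1 * X \<omega> + A2 * Y \<omega>)) else 0)"
  and power_test_mult_H':
  "AE \<omega> in M. (1 - power_test p Z H c \<omega>) * H \<omega>
    = (if \<not> a < X \<omega> then 0 else if exercise p (X \<omega>) (Y \<omega>)
       then c powr (1 / (p - 1)) * exp (- (b * T / (p - 1))) * exp (- (1 / (p - 1)) * (A1 * X \<omega> + A2 * Y \<omega>))
       else S20 * exp ((\<beta>2 - 1 / 2 * \<sigma>2\<^sup>2) * T) * (d (X \<omega>) * exp (\<sigma>2 * Y \<omega>)))"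
proof -
  define g where "g \<omega> = c powr (1 / (p - 1)) * exp (- (b * T / (p - 1))) * exp (- (1 / (p - 1)) * (A1 * X \<omega> + A2 * Y \<omega>))" for \<omega>
  define h where "h \<omega> = S20 * exp ((\<beta>2 - 1 / 2 * \<sigma>2\<^sup>2) * T) * (d (X \<omega>) * exp (\<sigma>2 * Y \<omega>))" for \<omega>
  have h: "0 < h \<omega>" if "a < X \<omega>" for \<omega> using that S20 by (simp add: h_def d_pos)
  have ex: "exercise p (X \<omega>) (Y \<omega>) \<longleftrightarrow> a < X \<omega> \<and> g \<omega> < h \<omega>" for \<omega>
    by (simp add: exercise_def g_def h_def)
  have H: "AE \<omega> in M. H \<omega> = (if a < X \<omega> then h \<omega> else 0)" using H_eq unfolding h_def .
  have pt: "power_test p Z H c \<omega> = (1 - min (g \<omega> / H \<omega>) 1) * indicator {\<omega>. 0 < H \<omega>} \<omega>" for \<omega>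
    unfolding power_test_def Z_powr g_def ..
  \<comment> \<open>Multiplying the minimum in the test by a positive payoff clears the
    quotient.\<close>
  have *: "h \<omega> * min (g \<omega> / h \<omega>) 1 = min (g \<omega>) (h \<omega>)" if "0 < h \<omega>" for \<omega>
    using that by (simp add: min_def field_simps)
  have "AE \<omega> in M. H \<omega> * power_test p Z H c \<omega> = (if exercise p (X \<omega>) (Y \<omega>) then h \<omega> - g \<omega> else 0)"
    using H
  proof eventually_elim
    case (elim \<omega>)
    show ?case
    proof (cases "a < X \<omega>")
      case True
      then have "H \<omega> * power_test p Z H c \<omega> = h \<omega> - h \<omega> * min (g \<omega> / h \<omega>) 1"
        using elim h by (simp add: pt right_diff_distrib)
      then show ?thesis using True h by (simp add: * ex)
    qed (use elim in \<open>simp add: ex\<close>)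
  qed
  then show "AE \<omega> in M. H \<omega> * power_test p Z H c \<omega>
    = (if exercise p (X \<omega>) (Y \<omega>) then S20 * exp ((\<beta>2 - 1 / 2 * \<sigma>2\<^sup>2) * T) * (d (X \<omega>) * exp (\<sigma>2 * Y \<omega>))
        - c powr (1 / (p - 1)) * exp (- (b * T / (p - 1))) * exp (- (1 / (p - 1)) * (A1 * X \<omega> + A2 * Y \<omega>)) else 0)"
    by (simp only: g_def h_def)
  have "AE \<omega> in M. (1 - power_test p Z H c \<omega>) * H \<omega> = (if \<not> a < X \<omega> then 0 else if exercise p (X \<omega>) (Y \<omega>) then g \<omega> else h \<omega>)"
    using H
  proof eventually_elim
    case (elim \<omega>)
    show ?case
    proof (cases "a < X \<omega>")
      case True
      then have "(1 - power_test p Z H c \<omega>) * H \<omega> = h \<omega> * min (g \<omega> / h \<omega>) 1"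
        using elim h by (simp add: pt mult.commute)
      then show ?thesis using True h by (simp add: * ex)
    qed (use elim in simp)
  qed
  then show "AE \<omega> in M. (1 - power_test p Z H c \<omega>) * H \<omega>
    = (if \<not> a < X \<omega> then 0 else if exercise p (X \<omega>) (Y \<omega>)
       then c powr (1 / (p - 1)) * exp (- (b * T / (p - 1))) * exp (- (1 / (p - 1)) * (A1 * X \<omega> + A2 * Y \<omega>))
       else S20 * exp ((\<beta>2 - 1 / 2 * \<sigma>2\<^sup>2) * T) * (d (X \<omega>) * exp (\<sigma>2 * Y \<omega>)))"
    by (simp only: g_def h_def)
qed

lemma power_test_measurable [measurable]: "power_test p Z H c \<in> borel_measurable M"
proof -
  have "power_test p Z H c = (\<lambda>\<omega>. if 0 < H \<omega> then 1 - min ((c * Z \<omega>) powr (1 / (p - 1)) / H \<omega>) 1 else 0)"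
    by (auto simp: power_test_def fun_eq_iff)
  then show ?thesis by simp
qed

lemma exercise_payoff_integrable:
  "integrable M (\<lambda>\<omega>. if exercise p (X \<omega>) (Y \<omega>) then exp (\<sigma>2 * Y \<omega>) * d (X \<omega>) else 0)"
proof -
  have "integrable M (\<lambda>\<omega>. (\<lambda>z. if exercise p (fst z) (snd z) then exp (\<sigma>2 * snd z) * d (fst z) else 0) (X \<omega>, Y \<omega>))"
  proof (rule integrable_exp_bound)
    fix x y
    have "d x * exp (\<sigma>2 * y) \<le> S10 * exp ((\<beta>1 - 1 / 2 * \<sigma>1\<^sup>2) * T) * exp (\<sigma>1 * x) * exp (\<sigma>2 * y)"
      by (intro mult_right_mono d_le) simp
    then show "\<bar>if exercise p (fst (x, y)) (snd (x, y)) then exp (\<sigma>2 * snd (x, y)) * d (fst (x, y)) else 0\<bar>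
        \<le> (S10 * exp ((\<beta>1 - 1 / 2 * \<sigma>1\<^sup>2) * T)) * exp (\<sigma>1 * x + \<sigma>2 * y)"
      using d_pos[of x] S10 by (auto simp: exercise_def exp_add mult_ac abs_mult)
  qed measurable
  then show ?thesis by (simp only: fst_conv snd_conv)
qed

lemma exercise_exp_integrable:
  "integrable M (\<lambda>\<omega>. if exercise p (X \<omega>) (Y \<omega>) then exp (u * X \<omega> + v * Y \<omega>) else 0)"
proof -
  have "integrable M (\<lambda>\<omega>. (\<lambda>z. if exercise p (fst z) (snd z) then exp (u * fst z + v * snd z) else 0) (X \<omega>, Y \<omega>))"
  proof (rule integrable_exp_bound)
    show "\<bar>if exercise p (fst (x, y)) (snd (x, y)) then exp (u * fst (x, y) + v * snd (x, y)) else 0\<bar>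
        \<le> 1 * exp (u * x + v * y)" for x y by simp
  qed measurable
  then show ?thesis by (simp only: fst_conv snd_conv)
qed

lemma exercise_integral:
  assumes p: "1 < p" and D: "0 < A2 / (p - 1) + \<sigma>2"
    and [measurable]: "(\<lambda>z. \<Phi> (fst z) (snd z)) \<in> borel_measurable (borel \<Otimes>\<^sub>M borel)"
    and I: "integrable M (\<lambda>\<omega>. if exercise p (X \<omega>) (Y \<omega>) then \<Phi> (X \<omega>) (Y \<omega>) else 0)"
  shows "(\<integral>\<omega>. (if exercise p (X \<omega>) (Y \<omega>) then \<Phi> (X \<omega>) (Y \<omega>) else 0) \<partial>M)
    = (LBINT x=ereal a..\<infinity>. (LBINT y=w p x..\<infinity>. \<Phi> x y * k x y * f x))"
proof -
  define \<phi> where "\<phi> z = (if exercise p (fst z) (snd z) then \<Phi> (fst z) (snd z) else 0)" for z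
  have [measurable]: "\<phi> \<in> borel_measurable (borel \<Otimes>\<^sub>M borel)" unfolding \<phi>_def by measurable
  have "(\<integral>\<omega>. \<phi> (X \<omega>, Y \<omega>) \<partial>M) = (LBINT x=ereal a..\<infinity>. (LBINT y=w p x..\<infinity>. \<Phi> x y * k x y * f x))"
  proof (rule cond_density_integral[OF f k])
    show "integrable M (\<lambda>\<omega>. \<phi> (X \<omega>, Y \<omega>))" using I by (simp only: \<phi>_def fst_conv snd_conv)
    show "\<phi> (x, y) = (if a < x \<and> w p x < ereal y then \<Phi> x y else 0)" for x y
      using exercise_iff[OF p D, of x y] by (auto simp: \<phi>_def exercise_def[of p x y])
  qed measurable
  then show ?thesis by (simp only: \<phi>_def fst_conv snd_conv)
qed

lemma power_risk2_eq:
  assumes p: "1 < p" and D: "0 < A2 / (p - 1) + \<sigma>2"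
  shows "power_risk2 M p Z H c =
    S20 * exp ((\<beta>2 - 1 / 2 * \<sigma>2\<^sup>2) * T) *
      (LBINT x=ereal a..\<infinity>. (LBINT y=w p x..\<infinity>. exp (\<sigma>2 * y) * d x * k x y * f x))
    - c powr (1 / (p - 1)) * exp (- (b * T / (p - 1))) *
      (LBINT x=ereal a..\<infinity>. (LBINT y=w p x..\<infinity>. exp (- (1 / (p - 1)) * (A1 * x + A2 * y)) * k x y * f x))"
proof -
  define g where "g \<omega> = (if exercise p (X \<omega>) (Y \<omega>) then exp (\<sigma>2 * Y \<omega>) * d (X \<omega>) else 0)" for \<omega>
  define h where "h \<omega> = (if exercise p (X \<omega>) (Y \<omega>) then exp (- (1 / (p - 1)) * (A1 * X \<omega> + A2 * Y \<omega>)) else 0)" for \<omega>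
  have g: "integrable M g" unfolding g_def by (rule exercise_payoff_integrable)
  have h: "integrable M h"
    using exercise_exp_integrable[of p "- (1 / (p - 1)) * A1" "- (1 / (p - 1)) * A2"]
    unfolding h_def by (simp only: distrib_left mult.assoc)
  have "power_risk2 M p Z H c = (\<integral>\<omega>. S20 * exp ((\<beta>2 - 1 / 2 * \<sigma>2\<^sup>2) * T) * g \<omega>
      - c powr (1 / (p - 1)) * exp (- (b * T / (p - 1))) * h \<omega> \<partial>M)"
    unfolding power_risk2_def
  proof (rule integral_cong_AE)
    show "AE \<omega> in M. H \<omega> * power_test p Z H c \<omega> = S20 * exp ((\<beta>2 - 1 / 2 * \<sigma>2\<^sup>2) * T) * g \<omega>
      - c powr (1 / (p - 1)) * exp (- (b * T / (p - 1))) * h \<omega>"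
      using power_test_mult_H[of p] by eventually_elim (simp add: g_def h_def mult_ac)
  qed (use g h in auto)
  also have "\<dots> = S20 * exp ((\<beta>2 - 1 / 2 * \<sigma>2\<^sup>2) * T) * integral\<^sup>L M g
      - c powr (1 / (p - 1)) * exp (- (b * T / (p - 1))) * integral\<^sup>L M h"
    using g h by simp
  also have "integral\<^sup>L M g = (LBINT x=ereal a..\<infinity>. (LBINT y=w p x..\<infinity>. exp (\<sigma>2 * y) * d x * k x y * f x))"
    using g unfolding g_def by (intro exercise_integral[OF p D]) measurable
  also have "integral\<^sup>L M h = (LBINT x=ereal a..\<infinity>. (LBINT y=w p x..\<infinity>. exp (- (1 / (p - 1)) * (A1 * x + A2 * y)) * k x y * f x))"
    using h unfolding h_def by (intro exercise_integral[OF p D]) measurable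
  finally show ?thesis .
qed

text \<open>Outside the exercise region the integrand is the p-th power of the payoff. It is written
  as its restriction to a < X minus the part inside the region, so that only upper half-lines in y
  occur; this is the difference of integrals in the formula. Domination by exponentials makes each
  piece integrable, so that they may be separated.\<close>

lemma power_risk1_eq:
  assumes p: "1 < p" and D: "0 < A2 / (p - 1) + \<sigma>2"
  shows "power_risk1 M p Z H c =
    S20 powr p * exp ((\<beta>2 - 1 / 2 * \<sigma>2\<^sup>2) * p * T) / p *
      ((LBINT x=ereal a..\<infinity>. (LBINT y=-\<infinity>..\<infinity>. exp (p * \<sigma>2 * y) * d x powr p * k x y * f x))
       - (LBINT x=ereal a..\<infinity>. (LBINT y=w p x..\<infinity>. exp (p * \<sigma>2 * y) * d x powr p * k x y * f x)))
    + c powr (p / (p - 1)) * exp (- (b * T * p / (p - 1))) / p *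
      (LBINT x=ereal a..\<infinity>. (LBINT y=w p x..\<infinity>.
        exp (- (A1 * p / (p - 1) * x + A2 * p / (p - 1) * y)) * k x y * f x))"
proof -
  define g0 where "g0 z = (if a < fst z then exp (p * \<sigma>2 * snd z) * d (fst z) powr p else 0)" for z :: "real \<times> real"
  define g where "g \<omega> = (if exercise p (X \<omega>) (Y \<omega>) then exp (p * \<sigma>2 * Y \<omega>) * d (X \<omega>) powr p else 0)" for \<omega>
  define h where "h \<omega> = (if exercise p (X \<omega>) (Y \<omega>) then exp (- (A1 * p / (p - 1) * X \<omega> + A2 * p / (p - 1) * Y \<omega>)) else 0)" for \<omega>
  define C1 where "C1 = S20 powr p * exp ((\<beta>2 - 1 / 2 * \<sigma>2\<^sup>2) * p * T)"
  define C2 where "C2 = c powr (p / (p - 1)) * exp (- (b * T * p / (p - 1)))"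
  have [measurable]: "g0 \<in> borel_measurable (borel \<Otimes>\<^sub>M borel)" unfolding g0_def by measurable
  have bound: "exp (p * \<sigma>2 * y) * d x powr p
      \<le> (S10 * exp ((\<beta>1 - 1 / 2 * \<sigma>1\<^sup>2) * T)) powr p * exp (p * \<sigma>1 * x + p * \<sigma>2 * y)" if "a < x" for x y
  proof -
    have "d x powr p \<le> (S10 * exp ((\<beta>1 - 1 / 2 * \<sigma>1\<^sup>2) * T) * exp (\<sigma>1 * x)) powr p"
      using d_le d_pos[of x] that p by (intro powr_mono2) auto
    also have "\<dots> = (S10 * exp ((\<beta>1 - 1 / 2 * \<sigma>1\<^sup>2) * T)) powr p * exp (p * \<sigma>1 * x)"
      using S10 by (simp add: powr_mult exp_powr_real mult_ac)
    finally show ?thesis by (simp add: exp_add mult_ac)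
  qed
  have g0: "integrable M (\<lambda>\<omega>. g0 (X \<omega>, Y \<omega>))"
    using bound by (intro integrable_exp_bound) (auto simp: g0_def)
  have g: "integrable M g"
    unfolding g_def
    by (rule Bochner_Integration.integrable_bound[OF g0]) (auto simp: g0_def exercise_def)
  have "- (A1 * p / (p - 1)) * x + - (A2 * p / (p - 1)) * y = - (A1 * p / (p - 1) * x + A2 * p / (p - 1) * y)" for x y
    by simp
  then have h: "integrable M h"
    using exercise_exp_integrable[of p "- (A1 * p / (p - 1))" "- (A2 * p / (p - 1))"]
    unfolding h_def by (simp only:)
  have "power_risk1 M p Z H c = 1 / p * (\<integral>\<omega>. C1 * (g0 (X \<omega>, Y \<omega>) - g \<omega>) + C2 * h \<omega> \<partial>M)"
    unfolding power_risk1_def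
  proof (intro arg_cong2[where f="(*)"] refl integral_cong_AE)
    show "AE \<omega> in M. ((1 - power_test p Z H c \<omega>) * H \<omega>) powr p = C1 * (g0 (X \<omega>, Y \<omega>) - g \<omega>) + C2 * h \<omega>"
      using power_test_mult_H'[of p]
    proof eventually_elim
      case (elim \<omega>)
      have payoff_powr: "(S20 * exp ((\<beta>2 - 1 / 2 * \<sigma>2\<^sup>2) * T) * (d (X \<omega>) * exp (\<sigma>2 * Y \<omega>))) powr p
        = C1 * (exp (p * \<sigma>2 * Y \<omega>) * d (X \<omega>) powr p)" if "a < X \<omega>"
      proof -
        have "0 \<le> d (X \<omega>)" using that d_pos[of "X \<omega>"] by simp
        then show ?thesis using S20 by (simp add: powr_mult exp_powr_real C1_def mult_ac)
      qed
      have Z_powr_p: "(c powr (1 / (p - 1)) * exp (- (b * T / (p - 1))) * exp (- (1 / (p - 1)) * (A1 * X \<omega> + A2 * Y \<omega>))) powr p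
        = C2 * exp (- (A1 * p / (p - 1) * X \<omega> + A2 * p / (p - 1) * Y \<omega>))"
      proof -
        have "p * (- (1 / (p - 1)) * (A1 * X \<omega> + A2 * Y \<omega>)) = - (A1 * p / (p - 1) * X \<omega> + A2 * p / (p - 1) * Y \<omega>)"
          by (simp add: add_divide_distrib algebra_simps)
        then show ?thesis
          by (simp add: powr_mult exp_powr_real powr_powr C2_def mult_ac del: mult_minus_left)
      qed
      consider "\<not> a < X \<omega>" | "a < X \<omega>" "exercise p (X \<omega>) (Y \<omega>)" | "a < X \<omega>" "\<not> exercise p (X \<omega>) (Y \<omega>)" by blast
      then show ?case
      proof cases
        case 1
        then have "\<not> exercise p (X \<omega>) (Y \<omega>)" by (simp add: exercise_def)
        with 1 show ?thesis unfolding elim by (simp add: g0_def g_def h_def)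
      next
        case 2
        then have "((1 - power_test p Z H c \<omega>) * H \<omega>) powr p
            = C2 * exp (- (A1 * p / (p - 1) * X \<omega> + A2 * p / (p - 1) * Y \<omega>))"
          unfolding elim by (simp only: not_True_eq_False if_False if_True Z_powr_p)
        then show ?thesis using 2 by (simp add: g0_def g_def h_def)
      next
        case 3
        then show ?thesis unfolding elim using payoff_powr by (simp add: g0_def g_def h_def)
      qed
    qed
  qed (use g0 g h in auto)
  also have "\<dots> = C1 / p * ((\<integral>\<omega>. g0 (X \<omega>, Y \<omega>) \<partial>M) - integral\<^sup>L M g) + C2 / p * integral\<^sup>L M h"
    using g0 g h by (simp add: algebra_simps)
  \<comment> \<open>Here the threshold in \<open>cond_density_integral\<close> is constantly
    -\<infinity>.\<close>
  also have "(\<integral>\<omega>. g0 (X \<omega>, Y \<omega>) \<partial>M) = (LBINT x=ereal a..\<infinity>. (LBINT y=-\<infinity>..\<infinity>. exp (p * \<sigma>2 * y) * d x powr p * k x y * f x))"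
    by (rule cond_density_integral[OF f k _ g0]) (auto simp: g0_def)
  also have "integral\<^sup>L M g = (LBINT x=ereal a..\<infinity>. (LBINT y=w p x..\<infinity>. exp (p * \<sigma>2 * y) * d x powr p * k x y * f x))"
    using g unfolding g_def by (intro exercise_integral[OF p D]) measurable
  also have "integral\<^sup>L M h = (LBINT x=ereal a..\<infinity>. (LBINT y=w p x..\<infinity>.
        exp (- (A1 * p / (p - 1) * x + A2 * p / (p - 1) * y)) * k x y * f x))"
    using h unfolding h_def by (intro exercise_integral[OF p D]) measurable
  finally show ?thesis unfolding C1_def C2_def .
qed

end

theorem mainTheorem5:
  fixes P Pt :: "'a measure" and F :: "real \<Rightarrow> 'a measure"
    and W1 W2 Wt1 Wt2 S1 S2 :: "real \<Rightarrow> 'a \<Rightarrow> real" and Z H :: "'a \<Rightarrow> real"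
    and T r \<rho> \<alpha>1 \<alpha>2 \<sigma>1 \<sigma>2 \<theta>1 \<theta>2 S10 S20 A1 A2 B Bt K c a1 at1 :: real
    and Q :: "real^2^2" and \<theta> A :: "real^2"
    and f1 ft1 :: "real \<Rightarrow> real" and f21 ft21 :: "real \<Rightarrow> real \<Rightarrow> real"
  assumes "T > 0" and "\<sigma>1 > 0" and "\<sigma>2 > 0" and "S10 > 0" and "S20 > 0" and "K > 0" and "c \<ge> 0"
    and Q: "Q = vector [vector [1, \<rho>], vector [\<rho>, 1]]" "positive_definite Q"
    and W: "wiener2 P F T Q W1 W2"
    and S1: "solves_sde P F T W1 (\<lambda>x. \<alpha>1 * x) (\<lambda>x. \<sigma>1 * x) S10 S1"
    and S2: "solves_sde P F T W2 (\<lambda>x. \<alpha>2 * x) (\<lambda>x. \<sigma>2 * x) S20 S2"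
    and \<theta>: "\<theta>1 = (\<alpha>1 - r) / \<sigma>1" "\<theta>2 = (\<alpha>2 - r) / \<sigma>2" "\<theta> = vector [\<theta>1, \<theta>2]"
    and A: "A = matrix_inv Q *v \<theta>" "A1 = A $ 1" "A2 = A $ 2"
    and B: "B = 1 / 2 * (norm (matrix_inv_sqrt Q *v \<theta>))\<^sup>2"
    and Bt: "Bt = B - A1 * \<theta>1 - A2 * \<theta>2"
    and Z: "Z = (\<lambda>\<omega>. exp (- A1 * W1 T \<omega> - A2 * W2 T \<omega> - B * T))"
    and Pt: "Pt = density P (\<lambda>\<omega>. ennreal (Z \<omega>))"
    and Wt: "Wt1 = (\<lambda>t \<omega>. W1 t \<omega> + \<theta>1 * t)" "Wt2 = (\<lambda>t \<omega>. W2 t \<omega> + \<theta>2 * t)"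
    and f: "is_density P (W1 T) f1" "is_cond_density P (W2 T) (W1 T) f21"
    and ft: "is_density Pt (Wt1 T) ft1" "is_cond_density Pt (Wt2 T) (Wt1 T) ft21"
    and a1: "a1 = 1 / \<sigma>1 * (ln (K / S10) - (\<alpha>1 - 1 / 2 * \<sigma>1\<^sup>2) * T)"
    and at1: "at1 = 1 / \<sigma>1 * (ln (K / S10) - (r - 1 / 2 * \<sigma>1\<^sup>2) * T)"
    and H: "H = (\<lambda>\<omega>. S2 T \<omega> * max (S1 T \<omega> - K) 0)"
  shows
    "(A2 > 0 \<longrightarrow>
       linear_risk P Z H c =
         S20 * exp ((\<alpha>2 - 1 / 2 * \<sigma>2\<^sup>2) * T) *
         (LBINT x=ereal a1..\<infinity>.
           (LBINT y=(ext_ln (ereal c) - ereal (B * T) - ereal (A1 * x)) / ereal A2..\<infinity>.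
             (S10 * exp ((\<alpha>1 - 1 / 2 * \<sigma>1\<^sup>2) * T + \<sigma>1 * x) - K) * exp (\<sigma>2 * y)
             * f21 x y * f1 x)) \<and>
       linear_risk Pt Z H c =
         S20 * exp ((r - 1 / 2 * \<sigma>2\<^sup>2) * T) *
         (LBINT x=ereal at1..\<infinity>.
           (LBINT y=(ext_ln (ereal c) - ereal (Bt * T) - ereal (A1 * x)) / ereal A2..\<infinity>.
             (S10 * exp ((r - 1 / 2 * \<sigma>1\<^sup>2) * T + \<sigma>1 * x) - K) * exp (\<sigma>2 * y)
             * ft21 x y) * ft1 x))
     \<and>
     (\<forall>p>1. A2 / (p - 1) + \<sigma>2 > 0 \<longrightarrow>
       (let w = (\<lambda>x.
              (ereal (A1 / (p - 1) * x)
               + ext_ln (ereal (S20 * (S10 * exp ((\<alpha>1 - 1 / 2 * \<sigma>1\<^sup>2) * T + \<sigma>1 * x) - K))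
                         / ereal (c powr (1 / (p - 1))))
               + ereal ((B / (p - 1) + \<alpha>2 - 1 / 2 * \<sigma>2\<^sup>2) * T))
              / ereal (- (A2 / (p - 1) + \<sigma>2)));
            wt = (\<lambda>x.
              (ereal (A1 / (p - 1) * x)
               + ext_ln (ereal (S20 * (S10 * exp ((r - 1 / 2 * \<sigma>1\<^sup>2) * T + \<sigma>1 * x) - K))
                         / ereal (c powr (1 / (p - 1))))
               + ereal ((Bt / (p - 1) + r - 1 / 2 * \<sigma>2\<^sup>2) * T))
              / ereal (- (A2 / (p - 1) + \<sigma>2)));
            g = (\<lambda>x y. exp (p * \<sigma>2 * y)
              * (S10 * exp ((\<alpha>1 - 1 / 2 * \<sigma>1\<^sup>2) * T + \<sigma>1 * x) - K) powr p * f21 x y * f1 x)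
        in
          power_risk1 P p Z H c =
            S20 powr p * exp ((\<alpha>2 - 1 / 2 * \<sigma>2\<^sup>2) * p * T) / p *
              ((LBINT x=ereal a1..\<infinity>. (LBINT y=-\<infinity>..\<infinity>. g x y))
               - (LBINT x=ereal a1..\<infinity>. (LBINT y=w x..\<infinity>. g x y)))
            + c powr (p / (p - 1)) * exp (- (B * T * p / (p - 1))) / p *
              (LBINT x=ereal a1..\<infinity>. (LBINT y=w x..\<infinity>.
                exp (- (A1 * p / (p - 1) * x + A2 * p / (p - 1) * y)) * f21 x y * f1 x)) \<and>
          power_risk2 Pt p Z H c =
            S20 * exp ((r - 1 / 2 * \<sigma>2\<^sup>2) * T) *
              (LBINT x=ereal at1..\<infinity>. (LBINT y=wt x..\<infinity>.
                exp (\<sigma>2 * y) * (S10 * exp ((r - 1 / 2 * \<sigma>1\<^sup>2) * T + \<sigma>1 * x) - K)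
                * ft21 x y * ft1 x))
            - c powr (1 / (p - 1)) * exp (- (Bt * T / (p - 1))) *
              (LBINT x=ereal at1..\<infinity>. (LBINT y=wt x..\<infinity>.
                exp (- (1 / (p - 1)) * (A1 * x + A2 * y)) * ft21 x y * ft1 x))))"
proof -
  interpret W1: scalar_wiener P F T W1 by (rule wiener2_scalar_wiener(1)[OF W Q])
  interpret W2: scalar_wiener P F T W2 by (rule wiener2_scalar_wiener(2)[OF W Q])
  interpret S1: linear_sde P F T W1 \<alpha>1 \<sigma>1 S10 S1 by unfold_locales (fact assms)+
  interpret S2: linear_sde P F T W2 \<alpha>2 \<sigma>2 S20 S2 by unfold_locales (fact assms)+
  have T: "T \<in> {0..T}" using \<open>T > 0\<close> by simp
  have [measurable]: "W1 T \<in> borel_measurable P" "W2 T \<in> borel_measurable P"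
    "S1 T \<in> borel_measurable P" "S2 T \<in> borel_measurable P"
    using W1.W_measurable[of T] W2.W_measurable[of T] S1.S_measurable[OF T] S2.S_measurable[OF T] T by auto
  have [measurable]: "Z \<in> borel_measurable P" "H \<in> borel_measurable P" unfolding Z H by measurable
  \<comment> \<open>The estimate exp (x + y) \<le> exp (2 x) + exp (2 y) reduces joint exponential
    moments to those of the single coordinates.\<close>
  have exp_P: "integrable P (\<lambda>\<omega>. exp (u * W1 T \<omega> + v * W2 T \<omega>))" for u v
  proof (rule Bochner_Integration.integrable_bound)
    show "integrable P (\<lambda>\<omega>. exp (2 * u * W1 T \<omega>) + exp (2 * v * W2 T \<omega>))"
      using W1.W_exp[of T "2 * u"] W2.W_exp[of T "2 * v"] T by (auto simp: has_bochner_integral_iff)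
    have "exp (x + y) \<le> exp (2 * x) + exp (2 * y)" for x y :: real
    proof -
      have "exp (x + y) \<le> exp (2 * max x y)" by (auto simp: max_def)
      then show ?thesis by (smt (verit) exp_ge_zero max_def)
    qed
    from this[of "u * W1 T \<omega>" "v * W2 T \<omega>" for \<omega>]
    show "AE \<omega> in P. norm (exp (u * W1 T \<omega> + v * W2 T \<omega>)) \<le> norm (exp (2 * u * W1 T \<omega>) + exp (2 * v * W2 T \<omega>))"
      by (simp add: mult.assoc abs_of_nonneg)
  qed measurable
  have H_P: "AE \<omega> in P. H \<omega> = S20 * exp ((\<alpha>2 - 1 / 2 * \<sigma>2\<^sup>2) * T + \<sigma>2 * W2 T \<omega>)
      * max (S10 * exp ((\<alpha>1 - 1 / 2 * \<sigma>1\<^sup>2) * T + \<sigma>1 * W1 T \<omega>) - K) 0"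
    using S1.S_eq_G S2.S_eq_G by eventually_elim (simp add: H S1.G_def S2.G_def)
  interpret O: quanto_option P "W1 T" "W2 T" Z H f1 f21 T \<sigma>1 \<sigma>2 S10 S20 K A1 A2 B \<alpha>1 \<alpha>2 c a1
    by unfold_locales (use assms exp_P H_P in \<open>auto simp: Z[THEN fun_cong]\<close>)
  have \<theta>_\<sigma>: "\<sigma>1 * \<theta>1 = \<alpha>1 - r" "\<sigma>2 * \<theta>2 = \<alpha>2 - r"
    using \<theta>(1,2) \<open>\<sigma>1 > 0\<close> \<open>\<sigma>2 > 0\<close> by simp_all
  \<comment> \<open>The density Z is itself an exponential of a linear form, so the integral is
    moved back to P, where the exponents u and v are shifted by A1 and A2.\<close>
  have exp_Pt: "integrable Pt (\<lambda>\<omega>. exp (u * Wt1 T \<omega> + v * Wt2 T \<omega>))" for u v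
  proof -
    have "Z \<omega> * exp (u * Wt1 T \<omega> + v * Wt2 T \<omega>)
        = exp (- B * T + u * \<theta>1 * T + v * \<theta>2 * T) * exp ((u - A1) * W1 T \<omega> + (v - A2) * W2 T \<omega>)" for \<omega>
      unfolding Z Wt exp_add[symmetric] by (simp add: algebra_simps)
    moreover have "integrable P (\<lambda>\<omega>. exp (- B * T + u * \<theta>1 * T + v * \<theta>2 * T) * exp ((u - A1) * W1 T \<omega> + (v - A2) * W2 T \<omega>))"
      using exp_P by simp
    ultimately show ?thesis
      unfolding Pt by (subst integrable_real_density) (auto simp: Z Wt)
  qed
  \<comment> \<open>The payoff is the same function on paths: since \<sigma>_i \<theta>_i =
    \<alpha>_i - r, replacing W_i by Wt_i exchanges the rate \<alpha>_i for r. Almost sure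
    statements carry over because Pt has a density with respect to P.\<close>
  have H_Pt: "AE \<omega> in Pt. H \<omega> = S20 * exp ((r - 1 / 2 * \<sigma>2\<^sup>2) * T + \<sigma>2 * Wt2 T \<omega>)
      * max (S10 * exp ((r - 1 / 2 * \<sigma>1\<^sup>2) * T + \<sigma>1 * Wt1 T \<omega>) - K) 0"
  proof -
    have "(r - 1 / 2 * \<sigma>2\<^sup>2) * T + \<sigma>2 * Wt2 T \<omega> = (\<alpha>2 - 1 / 2 * \<sigma>2\<^sup>2) * T + \<sigma>2 * W2 T \<omega>"
      "(r - 1 / 2 * \<sigma>1\<^sup>2) * T + \<sigma>1 * Wt1 T \<omega> = (\<alpha>1 - 1 / 2 * \<sigma>1\<^sup>2) * T + \<sigma>1 * W1 T \<omega>" for \<omega>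
      using arg_cong[OF \<theta>_\<sigma>(1), of "\<lambda>x. x * T"] arg_cong[OF \<theta>_\<sigma>(2), of "\<lambda>x. x * T"]
      by (simp_all add: Wt algebra_simps)
    with H_P show ?thesis unfolding Pt by (subst AE_density) auto
  qed
  \<comment> \<open>Substituting W_i T = Wt_i T - \<theta>_i T moves A_i \<theta>_i T into the time
    term, which is what Bt collects.\<close>
  have Z_Pt: "Z \<omega> = exp (- A1 * Wt1 T \<omega> - A2 * Wt2 T \<omega> - Bt * T)" for \<omega>
    by (simp add: Z Wt Bt algebra_simps)
  interpret Ot: quanto_option Pt "Wt1 T" "Wt2 T" Z H ft1 ft21 T \<sigma>1 \<sigma>2 S10 S20 K A1 A2 Bt r r c at1
  proof unfold_locales
    show "H \<in> borel_measurable Pt" by (simp add: Pt)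
  qed (fact assms exp_Pt H_Pt Z_Pt)+
  \<comment> \<open>The density of the outer variable stands outside the inner integral in one
    formula and inside it in the others; \<open>interval_lebesgue_integral_mult_left\<close>
    normalises facts and goal alike.\<close>
  show ?thesis
    unfolding Let_def
    using O.linear_risk_eq Ot.linear_risk_eq O.power_risk1_eq Ot.power_risk2_eq
    unfolding O.d_def Ot.d_def O.w_def Ot.w_def interval_lebesgue_integral_mult_left
    by blast
qed

end
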